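(* Let $a$, $k$, $m$ be positive integers. Then $$\chi(M^s_{(1\cdot a,1\cdot(ka+1))}(\mathcal{N}_m))=m^{(k+1)a}\,\frac{(ka)!}{ka+1}\left(\frac{ka+1}{k!}\right)^{a}.$$
   Context: All representations are over $\mathbb{C}$. $\mathcal{N}_m$ is the bipartite quiver with sources $I=\{i_{l,n}\mid l,n\ge1\}$, sinks $J=\{j_{l,n}\mid l,n\ge 1\}$ and $m\cdot p\cdot q$ arrows from $i_{p,s}$ to $j_{q,t}$ for all $p,q,s,t$. Its level function is $l(i_{l,n})=l(j_{l,n})=l$. The slope of a nonzero (finitely supported) dimension vector $d$ is $\mu(d)=\frac{\sum_{i\in I}l(i)d_i}{\sum_{q\in I\cup J}l(q)d_q}$; a representation $X$ is stable if $\mu(\underline{\dim}\,U)<\mu(\underline{\dim}\,X)$ for all proper nonzero subrepresentations $U$. For a dimension vector $d$, $M^s_d(\mathcal{N}_m)$ is the moduli space of stable representations of $\mathcal N_m$ of dimension vector $d$, and $\chi$ is the Euler characteristic in singular cohomology. The trivial partition $(1\cdot a,1\cdot b)$ denotes the dimension vector with $d_{i_{1,n}}=1$ for $1\le n\le a$, $d_{j_{1,n}}=1$ for $1\le n\le b$, and all other entries $0$. So, concretely, one considers representations of dimension $1$ at every vertex of the quiver with $a$ sources, $b$ sinks and $m$ arrows from each source to each sink, with slope $\mu(d)=\frac{\sum_{\text{sources}}d_i}{\sum_{\text{all}}d_q}$. *)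

theory Defs
  imports
    "HOL-Homology.Homology"
    "HOL-Library.Function_Algebras"
    "Graph_Theory.Digraph"
begin

section \<open>Spaces of functions as vector spaces\<close>

definition fun_scale :: "'k::field \<Rightarrow> ('x \<Rightarrow> 'k) \<Rightarrow> 'x \<Rightarrow> 'k"  (infixr \<open>*\<^sub>f\<close> 75)
  where "c *\<^sub>f f = (\<lambda>x. c * f x)"

global_interpretation fun_space: vector_space fun_scale
  by standard (auto simp: fun_scale_def fun_eq_iff algebra_simps)

text \<open>
  \<open>has_quotient_dim Z B n\<close>: the quotient \<open>Z / B\<close> of a subspace \<open>Z\<close> by a subspace \<open>B \<subseteq> Z\<close> has
  a basis consisting of the classes of \<open>n\<close> elements of \<open>Z\<close>.
\<close>
definition has_quotient_dim :: "('x \<Rightarrow> 'k::field) set \<Rightarrow> ('x \<Rightarrow> 'k) set \<Rightarrow> nat \<Rightarrow> bool" where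
  "has_quotient_dim Z B n \<longleftrightarrow>
    (\<exists>S. S \<subseteq> Z \<and> finite S \<and> card S = n \<and>
         (\<forall>u. (\<Sum>s\<in>S. u s *\<^sub>f s) \<in> B \<longrightarrow> (\<forall>s\<in>S. u s = 0)) \<and>
         (\<forall>z\<in>Z. \<exists>u. z - (\<Sum>s\<in>S. u s *\<^sub>f s) \<in> B))"


section \<open>Singular cohomology and the Euler characteristic\<close>

text \<open>
  Singular cohomology with rational coefficients. A \<open>p\<close>-cochain, i.e. a homomorphism from the free
  abelian group on the singular \<open>p\<close>-simplices to the rationals, is given by its values on the
  simplices; it is extended by \<open>0\<close> to functions that are not singular \<open>p\<close>-simplices of \<open>X\<close>.
\<close>
definition singular_cochains :: "nat \<Rightarrow> 'a topology \<Rightarrow> (((nat \<Rightarrow> real) \<Rightarrow> 'a) \<Rightarrow> rat) set" where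
  "singular_cochains p X = {\<phi>. \<forall>f. \<not> singular_simplex p X f \<longrightarrow> \<phi> f = 0}"

definition coboundary_map ::
    "nat \<Rightarrow> 'a topology \<Rightarrow> (((nat \<Rightarrow> real) \<Rightarrow> 'a) \<Rightarrow> rat) \<Rightarrow> ((nat \<Rightarrow> real) \<Rightarrow> 'a) \<Rightarrow> rat" where
  "coboundary_map p X \<phi> =
    (\<lambda>f. if singular_simplex (Suc p) X f
         then \<Sum>k\<le>Suc p. (- 1) ^ k * \<phi> (singular_face (Suc p) k f) else 0)"

definition singular_cocycles :: "nat \<Rightarrow> 'a topology \<Rightarrow> (((nat \<Rightarrow> real) \<Rightarrow> 'a) \<Rightarrow> rat) set" where
  "singular_cocycles p X = {\<phi> \<in> singular_cochains p X. coboundary_map p X \<phi> = 0}"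

definition singular_coboundaries :: "nat \<Rightarrow> 'a topology \<Rightarrow> (((nat \<Rightarrow> real) \<Rightarrow> 'a) \<Rightarrow> rat) set" where
  "singular_coboundaries p X =
    (case p of 0 \<Rightarrow> {0} | Suc q \<Rightarrow> coboundary_map q X ` singular_cochains q X)"

definition has_betti_number :: "nat \<Rightarrow> 'a topology \<Rightarrow> nat \<Rightarrow> bool" where
  "has_betti_number p X n \<longleftrightarrow>
    has_quotient_dim (singular_cocycles p X) (singular_coboundaries p X) n"

definition betti_number :: "nat \<Rightarrow> 'a topology \<Rightarrow> nat" where
  "betti_number p X = (THE n. has_betti_number p X n)"

text \<open>The total cohomology is finite-dimensional, so that the Euler characteristic is defined.\<close>
definition finite_cohomology :: "'a topology \<Rightarrow> bool" where
  "finite_cohomology X \<longleftrightarrow>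
    (\<forall>p. \<exists>n. has_betti_number p X n) \<and> finite {p. betti_number p X \<noteq> 0}"

definition euler_characteristic :: "'a topology \<Rightarrow> int" where
  "euler_characteristic X = (\<Sum>p | betti_number p X \<noteq> 0. (- 1) ^ p * int (betti_number p X))"


section \<open>Quotient topology\<close>

definition quotient_topology :: "'a topology \<Rightarrow> ('a \<Rightarrow> 'b) \<Rightarrow> 'b topology" where
  "quotient_topology X q =
    topology (\<lambda>U. U \<subseteq> q ` topspace X \<and> openin X {x \<in> topspace X. q x \<in> U})"

lemma istopology_quotient:
  "istopology (\<lambda>U. U \<subseteq> q ` topspace X \<and> openin X {x \<in> topspace X. q x \<in> U})"
proof -
  have Int: "{x \<in> topspace X. q x \<in> S \<inter> T} =
      {x \<in> topspace X. q x \<in> S} \<inter> {x \<in> topspace X. q x \<in> T}" for S T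
    by auto
  have Un: "{x \<in> topspace X. q x \<in> \<Union>\<K>} = (\<Union>S\<in>\<K>. {x \<in> topspace X. q x \<in> S})" for \<K>
    by auto
  show ?thesis
    unfolding istopology_def Int Un by (auto intro!: openin_Int openin_Union)
qed

lemma openin_quotient_topology:
  "openin (quotient_topology X q) U \<longleftrightarrow>
    U \<subseteq> q ` topspace X \<and> openin X {x \<in> topspace X. q x \<in> U}"
  unfolding quotient_topology_def by (simp add: topology_inverse'[OF istopology_quotient])

lemma topspace_quotient_topology [simp]:
  "topspace (quotient_topology X q) = q ` topspace X"
proof -
  have "{x \<in> topspace X. q x \<in> q ` topspace X} = topspace X"
    by auto
  then have "openin (quotient_topology X q) (q ` topspace X)"
    by (simp add: openin_quotient_topology)
  then show ?thesis
    by (metis openin_quotient_topology openin_subset openin_topspace subset_antisym)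
qed

lemma quotient_map_quotient_topology: "quotient_map X (quotient_topology X q) q"
  by (simp add: quotient_map_def openin_quotient_topology)


section \<open>Complex matrices of variable size\<close>

text \<open>
  Vectors and matrices are functions on all of \<open>nat\<close>, with entries \<open>0\<close> outside the index range.
  The topology on the matrices and on families of matrices is then the product topology of the
  library's instance for function types.
\<close>
definition cvec :: "nat \<Rightarrow> (nat \<Rightarrow> complex) set" where
  "cvec n = {x. \<forall>i\<ge>n. x i = 0}"

definition cmat :: "nat \<Rightarrow> nat \<Rightarrow> (nat \<Rightarrow> nat \<Rightarrow> complex) set" where
  "cmat r c = {A. \<forall>i j. i \<ge> r \<or> j \<ge> c \<longrightarrow> A i j = 0}"

definition mat_app :: "nat \<Rightarrow> (nat \<Rightarrow> nat \<Rightarrow> complex) \<Rightarrow> (nat \<Rightarrow> complex) \<Rightarrow> nat \<Rightarrow> complex" where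
  "mat_app c A x = (\<lambda>i. \<Sum>j<c. A i j * x j)"

text \<open>In \<open>mat_mul n A B\<close> the number \<open>n\<close> is the inner dimension.\<close>
definition mat_mul ::
    "nat \<Rightarrow> (nat \<Rightarrow> nat \<Rightarrow> complex) \<Rightarrow> (nat \<Rightarrow> nat \<Rightarrow> complex) \<Rightarrow> nat \<Rightarrow> nat \<Rightarrow> complex" where
  "mat_mul n A B = (\<lambda>i j. \<Sum>k<n. A i k * B k j)"

definition mat_one :: "nat \<Rightarrow> nat \<Rightarrow> nat \<Rightarrow> complex" where
  "mat_one n = (\<lambda>i j. if i = j \<and> i < n then 1 else 0)"

definition GL :: "nat \<Rightarrow> (nat \<Rightarrow> nat \<Rightarrow> complex) set" where
  "GL n = {A \<in> cmat n n. \<exists>B \<in> cmat n n. mat_mul n A B = mat_one n \<and> mat_mul n B A = mat_one n}"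


section \<open>Quiver representations, stability and moduli spaces\<close>

text \<open>
  A quiver is a multidigraph \<open>Q\<close>; its arrows are the arcs. Dimension vectors are assumed to be
  supported on \<open>verts Q\<close>.
\<close>
type_synonym 'e rep = "'e \<Rightarrow> nat \<Rightarrow> nat \<Rightarrow> complex"

definition rep_space :: "('v, 'e) pre_digraph \<Rightarrow> ('v \<Rightarrow> nat) \<Rightarrow> 'e rep set" where
  "rep_space Q d = {X. (\<forall>e\<in>arcs Q. X e \<in> cmat (d (head Q e)) (d (tail Q e))) \<and>
                       (\<forall>e. e \<notin> arcs Q \<longrightarrow> X e = 0)}"

text \<open>
  Isomorphism of two representations of the same dimension vector \<open>d\<close>, that is, being in the same
  orbit of the product of the groups \<open>GL (d v)\<close>. The equation is \<open>Y e = g (head e) (X e) (g (tail e))\<close>,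
  the last factor being inverted, multiplied by \<open>g (tail e)\<close> on the right.
\<close>
definition rep_iso :: "('v, 'e) pre_digraph \<Rightarrow> ('v \<Rightarrow> nat) \<Rightarrow> 'e rep \<Rightarrow> 'e rep \<Rightarrow> bool" where
  "rep_iso Q d X Y \<longleftrightarrow>
    (\<exists>g. (\<forall>v\<in>verts Q. g v \<in> GL (d v)) \<and>
         (\<forall>e\<in>arcs Q. mat_mul (d (tail Q e)) (Y e) (g (tail Q e)) =
                     mat_mul (d (head Q e)) (g (head Q e)) (X e)))"

definition subrep ::
    "('v, 'e) pre_digraph \<Rightarrow> ('v \<Rightarrow> nat) \<Rightarrow> 'e rep \<Rightarrow> ('v \<Rightarrow> (nat \<Rightarrow> complex) set) \<Rightarrow> bool" where
  "subrep Q d X U \<longleftrightarrow>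
    (\<forall>v\<in>verts Q. fun_space.subspace (U v) \<and> U v \<subseteq> cvec (d v)) \<and>
    (\<forall>v. v \<notin> verts Q \<longrightarrow> U v = {0}) \<and>
    (\<forall>e\<in>arcs Q. mat_app (d (tail Q e)) (X e) ` U (tail Q e) \<subseteq> U (head Q e))"

definition dim_vec :: "('v \<Rightarrow> (nat \<Rightarrow> complex) set) \<Rightarrow> 'v \<Rightarrow> nat" where
  "dim_vec U = (\<lambda>v. fun_space.dim (U v))"

definition stable_rep ::
    "('v, 'e) pre_digraph \<Rightarrow> (('v \<Rightarrow> nat) \<Rightarrow> real) \<Rightarrow> ('v \<Rightarrow> nat) \<Rightarrow> 'e rep \<Rightarrow> bool" where
  "stable_rep Q \<mu> d X \<longleftrightarrow>
    X \<in> rep_space Q d \<and> (\<exists>v\<in>verts Q. d v \<noteq> 0) \<and>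
    (\<forall>U. subrep Q d X U \<and> (\<exists>v\<in>verts Q. U v \<noteq> {0}) \<and> (\<exists>v\<in>verts Q. U v \<noteq> cvec (d v)) \<longrightarrow>
         \<mu> (dim_vec U) < \<mu> d)"

definition iso_class ::
    "('v, 'e) pre_digraph \<Rightarrow> ('v \<Rightarrow> nat) \<Rightarrow> 'e rep \<Rightarrow> 'e rep set" where
  "iso_class Q d X = {Y \<in> rep_space Q d. rep_iso Q d X Y}"

text \<open>
  The moduli space of stable representations is the geometric quotient of the stable locus by the
  base change group. Its complex points are the isomorphism classes, and its analytic topology is
  the quotient of the analytic topology on the stable locus.
\<close>
definition stable_moduli ::
    "('v, 'e) pre_digraph \<Rightarrow> (('v \<Rightarrow> nat) \<Rightarrow> real) \<Rightarrow> ('v \<Rightarrow> nat) \<Rightarrow> 'e rep set topology" where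
  "stable_moduli Q \<mu> d =
    quotient_topology (top_of_set {X. stable_rep Q \<mu> d X}) (iso_class Q d)"


section \<open>The level quiver\<close>

text \<open>\<open>Source l n\<close> is the vertex $i_{l,n}$ and \<open>Sink l n\<close> is $j_{l,n}$.\<close>
datatype level_vertex = Source nat nat | Sink nat nat

fun level :: "level_vertex \<Rightarrow> nat" where
  "level (Source l n) = l"
| "level (Sink l n) = l"

fun is_source :: "level_vertex \<Rightarrow> bool" where
  "is_source (Source l n) = True"
| "is_source (Sink l n) = False"

text \<open>The arc \<open>((p, s), (q, t), r)\<close> is the \<open>r\<close>-th arrow from \<open>Source p s\<close> to \<open>Sink q t\<close>.\<close>
type_synonym level_arc = "(nat \<times> nat) \<times> (nat \<times> nat) \<times> nat"

definition level_quiver :: "nat \<Rightarrow> (level_vertex, level_arc) pre_digraph" where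
  "level_quiver m =
    \<lparr> verts = {Source l n | l n. l \<ge> 1 \<and> n \<ge> 1} \<union> {Sink l n | l n. l \<ge> 1 \<and> n \<ge> 1},
      arcs = {((p, s), (q, t), r) | p s q t r.
                p \<ge> 1 \<and> s \<ge> 1 \<and> q \<ge> 1 \<and> t \<ge> 1 \<and> r < m * p * q},
      tail = (\<lambda>((p, s), (q, t), r). Source p s),
      head = (\<lambda>((p, s), (q, t), r). Sink q t) \<rparr>"

lemma wf_digraph_level_quiver: "wf_digraph (level_quiver m)"
  by unfold_locales (auto simp: level_quiver_def)

definition level_slope :: "(level_vertex \<Rightarrow> nat) \<Rightarrow> real" where
  "level_slope d =
    (\<Sum>v | is_source v \<and> d v \<noteq> 0. real (level v * d v)) /
    (\<Sum>v | d v \<noteq> 0. real (level v * d v))"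

text \<open>The dimension vector written $(1 \cdot a, 1 \cdot b)$.\<close>
fun trivial_partition :: "nat \<Rightarrow> nat \<Rightarrow> level_vertex \<Rightarrow> nat" where
  "trivial_partition a b (Source l n) = (if l = 1 \<and> 1 \<le> n \<and> n \<le> a then 1 else 0)"
| "trivial_partition a b (Sink l n) = (if l = 1 \<and> 1 \<le> n \<and> n \<le> b then 1 else 0)"

end

theory Submission
  imports Defs
begin

text \<open>
  A representation of dimension one at every vertex is stable iff its support satisfies
  \<open>card (N A) > k * card A\<close> for every nonempty set \<open>A\<close> of sources, where \<open>N A\<close> is the set of
  neighbours of \<open>A\<close>. A minimal such support is a spanning tree all of whose sources have degree
  \<open>k + 1\<close>. The representations whose support contains a given stable tree form an open chart of the
  moduli space, homeomorphic to an affine space, and an intersection of several charts is a product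
  of an affine space with a nontrivial torus, whose Euler characteristic vanishes. By additivity over
  open covers, which follows from excision and the long exact sequence of a pair, the Euler
  characteristic is the number of stable trees. Rooting the trees at a fixed sink, they are counted by
  first distributing the other sinks into disjoint \<open>k\<close>-sets of children of the sources and then
  choosing the parents of the sources level by level, which is a binomial sum.
\<close>

section \<open>Ranks of quotients of free abelian groups\<close>

text \<open>The Euler characteristic is defined through rational cohomology, while excision and
  homotopy invariance are used for integral homology. The two are joined by ranks of quotients of
  chain groups, that is, dimensions after tensoring with the rationals: torsion drops out, and
  cohomology is dual to homology because the rationals are injective. Ranks and Euler
  characteristics are relations between a space and a number, so that finiteness is proved along
  with each value. The constant \<open>k * a + 1\<close> is decisive for the combinatorics: once one
  sink serves as the root, the remaining \<open>k * a\<close> sinks give exactly \<open>k\<close>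
  children to each of the \<open>a\<close> sources. The power of \<open>k * a + 1\<close> in the
  result comes from a Cayley-type count of the ways to attach the sources to their parents.\<close>

lemma underdetermined_system:
  fixes A :: "'a \<Rightarrow> 'b \<Rightarrow> 'k::field"
  assumes "finite S" "finite T" "card S < card T"
  shows "\<exists>u. (\<exists>t\<in>T. u t \<noteq> 0) \<and> (\<forall>s\<in>S. (\<Sum>t\<in>T. u t * A t s) = 0)"
  using assms
proof (induction S arbitrary: T A rule: finite_induct)
  case empty
  then obtain t where "t \<in> T"
    by fastforce
  then show ?case
    by (intro exI[of _ "\<lambda>_. 1"]) auto
next
  case (insert s0 S)
  show ?case
  proof (cases "\<forall>t\<in>T. A t s0 = 0")
    case True
    have "card S < card T"
      using insert by simp
    from insert.IH[OF insert.prems(1) this, of A] True show ?thesis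
      by fastforce
  next
    case False
    then obtain p where p: "p \<in> T" "A p s0 \<noteq> 0"
      by blast
    \<comment> \<open>Elimination of the unknown at \<open>p\<close> by means of the equation
      \<open>s0\<close>, with pivot \<open>A p s0\<close>.\<close>
    define A' where "A' t s = A t s - A t s0 / A p s0 * A p s" for t s
    have "card S < card (T - {p})"
      using insert p by simp
    from insert.IH[OF _ this, of A'] insert.prems obtain u where
      u: "\<exists>t\<in>T - {p}. u t \<noteq> 0" "\<forall>s\<in>S. (\<Sum>t\<in>T - {p}. u t * A' t s) = 0"
      by auto
    \<comment> \<open>The value at \<open>p\<close> is back-substituted so that the equation
      \<open>s0\<close> holds as well.\<close>
    define v where "v = u(p := - (\<Sum>t\<in>T - {p}. u t * A t s0 / A p s0))"
    have v: "(\<Sum>t\<in>T. v t * A t s) = (\<Sum>t\<in>T - {p}. u t * A' t s)" for s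
    proof -
      have "(\<Sum>t\<in>T. v t * A t s) = v p * A p s + (\<Sum>t\<in>T - {p}. v t * A t s)"
        using p insert.prems by (simp add: sum.remove)
      also have "(\<Sum>t\<in>T - {p}. v t * A t s) = (\<Sum>t\<in>T - {p}. u t * A t s)"
        by (intro sum.cong) (auto simp: v_def)
      finally show ?thesis
        by (simp add: v_def A'_def algebra_simps sum_subtractf sum_distrib_left sum_distrib_right sum_divide_distrib)
    qed
    have "(\<Sum>t\<in>T - {p}. u t * A' t s0) = 0"
      using p by (simp add: A'_def)
    moreover have "\<exists>t\<in>T. v t \<noteq> 0"
      using u(1) by (auto simp: v_def)
    ultimately show ?thesis
      using u(2) v by (intro exI[of _ v]) auto
  qed
qed

lemma common_denominator:
  fixes u :: "'a \<Rightarrow> rat"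
  assumes "finite S"
  shows "\<exists>N v. N > (0::int) \<and> (\<forall>s\<in>S. of_int (v s) = of_int N * u s)"
  using assms
proof induction
  case (insert x S)
  then obtain N v where N: "N > (0::int)" "\<forall>s\<in>S. of_int (v s) = of_int N * u s"
    by blast
  obtain a b where ab: "quotient_of (u x) = (a, b)"
    by fastforce
  then have b: "b > 0" "u x = of_int a / of_int b"
    using quotient_of_denom_pos quotient_of_div by blast+
  show ?case
    using N b insert.hyps
    by (intro exI[of _ "N * b"] exI[of _ "\<lambda>s. if s = x then N * a else v s * b"]) (auto simp: mult.commute)
qed (auto intro!: exI[of _ 1])

lemma underdetermined_system_int:
  fixes A :: "'a \<Rightarrow> 'b \<Rightarrow> int"
  assumes "finite S" "finite T" "card S < card T"
  shows "\<exists>u. (\<exists>t\<in>T. u t \<noteq> 0) \<and> (\<forall>s\<in>S. (\<Sum>t\<in>T. u t * A t s) = (0::int))"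
proof -
  obtain u :: "'a \<Rightarrow> rat" where u: "\<exists>t\<in>T. u t \<noteq> 0" "\<forall>s\<in>S. (\<Sum>t\<in>T. u t * of_int (A t s)) = 0"
    using underdetermined_system[OF assms, of "\<lambda>t s. of_int (A t s)"] by blast
  obtain N v where N: "N > (0::int)" and v: "\<forall>t\<in>T. of_int (v t) = of_int N * u t"
    using common_denominator[OF assms(2), of u] by blast
  have "(of_int (\<Sum>t\<in>T. v t * A t s) :: rat) = 0" if "s \<in> S" for s
  proof -
    have "(of_int (\<Sum>t\<in>T. v t * A t s) :: rat) = of_int N * (\<Sum>t\<in>T. u t * of_int (A t s))"
      using v by (simp add: sum_distrib_left mult.assoc)
    with u that show ?thesis by simp
  qed
  moreover obtain t where "t \<in> T" "u t \<noteq> 0"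
    using u(1) by blast
  then have "(of_int (v t) :: rat) \<noteq> 0"
    using v N by simp
  then have "v t \<noteq> 0"
    by auto
  ultimately show ?thesis
    using \<open>t \<in> T\<close> by (intro exI[of _ v]) (metis of_int_eq_0_iff)
qed

text \<open>Exchange argument: if \<open>T\<close> had more elements than \<open>S\<close>, some
  nontrivial combination of \<open>T\<close> would have all coordinates along \<open>S\<close> equal
  to zero and so lie in \<open>B\<close>. The resulting uniqueness gives meaning to the definite
  description in \<open>betti_number\<close>.\<close>

lemma has_quotient_dim_le:
  assumes B: "fun_space.subspace B" and n: "has_quotient_dim Z B n" and n': "has_quotient_dim Z B n'"
  shows "n' \<le> n"
proof (rule ccontr)
  assume "\<not> n' \<le> n"
  obtain S where S: "S \<subseteq> Z" "finite S" "card S = n" "\<forall>z\<in>Z. \<exists>u. z - (\<Sum>s\<in>S. u s *\<^sub>f s) \<in> B"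
    using n unfolding has_quotient_dim_def by blast
  obtain T where T: "T \<subseteq> Z" "finite T" "card T = n'" "\<forall>u. (\<Sum>s\<in>T. u s *\<^sub>f s) \<in> B \<longrightarrow> (\<forall>s\<in>T. u s = 0)"
    using n' unfolding has_quotient_dim_def by blast
  obtain A where A: "t - (\<Sum>s\<in>S. A t s *\<^sub>f s) \<in> B" if "t \<in> T" for t
    using S T by (metis subset_iff)
  have "card S < card T"
    using S T \<open>\<not> n' \<le> n\<close> by simp
  then obtain u where u: "\<exists>t\<in>T. u t \<noteq> 0" "\<forall>s\<in>S. (\<Sum>t\<in>T. u t * A t s) = 0"
    using underdetermined_system[OF S(2) T(2), of A] by blast
  have "(\<Sum>t\<in>T. \<Sum>s\<in>S. u t *\<^sub>f A t s *\<^sub>f s) = (\<Sum>s\<in>S. \<Sum>t\<in>T. u t *\<^sub>f A t s *\<^sub>f s)"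
    by (rule sum.swap)
  also have "\<dots> = (\<Sum>s\<in>S. (\<Sum>t\<in>T. u t * A t s) *\<^sub>f s)"
    by (simp only: fun_space.scale_sum_left fun_space.scale_scale)
  also have "\<dots> = (\<Sum>s\<in>S. 0)"
    using u(2) by (intro sum.cong refl) (simp only: fun_space.scale_zero_left)
  finally have "(\<Sum>t\<in>T. \<Sum>s\<in>S. u t *\<^sub>f A t s *\<^sub>f s) = 0"
    by (simp only: sum.neutral_const)
  then have "(\<Sum>t\<in>T. u t *\<^sub>f t) = (\<Sum>t\<in>T. u t *\<^sub>f (t - (\<Sum>s\<in>S. A t s *\<^sub>f s)))"
    by (simp only: fun_space.scale_right_diff_distrib sum_subtractf fun_space.scale_sum_right diff_zero)
  also have "\<dots> \<in> B"
    using A by (intro fun_space.subspace_sum[OF B] fun_space.subspace_scale[OF B]) auto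
  finally show False
    using T(4) u(1) by blast
qed

lemma has_quotient_dim_unique:
  "\<lbrakk>fun_space.subspace B; has_quotient_dim Z B n; has_quotient_dim Z B n'\<rbrakk> \<Longrightarrow> n = n'"
  by (meson has_quotient_dim_le le_antisym)

section \<open>Finite rank of one group of formal sums modulo another\<close>

definition frag_subgroup :: "('a \<Rightarrow>\<^sub>0 int) set \<Rightarrow> bool" where
  "frag_subgroup A \<longleftrightarrow> 0 \<in> A \<and> (\<forall>x\<in>A. \<forall>y\<in>A. x - y \<in> A)"

lemma frag_subgroupD:
  assumes "frag_subgroup A"
  shows frag_subgroup_0: "0 \<in> A"
    and frag_subgroup_diff: "x \<in> A \<Longrightarrow> y \<in> A \<Longrightarrow> x - y \<in> A"
    and frag_subgroup_uminus: "x \<in> A \<Longrightarrow> - x \<in> A"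
    and frag_subgroup_add: "x \<in> A \<Longrightarrow> y \<in> A \<Longrightarrow> x + y \<in> A"
    and frag_subgroup_cmul: "x \<in> A \<Longrightarrow> frag_cmul k x \<in> A"
proof -
  show 0: "0 \<in> A" and d: "\<And>x y. x \<in> A \<Longrightarrow> y \<in> A \<Longrightarrow> x - y \<in> A"
    using assms by (auto simp: frag_subgroup_def)
  show m: "\<And>x. x \<in> A \<Longrightarrow> - x \<in> A"
    using d[OF 0] by simp
  show "x \<in> A \<Longrightarrow> y \<in> A \<Longrightarrow> x + y \<in> A"
    using d[OF _ m, of x y] by simp
  show "x \<in> A \<Longrightarrow> frag_cmul k x \<in> A"
    by (rule frag_closure_minus_cmul[of "\<lambda>x. x \<in> A"]) (auto intro: 0 d)
qed

lemma frag_subgroup_sum: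
  "frag_subgroup A \<Longrightarrow> (\<And>i. i \<in> I \<Longrightarrow> f i \<in> A) \<Longrightarrow> (\<Sum>i\<in>I. f i) \<in> A"
  by (induction I rule: infinite_finite_induct) (auto simp: frag_subgroupD)

definition frag_indep :: "('a \<Rightarrow>\<^sub>0 int) set \<Rightarrow> ('a \<Rightarrow>\<^sub>0 int) set \<Rightarrow> bool" where
  "frag_indep B S \<longleftrightarrow> finite S \<and> (\<forall>u. (\<Sum>s\<in>S. frag_cmul (u s) s) \<in> B \<longrightarrow> (\<forall>s\<in>S. u s = 0))"

text \<open>The dimension of \<open>Z / B\<close> after tensoring with the rationals: elements have
  to be generated by \<open>S\<close> only up to a nonzero multiple \<open>N\<close>, which ignores
  torsion in the quotient. Being a relation, it also expresses that the rank is finite.\<close>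

definition frag_rank :: "('a \<Rightarrow>\<^sub>0 int) set \<Rightarrow> ('a \<Rightarrow>\<^sub>0 int) set \<Rightarrow> nat \<Rightarrow> bool" where
  "frag_rank Z B n \<longleftrightarrow> (\<exists>S\<subseteq>Z. frag_indep B S \<and> card S = n \<and>
     (\<forall>z\<in>Z. \<exists>N u. N \<noteq> 0 \<and> frag_cmul N z - (\<Sum>s\<in>S. frag_cmul (u s) s) \<in> B))"

lemma frag_indepD:
  "frag_indep B S \<Longrightarrow> (\<Sum>s\<in>S. frag_cmul (u s) s) \<in> B \<Longrightarrow> s \<in> S \<Longrightarrow> u s = 0"
  unfolding frag_indep_def by blast

lemma frag_cmul_sum_left: "frag_cmul (sum f I) x = (\<Sum>i\<in>I. frag_cmul (f i) x)"
  by (induction I rule: infinite_finite_induct) (auto simp: frag_cmul_distrib)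

lemma frag_cmul_diff_distrib2: "frag_cmul a (x - y) = frag_cmul a x - frag_cmul a y"
  by (rule poly_mapping_eqI) (simp add: lookup_minus algebra_simps)

text \<open>The exchange argument over the integers. Since each \<open>t\<close> is expressed
  through \<open>S\<close> only after multiplication by \<open>N t\<close>, the relation found among
  the elements of \<open>T\<close> has the coefficients \<open>u t * N t\<close>.\<close>

lemma frag_indep_card_le:
  assumes B: "frag_subgroup B" and n: "frag_rank Z B n" and T: "T \<subseteq> Z" "frag_indep B T"
  shows "card T \<le> n"
proof (rule ccontr)
  assume "\<not> card T \<le> n"
  obtain S where S: "S \<subseteq> Z" "finite S" "card S = n"
    "\<forall>z\<in>Z. \<exists>N u. N \<noteq> 0 \<and> frag_cmul N z - (\<Sum>s\<in>S. frag_cmul (u s) s) \<in> B"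
    using n unfolding frag_rank_def frag_indep_def by blast
  have "\<forall>t\<in>T. \<exists>N A. N \<noteq> 0 \<and> frag_cmul N t - (\<Sum>s\<in>S. frag_cmul (A s) s) \<in> B"
    using S T by blast
  then obtain N where "\<forall>t\<in>T. \<exists>A. N t \<noteq> 0 \<and> frag_cmul (N t) t - (\<Sum>s\<in>S. frag_cmul (A s) s) \<in> B"
    by metis
  then obtain A where N: "\<And>t. t \<in> T \<Longrightarrow> N t \<noteq> 0"
    and A: "\<And>t. t \<in> T \<Longrightarrow> frag_cmul (N t) t - (\<Sum>s\<in>S. frag_cmul (A t s) s) \<in> B"
    by metis
  have "finite T"
    using T by (simp add: frag_indep_def)
  moreover have "card S < card T"
    using S T \<open>\<not> card T \<le> n\<close> by simp
  ultimately obtain u where u: "\<exists>t\<in>T. u t \<noteq> 0" "\<forall>s\<in>S. (\<Sum>t\<in>T. u t * A t s) = 0"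
    using underdetermined_system_int[OF S(2), of T A] by blast
  have "(\<Sum>t\<in>T. \<Sum>s\<in>S. frag_cmul (u t) (frag_cmul (A t s) s)) =
        (\<Sum>s\<in>S. \<Sum>t\<in>T. frag_cmul (u t) (frag_cmul (A t s) s))"
    by (rule sum.swap)
  also have "\<dots> = (\<Sum>s\<in>S. frag_cmul (\<Sum>t\<in>T. u t * A t s) s)"
    by (simp add: frag_cmul_sum_left)
  also have "\<dots> = 0"
    using u by simp
  finally have "(\<Sum>t\<in>T. frag_cmul (u t * N t) t) =
      (\<Sum>t\<in>T. frag_cmul (u t) (frag_cmul (N t) t - (\<Sum>s\<in>S. frag_cmul (A t s) s)))"
    by (simp add: frag_cmul_diff_distrib2 sum_subtractf frag_cmul_sum del: frag_cmul_cmul)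
       (simp)
  also have "\<dots> \<in> B"
    using A by (intro frag_subgroup_sum[OF B] frag_subgroup_cmul[OF B]) auto
  finally have "\<forall>t\<in>T. u t * N t = 0"
    using frag_indepD[OF T(2), of "\<lambda>t. u t * N t"] by blast
  then show False
    using u(1) N by auto
qed

lemma frag_rank_unique:
  assumes "frag_subgroup B" "frag_rank Z B n" "frag_rank Z B n'"
  shows "n = n'"
proof -
  have "m' \<le> m" if m: "frag_rank Z B m" and m': "frag_rank Z B m'" for m m'
  proof -
    obtain S where "S \<subseteq> Z" "frag_indep B S" "card S = m'"
      using m' unfolding frag_rank_def by blast
    then show ?thesis
      using frag_indep_card_le[OF assms(1) m] by blast
  qed
  then show ?thesis
    using assms(2,3) le_antisym by blast
qed

text \<open>An independent set of largest size spans up to multiples, because adding any further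
  element makes it dependent.\<close>

lemma frag_rank_exists:
  assumes B: "frag_subgroup B" and bound: "\<And>T. T \<subseteq> Z \<Longrightarrow> frag_indep B T \<Longrightarrow> card T \<le> n"
  obtains m where "frag_rank Z B m"
proof -
  let ?P = "\<lambda>m. \<exists>T\<subseteq>Z. frag_indep B T \<and> card T = m"
  have "?P 0"
    by (auto simp: frag_indep_def intro!: exI[of _ "{}"])
  moreover have "m \<le> n" if "?P m" for m
    using bound that by blast
  ultimately have m: "?P (Greatest ?P)" "\<And>m'. ?P m' \<Longrightarrow> m' \<le> Greatest ?P"
    by (rule GreatestI_nat[of ?P 0 n], blast) (rule Greatest_le_nat[of ?P _ n], assumption, use bound in blast)
  define m where "m = Greatest ?P"
  note m = m[folded m_def]
  then obtain T where T: "T \<subseteq> Z" "frag_indep B T" "card T = m"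
    by blast
  have fin: "finite T"
    using T by (simp add: frag_indep_def)
  have span: "\<exists>N u. N \<noteq> 0 \<and> frag_cmul N z - (\<Sum>s\<in>T. frag_cmul (u s) s) \<in> B" if z: "z \<in> Z" for z
  proof (cases "z \<in> T")
    case True
    have "(\<Sum>s\<in>T. frag_cmul (if s = z then 1 else 0) s) = (\<Sum>s\<in>T. if s = z then z else 0)"
      by (intro sum.cong) auto
    then have "(\<Sum>s\<in>T. frag_cmul (if s = z then 1 else 0) s) = z"
      using True fin by simp
    then show ?thesis
      by (intro exI[of _ 1] exI[of _ "\<lambda>s. if s = z then 1 else 0"]) (simp add: frag_subgroup_0[OF B])
  next
    case False
    have "\<not> frag_indep B (insert z T)"
    proof
      assume "frag_indep B (insert z T)"
      then have "?P (card (insert z T))"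
        using T z by blast
      from m(2)[OF this] show False
        using False T fin by simp
    qed
    then obtain u t where u: "(\<Sum>s\<in>insert z T. frag_cmul (u s) s) \<in> B" "t \<in> insert z T" "u t \<noteq> 0"
      using fin by (auto simp: frag_indep_def)
    have eq: "(\<Sum>s\<in>insert z T. frag_cmul (u s) s) = frag_cmul (u z) z - (\<Sum>s\<in>T. frag_cmul (- u s) s)"
      using fin False by (simp add: sum_negf flip: minus_frag_cmul)
    \<comment> \<open>The relation must involve \<open>z\<close>, as otherwise it would be a
      relation within the independent set \<open>T\<close>. Thus \<open>u z\<close> is the multiple
      sought.\<close>
    have "u z \<noteq> 0"
    proof
      assume "u z = 0"
      then have "(\<Sum>s\<in>T. frag_cmul (u s) s) \<in> B"
        using u fin False by simp
      then show False
        using frag_indepD[OF T(2), of u t] u \<open>u z = 0\<close> by auto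
    qed
    then show ?thesis
      using u(1) unfolding eq by (intro exI[of _ "u z"] exI[of _ "\<lambda>s. - u s"] conjI)
  qed
  have "frag_rank Z B m"
    unfolding frag_rank_def by (intro exI[of _ T] conjI ballI T span)
  then show ?thesis ..
qed

lemma additive_frag_cmul:
  fixes f :: "('a \<Rightarrow>\<^sub>0 int) \<Rightarrow> ('b \<Rightarrow>\<^sub>0 int)"
  assumes f: "\<And>x y. f (x - y) = f x - f y"
  shows "f (frag_cmul k x) = frag_cmul k (f x)"
proof -
  have 0: "f 0 = 0"
    using f[of 0 0] by simp
  then have m: "f (- y) = - f y" for y
    using f[of 0 y] by simp
  have a: "f (x + y) = f x + f y" for x y
    using f[of x "- y"] m by simp
  have *: "f (frag_cmul (int n) x) = frag_cmul (int n) (f x)" for n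
    by (induction n) (auto simp: 0 a frag_cmul_distrib)
  show ?thesis
  proof (cases k rule: int_cases2)
    case (nonpos n)
    then show ?thesis
      using *[of n] m[of "frag_cmul (int n) x"] by simp
  qed (use * in auto)
qed

lemma additive_frag_sum:
  fixes f :: "('a \<Rightarrow>\<^sub>0 int) \<Rightarrow> ('b \<Rightarrow>\<^sub>0 int)"
  assumes f: "\<And>x y. f (x - y) = f x - f y"
  shows "f (\<Sum>i\<in>I. g i) = (\<Sum>i\<in>I. f (g i))"
proof -
  have 0: "f 0 = 0"
    using f[of 0 0] by simp
  then have m: "f (- y) = - f y" for y
    using f[of 0 y] by simp
  have a: "f (x + y) = f x + f y" for x y
    using f[of x "- y"] m by simp
  show ?thesis
    by (induction I rule: infinite_finite_induct) (auto simp: 0 a)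
qed

lemma frag_indep_image:
  fixes f :: "('a \<Rightarrow>\<^sub>0 int) \<Rightarrow> ('b \<Rightarrow>\<^sub>0 int)"
  assumes f: "\<And>x y. f (x - y) = f x - f y"
    and B: "frag_subgroup B" and B': "\<And>z. z \<in> Z \<Longrightarrow> f z \<in> B' \<Longrightarrow> z \<in> B" and Z: "frag_subgroup Z"
    and B0: "frag_subgroup B'"
    and S: "S \<subseteq> Z" "frag_indep B S"
  shows "inj_on f S" "frag_indep B' (f ` S)"
proof -
  have fin: "finite S"
    using S by (simp add: frag_indep_def)
  show inj: "inj_on f S"
  proof (rule inj_onI, rule ccontr)
    fix x y
    assume xy: "x \<in> S" "y \<in> S" "f x = f y" "x \<noteq> y"
    let ?u = "\<lambda>s. if s = x then 1 else if s = y then -1 else (0::int)"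
    have "(\<Sum>s\<in>S. frag_cmul (?u s) s) = (\<Sum>s\<in>S. (if s = x then x else 0) - (if s = y then y else 0))"
      using xy by (intro sum.cong) auto
    also have "\<dots> = x - y"
      using fin xy by (simp add: sum_subtractf)
    finally have "(\<Sum>s\<in>S. frag_cmul (?u s) s) = x - y" .
    moreover have "f (x - y) \<in> B'"
      using xy f by (simp add: frag_subgroup_0[OF B0])
    then have "x - y \<in> B"
      using B' xy S frag_subgroup_diff[OF Z] by blast
    ultimately have "?u x = 0"
      using xy by (intro frag_indepD[OF S(2)]) auto
    then show False
      by simp
  qed
  show "frag_indep B' (f ` S)"
    unfolding frag_indep_def
  proof (intro conjI allI impI)
    fix u
    assume "(\<Sum>s\<in>f ` S. frag_cmul (u s) s) \<in> B'"
    also have "(\<Sum>s\<in>f ` S. frag_cmul (u s) s) = f (\<Sum>s\<in>S. frag_cmul (u (f s)) s)"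
      by (simp add: sum.reindex[OF inj] additive_frag_sum[OF f] additive_frag_cmul[OF f])
    finally have "(\<Sum>s\<in>S. frag_cmul (u (f s)) s) \<in> B"
      using S by (intro B' frag_subgroup_sum[OF Z] frag_subgroup_cmul[OF Z]) auto
    then show "\<forall>s\<in>f ` S. u s = 0"
      using S(2) by (auto simp: frag_indep_def)
  qed (use fin in auto)
qed

text \<open>The hypotheses say that \<open>f\<close> induces an isomorphism of \<open>Z / B\<close>
  onto \<open>Z' / B'\<close>; stating them for representatives avoids forming the quotient
  groups.\<close>

lemma frag_rank_iso:
  fixes f :: "('a \<Rightarrow>\<^sub>0 int) \<Rightarrow> ('b \<Rightarrow>\<^sub>0 int)"
  assumes f: "\<And>x y. f (x - y) = f x - f y"
    and sub: "frag_subgroup Z" "frag_subgroup B" "frag_subgroup B'"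
    and Z': "\<And>z. z \<in> Z \<Longrightarrow> f z \<in> Z'" and B': "\<And>z. z \<in> Z \<Longrightarrow> f z \<in> B' \<longleftrightarrow> z \<in> B"
    and surj: "\<And>z'. z' \<in> Z' \<Longrightarrow> \<exists>z\<in>Z. z' - f z \<in> B'"
  shows "frag_rank Z B n \<longleftrightarrow> frag_rank Z' B' n"
proof -
  have B'': "\<And>z. z \<in> Z \<Longrightarrow> f z \<in> B' \<Longrightarrow> z \<in> B"
    using B' by blast
  have *: "frag_rank Z' B' n" if n: "frag_rank Z B n" for n
  proof -
    obtain S where S: "S \<subseteq> Z" "frag_indep B S" "card S = n"
      and span: "\<forall>z\<in>Z. \<exists>N u. N \<noteq> 0 \<and> frag_cmul N z - (\<Sum>s\<in>S. frag_cmul (u s) s) \<in> B"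
      using n unfolding frag_rank_def by blast
    note im = frag_indep_image[OF f sub(2) B'' sub(1,3) S(1,2)]
    have inj: "inj_on f S" and ind: "frag_indep B' (f ` S)"
      using im by auto
    show ?thesis
      unfolding frag_rank_def
    proof (intro exI[of _ "f ` S"] conjI ballI)
      show "f ` S \<subseteq> Z'" "frag_indep B' (f ` S)" "card (f ` S) = n"
        using S Z' ind card_image[OF inj] by auto
      fix z'
      assume "z' \<in> Z'"
      then obtain z where z: "z \<in> Z" "z' - f z \<in> B'"
        using surj by blast
      then obtain N u where Nu: "N \<noteq> 0" "frag_cmul N z - (\<Sum>s\<in>S. frag_cmul (u s) s) \<in> B"
        using span by blast
      let ?v = "\<lambda>t. u (the_inv_into S f t)"
      have "(\<Sum>s\<in>f ` S. frag_cmul (?v s) s) = f (\<Sum>s\<in>S. frag_cmul (u s) s)"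
        by (simp add: sum.reindex[OF inj] additive_frag_sum[OF f] additive_frag_cmul[OF f] the_inv_into_f_f[OF inj])
      then have "frag_cmul N z' - (\<Sum>s\<in>f ` S. frag_cmul (?v s) s) =
          frag_cmul N (z' - f z) + f (frag_cmul N z - (\<Sum>s\<in>S. frag_cmul (u s) s))"
        by (simp add: frag_cmul_diff_distrib2 f additive_frag_cmul[OF f])
      also have "\<dots> \<in> B'"
      proof (intro frag_subgroup_add[OF sub(3)] frag_subgroup_cmul[OF sub(3)] z)
        have "frag_cmul N z - (\<Sum>s\<in>S. frag_cmul (u s) s) \<in> Z"
          using z(1) S(1) sub(1) by (auto intro!: frag_subgroupD frag_subgroup_sum)
        then show "f (frag_cmul N z - (\<Sum>s\<in>S. frag_cmul (u s) s)) \<in> B'"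
          using B' Nu by blast
      qed
      finally show "\<exists>N u. N \<noteq> 0 \<and> frag_cmul N z' - (\<Sum>s\<in>f ` S. frag_cmul (u s) s) \<in> B'"
        using Nu(1) by (intro exI[of _ N] exI[of _ ?v] conjI)
    qed
  qed
  \<comment> \<open>Instead of inverting \<open>f\<close>, some rank \<open>m\<close> of
    \<open>Z / B\<close> is obtained from the bound \<open>n\<close>; the direction already shown
    and uniqueness then give \<open>m = n\<close>.\<close>
  moreover have "frag_rank Z B n" if n: "frag_rank Z' B' n"
  proof -
    have "card S \<le> n" if S: "S \<subseteq> Z" "frag_indep B S" for S
    proof -
      note im = frag_indep_image[OF f sub(2) B'' sub(1,3) S]
      have "card (f ` S) \<le> n"
      proof (rule frag_indep_card_le[OF sub(3) n _ im(2)], rule image_subsetI)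
        fix x
        assume "x \<in> S"
        with S(1) have "x \<in> Z"
          by (rule subsetD)
        then show "f x \<in> Z'"
          by (rule Z')
      qed
      then show ?thesis
        using card_image[OF im(1)] by simp
    qed
    then obtain m where "frag_rank Z B m"
      using frag_rank_exists[OF sub(2)] by metis
    moreover from this have "m = n"
      using * n frag_rank_unique[OF sub(3)] by blast
    ultimately show ?thesis
      by simp
  qed
  ultimately show ?thesis
    by blast
qed

lemma frag_rank_tower_sum:
  assumes sub: "frag_subgroup Z" "frag_subgroup Y" "frag_subgroup B" and "B \<subseteq> Y" "Y \<subseteq> Z"
    and m: "frag_rank Z Y m" and n: "frag_rank Y B n"
  shows "frag_rank Z B (m + n)"
proof -
  obtain S where S: "S \<subseteq> Z" "frag_indep Y S" "card S = m"
    and spanS: "\<forall>z\<in>Z. \<exists>N u. N \<noteq> 0 \<and> frag_cmul N z - (\<Sum>s\<in>S. frag_cmul (u s) s) \<in> Y"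
    using m unfolding frag_rank_def by blast
  obtain T where T: "T \<subseteq> Y" "frag_indep B T" "card T = n"
    and spanT: "\<forall>z\<in>Y. \<exists>N u. N \<noteq> 0 \<and> frag_cmul N z - (\<Sum>s\<in>T. frag_cmul (u s) s) \<in> B"
    using n unfolding frag_rank_def by blast
  have fin: "finite S" "finite T"
    using S T by (auto simp: frag_indep_def)
  \<comment> \<open>A common element would lie in \<open>Y\<close> and hence be dependent modulo
    \<open>Y\<close>.\<close>
  have disj: "S \<inter> T = {}"
  proof (rule ccontr)
    assume "S \<inter> T \<noteq> {}"
    then obtain x where x: "x \<in> S" "x \<in> T"
      by blast
    have "(\<Sum>s\<in>S. frag_cmul (if s = x then 1 else 0) s) = (\<Sum>s\<in>S. if s = x then x else 0)"
      by (intro sum.cong) auto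
    then have "(\<Sum>s\<in>S. frag_cmul (if s = x then 1 else 0) s) = x"
      using x fin by simp
    then have "(if x = x then 1 else 0 :: int) = 0"
      using T x by (intro frag_indepD[OF S(2), of "\<lambda>s. if s = x then 1 else 0"]) auto
    then show False
      by simp
  qed
  have sumY: "(\<Sum>s\<in>T. frag_cmul (u s) s) \<in> Y" for u
    using T by (intro frag_subgroup_sum[OF sub(2)] frag_subgroup_cmul[OF sub(2)]) auto
  show ?thesis
    unfolding frag_rank_def
  proof (intro exI[of _ "S \<union> T"] conjI ballI)
    show "S \<union> T \<subseteq> Z" "card (S \<union> T) = m + n"
      using S T disj fin assms(5) by (auto simp: card_Un_disjoint)
    show "frag_indep B (S \<union> T)"
      unfolding frag_indep_def
    proof (intro conjI allI impI)
      fix u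
      assume u: "(\<Sum>s\<in>S \<union> T. frag_cmul (u s) s) \<in> B"
      have eq: "(\<Sum>s\<in>S \<union> T. frag_cmul (u s) s) = (\<Sum>s\<in>S. frag_cmul (u s) s) + (\<Sum>s\<in>T. frag_cmul (u s) s)"
        using fin disj by (simp add: sum.union_disjoint)
      then have "(\<Sum>s\<in>S. frag_cmul (u s) s) = (\<Sum>s\<in>S \<union> T. frag_cmul (u s) s) - (\<Sum>s\<in>T. frag_cmul (u s) s)"
        by simp
      also have "\<dots> \<in> Y"
        using u assms(4) sumY by (intro frag_subgroup_diff[OF sub(2)]) auto
      finally have 0: "\<forall>s\<in>S. u s = 0"
        using frag_indepD[OF S(2)] by blast
      then have "(\<Sum>s\<in>T. frag_cmul (u s) s) \<in> B"
        using u eq by simp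
      then show "\<forall>s\<in>S \<union> T. u s = 0"
        using frag_indepD[OF T(2)] 0 by blast
    qed (use fin in auto)
    fix z
    assume "z \<in> Z"
    then obtain N u where Nu: "N \<noteq> 0" "frag_cmul N z - (\<Sum>s\<in>S. frag_cmul (u s) s) \<in> Y"
      using spanS by blast
    then obtain N' u' where Nu': "N' \<noteq> 0"
      "frag_cmul N' (frag_cmul N z - (\<Sum>s\<in>S. frag_cmul (u s) s)) - (\<Sum>s\<in>T. frag_cmul (u' s) s) \<in> B"
      using spanT by blast
    \<comment> \<open>The remainder in \<open>Y\<close> is multiplied by \<open>N'\<close> before it
      is expressed through \<open>T\<close>, which scales the coefficients along
      \<open>S\<close>.\<close>
    let ?w = "\<lambda>s. if s \<in> S then N' * u s else u' s"
    have "(\<Sum>s\<in>S \<union> T. frag_cmul (?w s) s) = (\<Sum>s\<in>S. frag_cmul (N' * u s) s) + (\<Sum>s\<in>T. frag_cmul (u' s) s)"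
    proof -
      have "(\<Sum>s\<in>T. frag_cmul (?w s) s) = (\<Sum>s\<in>T. frag_cmul (u' s) s)"
        using disj by (intro sum.cong) auto
      moreover have "(\<Sum>s\<in>S. frag_cmul (?w s) s) = (\<Sum>s\<in>S. frag_cmul (N' * u s) s)"
        by (intro sum.cong) auto
      ultimately show ?thesis
        using fin disj by (simp add: sum.union_disjoint)
    qed
    then have "frag_cmul (N' * N) z - (\<Sum>s\<in>S \<union> T. frag_cmul (?w s) s) =
      frag_cmul N' (frag_cmul N z - (\<Sum>s\<in>S. frag_cmul (u s) s)) - (\<Sum>s\<in>T. frag_cmul (u' s) s)"
      by (simp add: frag_cmul_diff_distrib2 frag_cmul_sum)
    then have "frag_cmul (N' * N) z - (\<Sum>s\<in>S \<union> T. frag_cmul (?w s) s) \<in> B"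
      using Nu'(2) by (simp only:)
    moreover have "N' * N \<noteq> 0"
      using Nu Nu' by simp
    ultimately show "\<exists>N u. N \<noteq> 0 \<and> frag_cmul N z - (\<Sum>s\<in>S \<union> T. frag_cmul (u s) s) \<in> B"
      by (intro exI[of _ "N' * N"] exI[of _ ?w] conjI)
  qed
qed

text \<open>A set that is independent in \<open>Z\<close> modulo \<open>Y\<close>, or in
  \<open>Y\<close> modulo \<open>B\<close>, is also independent in \<open>Z\<close> modulo
  \<open>B\<close>. This bounds both kinds of sets and makes the two ranks exist.\<close>

lemma frag_rank_tower:
  assumes sub: "frag_subgroup Z" "frag_subgroup Y" "frag_subgroup B" and "B \<subseteq> Y" "Y \<subseteq> Z"
    and n: "frag_rank Z B n"
  obtains k l where "frag_rank Z Y k" "frag_rank Y B l" "n = k + l"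
proof -
  have "card T \<le> n" if "T \<subseteq> Z" "frag_indep Y T" for T
    using that assms(4) by (intro frag_indep_card_le[OF sub(3) n]) (unfold frag_indep_def, blast+)
  then obtain k where k: "frag_rank Z Y k"
    using frag_rank_exists[OF sub(2)] by metis
  have "card T \<le> n" if "T \<subseteq> Y" "frag_indep B T" for T
    using that assms(5) by (intro frag_indep_card_le[OF sub(3) n]) auto
  then obtain l where l: "frag_rank Y B l"
    using frag_rank_exists[OF sub(3)] by metis
  have "n = k + l"
    using frag_rank_tower_sum[OF assms(1-5) k l] frag_rank_unique[OF sub(3) n] by blast
  with k l that show ?thesis
    by blast
qed

section \<open>Rational cohomology from integral homology\<close>

lemma frag_hom_cmul_sum:
  fixes f :: "('a \<Rightarrow>\<^sub>0 int) \<Rightarrow> rat"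
  assumes H: "frag_subgroup H" and f: "\<And>x y. x \<in> H \<Longrightarrow> y \<in> H \<Longrightarrow> f (x - y) = f x - f y"
  shows frag_hom_add: "x \<in> H \<Longrightarrow> y \<in> H \<Longrightarrow> f (x + y) = f x + f y"
    and frag_hom_cmul: "x \<in> H \<Longrightarrow> f (frag_cmul k x) = of_int k * f x"
    and frag_hom_sum: "(\<And>i. i \<in> I \<Longrightarrow> h i \<in> H) \<Longrightarrow> f (\<Sum>i\<in>I. h i) = (\<Sum>i\<in>I. f (h i))"
proof -
  have 0: "f 0 = 0"
    using f[of 0 0] frag_subgroup_0[OF H] by simp
  then have m: "f (- y) = - f y" if "y \<in> H" for y
    using f[of 0 y] frag_subgroup_0[OF H] that by simp
  show a: "f (x + y) = f x + f y" if "x \<in> H" "y \<in> H" for x y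
    using f[of x "- y"] m[of y] that frag_subgroup_uminus[OF H] by simp
  have *: "f (frag_cmul (int n) x) = of_int (int n) * f x" if "x \<in> H" for n
    by (induction n) (auto simp: 0 a that frag_cmul_distrib frag_subgroup_cmul[OF H] algebra_simps)
  show "f (frag_cmul k x) = of_int k * f x" if x: "x \<in> H"
  proof (cases k rule: int_cases2)
    case (nonpos n)
    then show ?thesis
      using *[OF x, of n] m[of "frag_cmul (int n) x"] frag_subgroup_cmul[OF H x] by simp
  qed (use *[OF x] in auto)
  show "f (\<Sum>i\<in>I. h i) = (\<Sum>i\<in>I. f (h i))" if "\<And>i. i \<in> I \<Longrightarrow> h i \<in> H"
    using that
    by (induction I rule: infinite_finite_induct) (auto simp: 0 a frag_subgroup_sum[OF H])
qed

text \<open>The rationals are injective; here this comes from extending a linear map defined on a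
  maximal independent subset of the rational span of \<open>H\<close>.\<close>
lemma frag_hom_extend:
  fixes f :: "('a \<Rightarrow>\<^sub>0 int) \<Rightarrow> rat"
  assumes H: "frag_subgroup H" and f: "\<And>x y. x \<in> H \<Longrightarrow> y \<in> H \<Longrightarrow> f (x - y) = f x - f y"
  obtains g where "\<And>x y. g (x - y) = g x - g y" "\<And>x. x \<in> H \<Longrightarrow> g x = f x"
proof -
  interpret P: vector_space_pair "fun_scale :: rat \<Rightarrow> ('a \<Rightarrow> rat) \<Rightarrow> 'a \<Rightarrow> rat" "(*) :: rat \<Rightarrow> rat \<Rightarrow> rat"
    by unfold_locales (auto simp: algebra_simps)
  \<comment> \<open>\<open>E\<close> embeds the free abelian group into a rational vector space,
    where bases and extensions of linear maps are available.\<close>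
  define E :: "('a \<Rightarrow>\<^sub>0 int) \<Rightarrow> 'a \<Rightarrow> rat" where "E c = (\<lambda>s. of_int (Poly_Mapping.lookup c s))" for c
  have E_diff: "E (x - y) = E x - E y" for x y
    by (auto simp: E_def lookup_minus fun_eq_iff)
  have E_cmul: "E (frag_cmul k x) = of_int k *\<^sub>f E x" for k x
    by (auto simp: E_def fun_eq_iff fun_scale_def)
  have E_sum: "E (\<Sum>i\<in>I. h i) = (\<Sum>i\<in>I. E (h i))" for I and h :: "('a \<Rightarrow> rat) \<Rightarrow> _"
    by (induction I rule: infinite_finite_induct) (auto simp: E_def lookup_add fun_eq_iff)
  have E_inj: "x = y" if "E x = E y" for x y
    using that by (intro poly_mapping_eqI) (auto simp: E_def fun_eq_iff)
  obtain Bs where Bs: "Bs \<subseteq> E ` H" "fun_space.independent Bs" "E ` H \<subseteq> fun_space.span Bs"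
    using fun_space.maximal_independent_subset by metis
  define h where "h b = (SOME x. x \<in> H \<and> E x = b)" for b
  have h: "h b \<in> H" "E (h b) = b" if "b \<in> Bs" for b
  proof -
    have "\<exists>x. x \<in> H \<and> E x = b"
      using Bs(1) that by auto
    from someI_ex[OF this] show "h b \<in> H" "E (h b) = b"
      by (auto simp: h_def)
  qed
  obtain G where lin: "Vector_Spaces.linear fun_scale (*) G" and G: "\<And>b. b \<in> Bs \<Longrightarrow> G b = f (h b)"
    using P.linear_independent_extend[OF Bs(2), of "\<lambda>b. f (h b)"] by blast
  show ?thesis
  proof
    show "G (E (x - y)) = G (E x) - G (E y)" for x y
      by (simp add: E_diff P.linear_diff[OF lin])
    fix x
    assume x: "x \<in> H"
    then have "E x \<in> fun_space.span Bs"
      using Bs by blast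
    then obtain t r where t: "finite t" "t \<subseteq> Bs" and Ex: "E x = (\<Sum>a\<in>t. r a *\<^sub>f a)"
      unfolding fun_space.span_explicit by blast
    \<comment> \<open>\<open>f\<close> is additive only on \<open>H\<close>, so the rational
      coefficients of \<open>E x\<close> are cleared before \<open>f\<close> is applied to the
      combination.\<close>
    obtain N v where N: "N > (0::int)" and v: "\<forall>a\<in>t. of_int (v a) = of_int N * r a"
      using common_denominator[OF t(1), of r] by blast
    have NEx: "of_int N *\<^sub>f E x = (\<Sum>a\<in>t. of_int (v a) *\<^sub>f a)"
      unfolding Ex fun_space.scale_sum_right using v by (intro sum.cong) auto
    have hH: "h a \<in> H" "E (h a) = a" "G a = f (h a)" if "a \<in> t" for a
      using t that h G by auto
    have "E (frag_cmul N x) = E (\<Sum>a\<in>t. frag_cmul (v a) (h a))"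
      unfolding E_cmul NEx E_sum by (intro sum.cong) (auto simp: hH)
    then have "f (frag_cmul N x) = f (\<Sum>a\<in>t. frag_cmul (v a) (h a))"
      using E_inj by metis
    also have "\<dots> = (\<Sum>a\<in>t. f (frag_cmul (v a) (h a)))"
      using frag_subgroup_cmul[OF H] hH by (intro frag_hom_sum[OF H f]) auto
    also have "\<dots> = (\<Sum>a\<in>t. of_int (v a) * G a)"
      using frag_hom_cmul[OF H f] hH by (intro sum.cong) auto
    also have "\<dots> = G (of_int N *\<^sub>f E x)"
      unfolding NEx P.linear_sum[OF lin] using P.linear_scale[OF lin] by (intro sum.cong) auto
    also have "\<dots> = of_int N * G (E x)"
      by (rule P.linear_scale[OF lin])
    also have "f (frag_cmul N x) = of_int N * f x"
      by (rule frag_hom_cmul[OF H f x])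
    finally show "G (E x) = f x"
      using N by simp
  qed
qed

section \<open>The Kronecker pairing of rational cochains with integral chains\<close>

definition cochain_eval :: "('s \<Rightarrow> rat) \<Rightarrow> ('s \<Rightarrow>\<^sub>0 int) \<Rightarrow> rat" where
  "cochain_eval \<phi> c = (\<Sum>i\<in>Poly_Mapping.keys c. of_int (Poly_Mapping.lookup c i) * \<phi> i)"

lemma cochain_eval_superset:
  "finite K \<Longrightarrow> Poly_Mapping.keys c \<subseteq> K \<Longrightarrow>
    cochain_eval \<phi> c = (\<Sum>i\<in>K. of_int (Poly_Mapping.lookup c i) * \<phi> i)"
  unfolding cochain_eval_def by (rule sum.mono_neutral_left) (auto simp: in_keys_iff)

lemma cochain_eval_diff: "cochain_eval \<phi> (x - y) = cochain_eval \<phi> x - cochain_eval \<phi> y"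
proof -
  let ?K = "Poly_Mapping.keys x \<union> Poly_Mapping.keys y"
  have "Poly_Mapping.keys (x - y) \<subseteq> ?K"
    by (rule keys_diff)
  then show ?thesis
    using cochain_eval_superset[of ?K _ \<phi>]
    by (simp add: lookup_minus sum_subtractf algebra_simps)
qed

lemma frag_subgroup_UNIV: "frag_subgroup UNIV"
  by (simp add: frag_subgroup_def)

lemma cochain_eval_cmul: "cochain_eval \<phi> (frag_cmul k x) = of_int k * cochain_eval \<phi> x"
  by (rule frag_hom_cmul[OF frag_subgroup_UNIV cochain_eval_diff]) auto

lemma cochain_eval_sum: "cochain_eval \<phi> (\<Sum>i\<in>I. h i) = (\<Sum>i\<in>I. cochain_eval \<phi> (h i))"
  by (rule frag_hom_sum[OF frag_subgroup_UNIV cochain_eval_diff]) auto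

lemma cochain_eval_of [simp]: "cochain_eval \<phi> (frag_of s) = \<phi> s"
  by (simp add: cochain_eval_def)

lemma cochain_eval_0_left [simp]: "cochain_eval 0 c = 0"
  by (simp add: cochain_eval_def)

lemma cochain_eval_0_right [simp]: "cochain_eval \<phi> 0 = 0"
  by (simp add: cochain_eval_def)

lemma cochain_eval_diff_left: "cochain_eval (\<phi> - \<psi>) c = cochain_eval \<phi> c - cochain_eval \<psi> c"
  by (simp add: cochain_eval_def algebra_simps sum_subtractf)

lemma cochain_eval_sum_left: "cochain_eval (\<Sum>s\<in>S. u s *\<^sub>f \<phi> s) c = (\<Sum>s\<in>S. u s * cochain_eval (\<phi> s) c)"
proof (induction S rule: infinite_finite_induct)
  case (insert x F)
  have "cochain_eval (u x *\<^sub>f \<phi> x + (\<Sum>s\<in>F. u s *\<^sub>f \<phi> s)) c =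
      u x * cochain_eval (\<phi> x) c + cochain_eval (\<Sum>s\<in>F. u s *\<^sub>f \<phi> s) c"
    by (simp add: cochain_eval_def fun_scale_def sum_distrib_left sum.distrib algebra_simps)
  then show ?case
    by (simp only: sum.insert[OF insert.hyps] insert.IH)
qed (simp_all add: cochain_eval_def)

lemma hom_eq_on_chains:
  fixes f g :: "'a chain \<Rightarrow> rat"
  assumes "singular_chain p X c" and f: "\<And>x y. f (x - y) = f x - f y" and g: "\<And>x y. g (x - y) = g x - g y"
    and "\<And>s. singular_simplex p X s \<Longrightarrow> f (frag_of s) = g (frag_of s)"
  shows "f c = g c"
proof -
  have "Poly_Mapping.keys c \<subseteq> singular_simplex_set p X"
    using assms by (simp add: singular_chain_def)
  then show ?thesis
  proof (induction c rule: frag_induction)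
    case zero
    show ?case
      using f[of 0 0] g[of 0 0] by simp
  qed (use assms in auto)
qed

lemma coboundary_map_eval:
  "singular_simplex (Suc p) X s \<Longrightarrow>
    coboundary_map p X \<phi> s = cochain_eval \<phi> (chain_boundary (Suc p) (frag_of s))"
  unfolding coboundary_map_def
  by (simp add: chain_boundary_of cochain_eval_sum cochain_eval_cmul del: sum.atMost_Suc)

lemma cochain_eval_coboundary:
  assumes "singular_chain (Suc p) X c"
  shows "cochain_eval (coboundary_map p X \<phi>) c = cochain_eval \<phi> (chain_boundary (Suc p) c)"
  by (rule hom_eq_on_chains[OF assms])
     (auto simp: cochain_eval_diff chain_boundary_diff coboundary_map_eval)

definition cochain_of_hom :: "nat \<Rightarrow> 'a topology \<Rightarrow> ('a chain \<Rightarrow> rat) \<Rightarrow> ((nat \<Rightarrow> real) \<Rightarrow> 'a) \<Rightarrow> rat" where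
  "cochain_of_hom p X g s = (if singular_simplex p X s then g (frag_of s) else 0)"

lemma cochain_of_hom_in: "cochain_of_hom p X g \<in> singular_cochains p X"
  by (simp add: cochain_of_hom_def singular_cochains_def)

lemma cochain_eval_of_hom:
  assumes "\<And>x y. g (x - y) = g x - g y" "singular_chain p X c"
  shows "cochain_eval (cochain_of_hom p X g) c = g c"
  by (rule hom_eq_on_chains[OF assms(2)]) (auto simp: cochain_eval_diff assms(1) cochain_of_hom_def)

text \<open>As the coboundary is adjoint to the boundary under \<open>cochain_eval\<close>, the
  cocycles are the annihilator of the boundaries.\<close>

lemma singular_cocycles_iff:
  "\<phi> \<in> singular_cocycles p X \<longleftrightarrow>
    \<phi> \<in> singular_cochains p X \<and> (\<forall>c. singular_relboundary p X {} c \<longrightarrow> cochain_eval \<phi> c = 0)"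
proof -
  have "coboundary_map p X \<phi> = 0 \<longleftrightarrow> (\<forall>c. singular_relboundary p X {} c \<longrightarrow> cochain_eval \<phi> c = 0)"
  proof
    assume L: "coboundary_map p X \<phi> = 0"
    show "\<forall>c. singular_relboundary p X {} c \<longrightarrow> cochain_eval \<phi> c = 0"
    proof (intro allI impI)
      fix c
      assume "singular_relboundary p X {} c"
      then obtain d where "singular_chain (Suc p) X d" "chain_boundary (Suc p) d = c"
        by (auto simp: singular_boundary)
      then show "cochain_eval \<phi> c = 0"
        using cochain_eval_coboundary[of p X d \<phi>] L by simp
    qed
  next
    assume R: "\<forall>c. singular_relboundary p X {} c \<longrightarrow> cochain_eval \<phi> c = 0"
    show "coboundary_map p X \<phi> = 0"
    proof
      fix s
      show "coboundary_map p X \<phi> s = 0 s"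
      proof (cases "singular_simplex (Suc p) X s")
        case True
        then have "singular_relboundary p X {} (chain_boundary (Suc p) (frag_of s))"
          unfolding singular_boundary by (intro exI[of _ "frag_of s"]) (simp add: singular_chain_of)
        then show ?thesis
          using R True by (simp add: coboundary_map_eval)
      qed (simp add: coboundary_map_def)
    qed
  qed
  then show ?thesis
    by (simp add: singular_cocycles_def)
qed

text \<open>A cochain that vanishes on cycles factors through the boundary map, and the resulting
  functional on boundaries extends to all chains because the rationals are injective. In degree 0
  every simplex is a cycle, so only the zero cochain vanishes on all cycles.\<close>

lemma singular_coboundaries_iff:
  "\<phi> \<in> singular_coboundaries p X \<longleftrightarrow>
    \<phi> \<in> singular_cochains p X \<and> (\<forall>c. singular_relcycle p X {} c \<longrightarrow> cochain_eval \<phi> c = 0)"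
proof (cases p)
  case 0
  have "\<phi> = 0" if "\<phi> \<in> singular_cochains 0 X" "\<forall>c. singular_relcycle 0 X {} c \<longrightarrow> cochain_eval \<phi> c = 0"
  proof
    fix s
    show "\<phi> s = 0 s"
    proof (cases "singular_simplex 0 X s")
      case True
      then have "singular_relcycle 0 X {} (frag_of s)"
        by (simp add: singular_cycle singular_chain_of chain_boundary_def)
      then show ?thesis
        using that by fastforce
    qed (use that in \<open>auto simp: singular_cochains_def\<close>)
  qed
  then show ?thesis
    using 0 by (auto simp: singular_coboundaries_def singular_cochains_def)
next
  case (Suc q)
  show ?thesis
  proof
    assume "\<phi> \<in> singular_coboundaries p X"
    then obtain \<psi> where "\<phi> = coboundary_map q X \<psi>"
      using Suc by (auto simp: singular_coboundaries_def)
    moreover have "coboundary_map q X \<psi> \<in> singular_cochains (Suc q) X"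
      by (simp add: singular_cochains_def coboundary_map_def)
    ultimately show "\<phi> \<in> singular_cochains p X \<and> (\<forall>c. singular_relcycle p X {} c \<longrightarrow> cochain_eval \<phi> c = 0)"
      using Suc by (simp add: cochain_eval_coboundary singular_cycle)
  next
    assume R: "\<phi> \<in> singular_cochains p X \<and> (\<forall>c. singular_relcycle p X {} c \<longrightarrow> cochain_eval \<phi> c = 0)"
    define H where "H = {chain_boundary p c | c. singular_chain p X c}"
    \<comment> \<open>The value does not depend on the chosen chain: two chains with the same
      boundary differ by a cycle, on which \<open>\<phi>\<close> vanishes.\<close>
    define \<theta> where "\<theta> b = cochain_eval \<phi> (SOME c. singular_chain p X c \<and> chain_boundary p c = b)" for b
    have \<theta>: "\<theta> (chain_boundary p c) = cochain_eval \<phi> c" if c: "singular_chain p X c" for c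
    proof -
      define c' where "c' = (SOME c'. singular_chain p X c' \<and> chain_boundary p c' = chain_boundary p c)"
      have "singular_chain p X c' \<and> chain_boundary p c' = chain_boundary p c"
        unfolding c'_def by (rule someI[of _ c]) (use c in auto)
      then have "singular_relcycle p X {} (c' - c)"
        using c by (simp add: singular_cycle chain_boundary_diff singular_chain_diff)
      then have "cochain_eval \<phi> (c' - c) = 0"
        using R by blast
      then show ?thesis
        by (simp add: \<theta>_def c'_def cochain_eval_diff)
    qed
    have H: "frag_subgroup H"
      unfolding frag_subgroup_def H_def
    proof (intro conjI ballI)
      show "0 \<in> {chain_boundary p c | c. singular_chain p X c}"
        by (auto intro!: exI[of _ 0])
      fix x y
      assume "x \<in> {chain_boundary p c | c. singular_chain p X c}" "y \<in> {chain_boundary p c | c. singular_chain p X c}"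
      then obtain c d where "x = chain_boundary p c" "singular_chain p X c" "y = chain_boundary p d" "singular_chain p X d"
        by auto
      then show "x - y \<in> {chain_boundary p c | c. singular_chain p X c}"
        by (intro CollectI exI[of _ "c - d"]) (simp add: chain_boundary_diff singular_chain_diff)
    qed
    have "\<theta> (x - y) = \<theta> x - \<theta> y" if xy: "x \<in> H" "y \<in> H" for x y
    proof -
      obtain c d where "x = chain_boundary p c" "singular_chain p X c" "y = chain_boundary p d" "singular_chain p X d"
        using xy by (auto simp: H_def)
      then show ?thesis
        using \<theta>[of "c - d"] \<theta>[of c] \<theta>[of d] by (simp add: chain_boundary_diff singular_chain_diff cochain_eval_diff)
    qed
    then obtain g where g: "\<And>x y. g (x - y) = g x - g y" "\<And>x. x \<in> H \<Longrightarrow> g x = \<theta> x"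
      using frag_hom_extend[OF H, of \<theta>] by blast
    have "coboundary_map q X (cochain_of_hom q X g) s = \<phi> s" for s
    proof (cases "singular_simplex p X s")
      case True
      then have s: "singular_chain p X (frag_of s)"
        by (simp add: singular_chain_of)
      then have "singular_chain q X (chain_boundary p (frag_of s))"
        using singular_chain_boundary[OF s] Suc by simp
      then have "coboundary_map q X (cochain_of_hom q X g) s = g (chain_boundary p (frag_of s))"
        using coboundary_map_eval[of q X s] True Suc cochain_eval_of_hom[of g q X, OF g(1)] by simp
      also have "\<dots> = \<phi> s"
        using g(2)[of "chain_boundary p (frag_of s)"] \<theta>[OF s] s by (auto simp: H_def)
      finally show ?thesis .
    next
      case False
      then show ?thesis
        using R Suc by (auto simp: coboundary_map_def singular_cochains_def)
    qed
    then have "\<phi> = coboundary_map q X (cochain_of_hom q X g)"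
      by auto
    then show "\<phi> \<in> singular_coboundaries p X"
      using Suc cochain_of_hom_in by (auto simp: singular_coboundaries_def)
  qed
qed

lemma frag_subgroup_relcycles: "frag_subgroup (singular_relcycle_set p X S)"
  by (simp add: frag_subgroup_def singular_relcycle_diff)

lemma frag_subgroup_relboundaries: "frag_subgroup (singular_relboundary_set p X S)"
  by (simp add: frag_subgroup_def singular_relboundary_diff)

text \<open>On the group \<open>H\<close> of elements congruent modulo \<open>B\<close> to
  combinations of \<open>S\<close>, the coefficient at \<open>s\<close> is well defined by
  independence. As a homomorphism to the rationals it extends to the whole free group.\<close>

lemma dual_basis:
  assumes B: "frag_subgroup B" and S: "frag_indep B S" and s: "s \<in> S"
  obtains g :: "('a \<Rightarrow>\<^sub>0 int) \<Rightarrow> rat" where "\<And>x y. g (x - y) = g x - g y" "\<And>x. x \<in> B \<Longrightarrow> g x = 0"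
    "g s = 1" "\<And>t. t \<in> S \<Longrightarrow> t \<noteq> s \<Longrightarrow> g t = 0"
proof -
  have fin: "finite S"
    using S by (simp add: frag_indep_def)
  define comb where "comb u = (\<Sum>t\<in>S. frag_cmul (u t) t)" for u :: "_ \<Rightarrow> int"
  have comb_diff: "comb u - comb v = comb (\<lambda>t. u t - v t)" for u v
    by (simp add: comb_def sum_subtractf frag_cmul_diff_distrib)
  define H where "H = {x. \<exists>u. x - comb u \<in> B}"
  define f where "f x = (of_int ((SOME u. x - comb u \<in> B) s) :: rat)" for x
  have f: "f x = of_int (u s)" if u: "x - comb u \<in> B" for x u
  proof -
    define v where "v = (SOME u. x - comb u \<in> B)"
    have "x - comb v \<in> B"
      unfolding v_def by (rule someI[of "\<lambda>u. x - comb u \<in> B" u, OF u])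
    from frag_subgroup_diff[OF B this u] have "comb (\<lambda>t. u t - v t) \<in> B"
      by (simp flip: comb_diff)
    then have "u s - v s = 0"
      using frag_indepD[OF S, of "\<lambda>t. u t - v t" s] s by (simp add: comb_def)
    then show ?thesis
      by (simp add: f_def v_def)
  qed
  have sub: "(x - y) - comb (\<lambda>t. u t - v t) \<in> B" if "x - comb u \<in> B" "y - comb v \<in> B" for x y u v
    using frag_subgroup_diff[OF B that] by (simp add: algebra_simps flip: comb_diff)
  have comb0: "comb (\<lambda>_. 0) = 0"
    by (simp add: comb_def)
  have inB: "x - comb (\<lambda>_. 0) \<in> B" if "x \<in> B" for x
    using that comb0 by simp
  have inS: "t - comb (\<lambda>r. if r = t then 1 else 0) \<in> B" if "t \<in> S" for t
  proof -
    have "comb (\<lambda>r. if r = t then 1 else 0) = (\<Sum>r\<in>S. if r = t then t else 0)"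
      unfolding comb_def by (intro sum.cong) auto
    also have "\<dots> = t"
      using fin that by simp
    finally show ?thesis
      by (simp add: frag_subgroup_0[OF B])
  qed
  have H: "frag_subgroup H"
    unfolding frag_subgroup_def
  proof (intro conjI ballI)
    show "0 \<in> H"
      using inB[OF frag_subgroup_0[OF B]] unfolding H_def by (intro CollectI exI)
    fix x y
    assume "x \<in> H" "y \<in> H"
    obtain u where u: "x - comb u \<in> B"
      using \<open>x \<in> H\<close> unfolding H_def mem_Collect_eq ..
    obtain v where v: "y - comb v \<in> B"
      using \<open>y \<in> H\<close> unfolding H_def mem_Collect_eq ..
    from sub[OF u v] show "x - y \<in> H"
      unfolding H_def by (intro CollectI exI)
  qed
  have "f (x - y) = f x - f y" if xy: "x \<in> H" "y \<in> H" for x y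
  proof -
    obtain u where u: "x - comb u \<in> B"
      using xy(1) unfolding H_def mem_Collect_eq ..
    obtain v where v: "y - comb v \<in> B"
      using xy(2) unfolding H_def mem_Collect_eq ..
    show ?thesis
      using f[OF sub[OF u v]] f[OF u] f[OF v] by simp
  qed
  then obtain g where g: "\<And>x y. g (x - y) = g x - g y" "\<And>x. x \<in> H \<Longrightarrow> g x = f x"
    using frag_hom_extend[OF H, of f] by blast
  show ?thesis
  proof
    show "g x = 0" if "x \<in> B" for x
    proof -
      have "x \<in> H"
        using inB[OF that] unfolding H_def by (intro CollectI exI)
      then show ?thesis
        using g(2) f[OF inB[OF that]] by simp
    qed
    have gt: "g t = (if s = t then 1 else 0)" if "t \<in> S" for t
    proof -
      have "t \<in> H"
        using inS[OF that] unfolding H_def by (intro CollectI exI)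
      then show ?thesis
        using g(2) f[OF inS[OF that]] by simp
    qed
    show "g s = 1" "\<And>t. t \<in> S \<Longrightarrow> t \<noteq> s \<Longrightarrow> g t = 0"
      using gt s by auto
  qed (rule g(1))
qed

text \<open>Universal coefficients over the rationals: the functionals dual to a maximal independent
  set of cycles represent a basis of the cohomology.\<close>

proposition has_betti_number_of_rank:
  assumes "frag_rank (singular_relcycle_set p X {}) (singular_relboundary_set p X {}) n"
  shows "has_betti_number p X n"
proof -
  let ?Z = "singular_relcycle_set p X {}" and ?B = "singular_relboundary_set p X {}"
  obtain S where S: "S \<subseteq> ?Z" "frag_indep ?B S" "card S = n"
    and span: "\<forall>z\<in>?Z. \<exists>N u. N \<noteq> 0 \<and> frag_cmul N z - (\<Sum>s\<in>S. frag_cmul (u s) s) \<in> ?B"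
    using assms unfolding frag_rank_def by blast
  have fin: "finite S"
    using S by (simp add: frag_indep_def)
  have "\<forall>s\<in>S. \<exists>g :: _ \<Rightarrow> rat. (\<forall>x y. g (x - y) = g x - g y) \<and> (\<forall>x\<in>?B. g x = 0) \<and>
      (\<forall>t\<in>S. g t = (if t = s then 1 else 0))"
  proof
    fix s
    assume "s \<in> S"
    from dual_basis[OF frag_subgroup_relboundaries S(2) this] show
      "\<exists>g :: _ \<Rightarrow> rat. (\<forall>x y. g (x - y) = g x - g y) \<and> (\<forall>x\<in>?B. g x = 0) \<and>
      (\<forall>t\<in>S. g t = (if t = s then 1 else 0))"
      by metis
  qed
  from bchoice[OF this] obtain G :: "_ \<Rightarrow> _ \<Rightarrow> rat" where "\<forall>s\<in>S. (\<forall>x y. G s (x - y) = G s x - G s y) \<and>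
      (\<forall>x\<in>?B. G s x = 0) \<and> (\<forall>t\<in>S. G s t = (if t = s then 1 else 0))" ..
  then have G: "\<And>s x y. s \<in> S \<Longrightarrow> G s (x - y) = G s x - G s y"
    and GB: "\<And>s x. s \<in> S \<Longrightarrow> x \<in> ?B \<Longrightarrow> G s x = 0"
    and GS: "\<And>s t. s \<in> S \<Longrightarrow> t \<in> S \<Longrightarrow> G s t = (if t = s then 1 else 0)"
    by blast+
  define \<Phi> where "\<Phi> s = cochain_of_hom p X (G s)" for s
  have ev: "cochain_eval (\<Phi> s) c = G s c" if "s \<in> S" "singular_chain p X c" for s c
    unfolding \<Phi>_def using G that by (intro cochain_eval_of_hom) auto
  have chainZ: "singular_chain p X c" if "c \<in> ?Z" for c
    using that by (simp add: singular_cycle)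
  have chainS: "singular_chain p X c" if "c \<in> S" for c
    using that S chainZ by blast
  have evS: "cochain_eval (\<Phi> s) t = (if t = s then 1 else 0)" if "s \<in> S" "t \<in> S" for s t
    using ev[OF that(1) chainS[OF that(2)]] GS[OF that] by simp
  have inj: "inj_on \<Phi> S"
  proof (rule inj_onI)
    fix s t
    assume st: "s \<in> S" "t \<in> S" "\<Phi> s = \<Phi> t"
    have "(if t = s then 1 else 0 :: rat) = cochain_eval (\<Phi> s) t"
      by (rule evS[symmetric]) (rule st)+
    also have "\<dots> = cochain_eval (\<Phi> t) t"
      unfolding st(3) ..
    also have "\<dots> = 1"
      using evS[OF st(2) st(2)] by simp
    finally show "s = t"
      by (simp split: if_splits)
  qed
  have coc: "\<Phi> s \<in> singular_cocycles p X" if "s \<in> S" for s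
    unfolding singular_cocycles_iff
  proof (intro conjI allI impI)
    show "\<Phi> s \<in> singular_cochains p X"
      unfolding \<Phi>_def by (rule cochain_of_hom_in)
    fix c
    assume "singular_relboundary p X {} c"
    then show "cochain_eval (\<Phi> s) c = 0"
      using ev[OF that, of c] GB[OF that, of c] singular_boundary_imp_chain by auto
  qed
  have sumS: "(\<Sum>t\<in>\<Phi> ` S. u t *\<^sub>f t) = (\<Sum>s\<in>S. u (\<Phi> s) *\<^sub>f \<Phi> s)" for u
    by (simp add: sum.reindex[OF inj])
  have eval_sum: "cochain_eval (\<Sum>s\<in>S. w s *\<^sub>f \<Phi> s) t = w t" if "t \<in> S" for w t
  proof -
    have "cochain_eval (\<Sum>s\<in>S. w s *\<^sub>f \<Phi> s) t = (\<Sum>s\<in>S. if t = s then w s else 0)"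
      unfolding cochain_eval_sum_left using evS that by (intro sum.cong) auto
    then show ?thesis
      using that fin by simp
  qed
  show ?thesis
    unfolding has_betti_number_def has_quotient_dim_def
  proof (intro exI[of _ "\<Phi> ` S"] conjI allI impI ballI)
    show "\<Phi> ` S \<subseteq> singular_cocycles p X" "finite (\<Phi> ` S)" "card (\<Phi> ` S) = n"
      using coc fin S card_image[OF inj] by auto
    fix u t
    assume u: "(\<Sum>s\<in>\<Phi> ` S. u s *\<^sub>f s) \<in> singular_coboundaries p X" and "t \<in> \<Phi> ` S"
    then obtain s where s: "s \<in> S" "t = \<Phi> s"
      by blast
    then have "singular_relcycle p X {} s"
      using S by blast
    then have "cochain_eval (\<Sum>s\<in>\<Phi> ` S. u s *\<^sub>f s) s = 0"
      using u by (simp add: singular_coboundaries_iff)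
    then show "u t = 0"
      using eval_sum[OF s(1), of "\<lambda>s. u (\<Phi> s)"] s by (simp add: sumS)
  next
    fix z
    assume z: "z \<in> singular_cocycles p X"
    \<comment> \<open>Subtracting the combination with the same values on \<open>S\<close> leaves a
      cocycle that vanishes on \<open>S\<close> and on boundaries. Some nonzero multiple of each
      cycle is built from these, so \<open>w\<close> vanishes on all cycles and is a
      coboundary.\<close>
    define w where "w = z - (\<Sum>s\<in>S. cochain_eval z s *\<^sub>f \<Phi> s)"
    have wcoch: "w \<in> singular_cochains p X"
    proof -
      have "\<Phi> s \<in> singular_cochains p X" if "s \<in> S" for s
        using coc[OF that] by (simp add: singular_cocycles_iff)
      moreover have "fun_space.subspace (singular_cochains p X)"
        by (auto simp: fun_space.subspace_def singular_cochains_def fun_scale_def)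
      ultimately show ?thesis
        using z unfolding w_def
        by (intro fun_space.subspace_diff fun_space.subspace_sum fun_space.subspace_scale)
           (auto simp: singular_cocycles_iff)
    qed
    have wS: "cochain_eval w s = 0" if "s \<in> S" for s
      using eval_sum[OF that] by (simp add: w_def cochain_eval_diff_left)
    have wB: "cochain_eval w b = 0" if "singular_relboundary p X {} b" for b
    proof -
      have "cochain_eval (\<Phi> s) b = 0" if "s \<in> S" for s
        using coc[OF that] \<open>singular_relboundary p X {} b\<close> by (simp add: singular_cocycles_iff)
      then show ?thesis
        using z that by (simp add: w_def cochain_eval_diff_left cochain_eval_sum_left singular_cocycles_iff)
    qed
    have "cochain_eval w c = 0" if c: "singular_relcycle p X {} c" for c
    proof -
      obtain N u where N: "N \<noteq> 0" "singular_relboundary p X {} (frag_cmul N c - (\<Sum>s\<in>S. frag_cmul (u s) s))"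
        using bspec[OF span, of c] c by (auto simp only: mem_Collect_eq)
      from wB[OF N(2)] have "of_int N * cochain_eval w c = 0"
        using wS by (simp add: cochain_eval_diff cochain_eval_cmul cochain_eval_sum)
      then show ?thesis
        using N by simp
    qed
    then have "w \<in> singular_coboundaries p X"
      using wcoch by (simp add: singular_coboundaries_iff)
    moreover have "w = z - (\<Sum>t\<in>\<Phi> ` S. cochain_eval z (the_inv_into S \<Phi> t) *\<^sub>f t)"
      unfolding sumS w_def by (intro arg_cong2[where f = "(-)"] refl sum.cong) (simp_all add: the_inv_into_f_f[OF inj])
    ultimately show "\<exists>u. z - (\<Sum>s\<in>\<Phi> ` S. u s *\<^sub>f s) \<in> singular_coboundaries p X"
      by (intro exI[of _ "\<lambda>t. cochain_eval z (the_inv_into S \<Phi> t)"]) simp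
  qed
qed

lemma subspace_singular_coboundaries: "fun_space.subspace (singular_coboundaries p X)"
proof (rule fun_space.subspaceI)
  show "0 \<in> singular_coboundaries p X"
    by (simp add: singular_coboundaries_iff singular_cochains_def)
  fix x
  assume x: "x \<in> singular_coboundaries p X"
  have "cochain_eval (k *\<^sub>f x) c = k * cochain_eval x c" for k c
    by (simp add: cochain_eval_def fun_scale_def sum_distrib_left algebra_simps)
  with x show "k *\<^sub>f x \<in> singular_coboundaries p X" for k
    unfolding singular_coboundaries_iff by (simp add: singular_cochains_def fun_scale_def)
  fix y
  assume y: "y \<in> singular_coboundaries p X"
  have "cochain_eval (x + y) c = cochain_eval x c + cochain_eval y c" for c
    by (simp add: cochain_eval_def sum.distrib algebra_simps)
  moreover have "x + y \<in> singular_cochains p X"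
    using x y by (simp add: singular_coboundaries_iff singular_cochains_def)
  ultimately show "x + y \<in> singular_coboundaries p X"
    using x y unfolding singular_coboundaries_iff by simp
qed

lemma betti_number_eq:
  assumes "frag_rank (singular_relcycle_set p X {}) (singular_relboundary_set p X {}) n"
  shows "betti_number p X = n"
  unfolding betti_number_def
proof (rule the_equality)
  show "has_betti_number p X n"
    by (rule has_betti_number_of_rank[OF assms])
  then show "\<And>n'. has_betti_number p X n' \<Longrightarrow> n' = n"
    unfolding has_betti_number_def using has_quotient_dim_unique[OF subspace_singular_coboundaries] by blast
qed

section \<open>Additivity of the Euler characteristic\<close>

definition homology_rank :: "nat \<Rightarrow> 'a topology \<Rightarrow> 'a set \<Rightarrow> nat \<Rightarrow> bool" where
  "homology_rank p X S n \<longleftrightarrow> frag_rank (singular_relcycle_set p X S) (singular_relboundary_set p X S) n"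

text \<open>Existence of all ranks and their vanishing in high degrees belong to the predicate, so
  that finite-dimensional cohomology is carried through every additivity step.\<close>

definition has_euler :: "'a topology \<Rightarrow> int \<Rightarrow> bool" where
  "has_euler X e \<longleftrightarrow> (\<exists>h N. (\<forall>p. homology_rank p X {} (h p)) \<and> (\<forall>p\<ge>N. h p = 0) \<and>
      e = (\<Sum>p<N. (- 1) ^ p * int (h p)))"

lemma has_euler_imp_cohomology:
  assumes "has_euler X e"
  shows "finite_cohomology X" "euler_characteristic X = e"
proof -
  obtain h N where h: "\<And>p. homology_rank p X {} (h p)" and N: "\<And>p. p \<ge> N \<Longrightarrow> h p = 0"
    and e: "e = (\<Sum>p<N. (- 1) ^ p * int (h p))"
    using assms unfolding has_euler_def by blast
  have b: "betti_number p X = h p" for p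
    using h betti_number_eq unfolding homology_rank_def by blast
  have "p < N" if "h p \<noteq> 0" for p
    using that N[of p] by linarith
  then have sub: "{p. h p \<noteq> 0} \<subseteq> {..<N}"
    by auto
  have "has_betti_number p X (h p)" for p
    using h[of p] has_betti_number_of_rank unfolding homology_rank_def by blast
  then show "finite_cohomology X"
    unfolding finite_cohomology_def b using finite_subset[OF sub] by auto
  show "euler_characteristic X = e"
    unfolding euler_characteristic_def e b using sub
    by (intro sum.mono_neutral_left) auto
qed

lemma frag_subgroup_chains: "frag_subgroup (singular_chain_set p X)"
  by (simp add: frag_subgroup_def singular_chain_diff)

lemma frag_subgroup_Int: "frag_subgroup A \<Longrightarrow> frag_subgroup B \<Longrightarrow> frag_subgroup (A \<inter> B)"
  by (simp add: frag_subgroup_def)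

definition frag_plus :: "('a \<Rightarrow>\<^sub>0 int) set \<Rightarrow> ('a \<Rightarrow>\<^sub>0 int) set \<Rightarrow> ('a \<Rightarrow>\<^sub>0 int) set" where
  "frag_plus A B = {x + y | x y. x \<in> A \<and> y \<in> B}"

lemma frag_plus_I: "x \<in> A \<Longrightarrow> y \<in> B \<Longrightarrow> x + y \<in> frag_plus A B"
  by (auto simp: frag_plus_def)

lemma frag_subgroup_plus:
  assumes "frag_subgroup A" "frag_subgroup B"
  shows "frag_subgroup (frag_plus A B)"
  unfolding frag_subgroup_def
proof (intro conjI ballI)
  show "0 \<in> frag_plus A B"
    using frag_plus_I[of 0 A 0 B] assms by (simp add: frag_subgroup_def)
  fix x y
  assume "x \<in> frag_plus A B" "y \<in> frag_plus A B"
  then obtain a b c d where "x = a + b" "y = c + d" "a \<in> A" "c \<in> A" "b \<in> B" "d \<in> B"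
    by (auto simp: frag_plus_def)
  then have "x - y = (a - c) + (b - d)" "a - c \<in> A" "b - d \<in> B"
    using assms by (simp_all add: frag_subgroup_diff)
  then show "x - y \<in> frag_plus A B"
    by (simp only: frag_plus_I)
qed

lemma frag_plus_left: "frag_subgroup B \<Longrightarrow> A \<subseteq> frag_plus A B"
  using frag_plus_I[of _ A 0 B] by (auto simp: frag_subgroup_0)

lemma frag_plus_right: "frag_subgroup A \<Longrightarrow> B \<subseteq> frag_plus A B"
  using frag_plus_I[of 0 A _ B] by (auto simp: frag_subgroup_0)

lemma frag_rank_second_iso:
  assumes "frag_subgroup A" "frag_subgroup B"
  shows "frag_rank A (A \<inter> B) n \<longleftrightarrow> frag_rank (frag_plus A B) B n"
proof (rule frag_rank_iso[where f = "\<lambda>x. x"])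
  show "z \<in> frag_plus A B" if "z \<in> A" for z
    using that frag_plus_left[OF assms(2)] by blast
  fix z'
  assume "z' \<in> frag_plus A B"
  then obtain x y where "z' = x + y" "x \<in> A" "y \<in> B"
    by (auto simp: frag_plus_def)
  then show "\<exists>z\<in>A. z' - z \<in> B"
    by (intro bexI[of _ x]) auto
qed (use assms in \<open>auto simp: frag_subgroup_Int\<close>)

section \<open>The long exact sequence of a pair, as identities between ranks\<close>

context
  fixes X :: "'a topology" and S :: "'a set"
begin

private abbreviation (input) "ZX p \<equiv> singular_relcycle_set p X {}"
private abbreviation (input) "BX p \<equiv> singular_relboundary_set p X {}"
private abbreviation (input) "ZS p \<equiv> singular_relcycle_set p (subtopology X S) {}"
private abbreviation (input) "BS p \<equiv> singular_relboundary_set p (subtopology X S) {}"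
private abbreviation (input) "ZR p \<equiv> singular_relcycle_set p X S"
private abbreviation (input) "BR p \<equiv> singular_relboundary_set p X S"
private abbreviation (input) "CS p \<equiv> singular_chain_set p (subtopology X S)"

private lemma sub_chain: "singular_chain p (subtopology X S) c \<Longrightarrow> singular_chain p X c"
  by (simp add: singular_chain_subtopology)

private lemma BS_sub: "BS p \<subseteq> ZS p \<inter> BX p"
proof
  fix c
  assume c: "c \<in> BS p"
  then obtain d where "singular_chain (Suc p) (subtopology X S) d" "chain_boundary (Suc p) d = c"
    by (auto simp: singular_boundary)
  then have "c \<in> BX p"
    using sub_chain by (auto simp: singular_boundary)
  then show "c \<in> ZS p \<inter> BX p"
    using c by (simp add: singular_relboundary_imp_relcycle)
qed

private lemma ZS_eq: "ZS p = ZX p \<inter> CS p"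
  using sub_chain by (auto simp: singular_cycle)

private lemma BR_eq: "BR p = frag_plus (BX p) (CS p)"
  unfolding frag_plus_def singular_relboundary[of _ X S] singular_boundary by blast

private lemma ZR_eq_rel: "frag_plus (ZX p) (CS p) \<subseteq> ZR p"
proof
  fix z
  assume "z \<in> frag_plus (ZX p) (CS p)"
  then obtain x c where "z = x + c" "x \<in> ZX p" "c \<in> CS p"
    by (auto simp: frag_plus_def)
  moreover from this have "singular_chain (p - 1) (subtopology X S) (chain_boundary p c)"
    by (simp add: singular_chain_boundary)
  ultimately show "z \<in> ZR p"
    by (auto simp: singular_relcycle chain_boundary_add sub_chain singular_chain_add singular_chain_empty)
qed

private lemmas subgroups =
  frag_subgroup_relcycles frag_subgroup_relboundaries frag_subgroup_chains frag_subgroup_Int frag_subgroup_plus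

text \<open>The ranks of the kernel of \<open>H\<^sub>p(S) \<rightarrow> H\<^sub>p(X)\<close>, of its image, and of the image of
  \<open>H\<^sub>p(X) \<rightarrow> H\<^sub>p(X, S)\<close>.\<close>
private definition "ker_rank p n \<longleftrightarrow> frag_rank (ZS p \<inter> BX p) (BS p) n"
private definition "im_rank p n \<longleftrightarrow> frag_rank (ZS p) (ZS p \<inter> BX p) n"
private definition "rel_im_rank p n \<longleftrightarrow> frag_rank (frag_plus (ZX p) (CS p)) (BR p) n"

private lemma sub_rank:
  shows "ker_rank p k \<Longrightarrow> im_rank p l \<Longrightarrow> homology_rank p (subtopology X S) {} (k + l)"
    and "homology_rank p (subtopology X S) {} n \<Longrightarrow> \<exists>k l. ker_rank p k \<and> im_rank p l \<and> n = k + l"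
proof -
  show "homology_rank p (subtopology X S) {} (k + l)" if "ker_rank p k" "im_rank p l"
    using frag_rank_tower_sum[of "ZS p" "ZS p \<inter> BX p" "BS p" l k] that BS_sub
    unfolding ker_rank_def im_rank_def homology_rank_def by (simp add: subgroups add.commute)
  show "\<exists>k l. ker_rank p k \<and> im_rank p l \<and> n = k + l" if "homology_rank p (subtopology X S) {} n"
    using frag_rank_tower[of "ZS p" "ZS p \<inter> BX p" "BS p" n] that BS_sub
    unfolding ker_rank_def im_rank_def homology_rank_def by (metis subgroups add.commute inf.cobounded1)
qed

private lemma im_rank_alt: "im_rank p n \<longleftrightarrow> frag_rank (frag_plus (ZS p) (BX p)) (BX p) n"
  unfolding im_rank_def by (rule frag_rank_second_iso) (simp_all add: subgroups)

text \<open>Exactness at the homology of \<open>X\<close>: a cycle of \<open>X\<close> is a relative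
  boundary precisely when it is the sum of a cycle in \<open>S\<close> and a boundary, that is,
  \<open>ZX p \<inter> BR p = frag_plus (ZS p) (BX p)\<close>.\<close>

private lemma rel_im_rank_alt: "rel_im_rank p n \<longleftrightarrow> frag_rank (ZX p) (frag_plus (ZS p) (BX p)) n"
proof -
  have "ZX p \<inter> BR p = frag_plus (ZS p) (BX p)"
  proof
    show "ZX p \<inter> BR p \<subseteq> frag_plus (ZS p) (BX p)"
    proof
      fix z
      assume z: "z \<in> ZX p \<inter> BR p"
      then obtain b c where bc: "z = b + c" "b \<in> BX p" "c \<in> CS p"
        unfolding BR_eq frag_plus_def by blast
      have "b \<in> ZX p"
        using bc by (simp add: singular_relboundary_imp_relcycle)
      then have "z - b \<in> ZX p"
        using z frag_subgroup_diff[OF frag_subgroup_relcycles] by blast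
      then have "c \<in> ZS p"
        using bc by (simp add: ZS_eq)
      then show "z \<in> frag_plus (ZS p) (BX p)"
        using frag_plus_I[of c _ b] bc by (simp add: add.commute)
    qed
    show "frag_plus (ZS p) (BX p) \<subseteq> ZX p \<inter> BR p"
    proof
      fix z
      assume "z \<in> frag_plus (ZS p) (BX p)"
      then obtain c b where bc: "z = c + b" "b \<in> BX p" "c \<in> ZS p"
        unfolding frag_plus_def by blast
      then have "b \<in> ZX p" "c \<in> ZX p" "c \<in> CS p"
        using ZS_eq by (auto simp: singular_relboundary_imp_relcycle)
      then show "z \<in> ZX p \<inter> BR p"
        using frag_subgroup_add[OF frag_subgroup_relcycles, of c p X "{}" b] frag_plus_I[of b "BX p" c "CS p"] bc
        unfolding BR_eq by (simp add: add.commute)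
    qed
  qed
  moreover have "frag_plus (ZX p) (CS p) = frag_plus (ZX p) (BR p)"
  proof
    show "frag_plus (ZX p) (CS p) \<subseteq> frag_plus (ZX p) (BR p)"
      using singular_chain_imp_relboundary by (fastforce simp: frag_plus_def)
    show "frag_plus (ZX p) (BR p) \<subseteq> frag_plus (ZX p) (CS p)"
    proof
      fix z
      assume "z \<in> frag_plus (ZX p) (BR p)"
      then obtain x b c where xbc: "z = x + (b + c)" "x \<in> ZX p" "b \<in> BX p" "c \<in> CS p"
        unfolding frag_plus_def BR_eq by blast
      then have "x + b \<in> ZX p"
        by (simp add: singular_relboundary_imp_relcycle singular_relcycle_add)
      from frag_plus_I[OF this xbc(4)] show "z \<in> frag_plus (ZX p) (CS p)"
        using xbc(1) by (simp add: add.assoc)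
    qed
  qed
  ultimately show ?thesis
    unfolding rel_im_rank_def
    using frag_rank_second_iso[OF frag_subgroup_relcycles frag_subgroup_relboundaries, of p X "{}" p X S n] by simp
qed

private lemma plus_ZS_BX: "BX p \<subseteq> frag_plus (ZS p) (BX p)" "frag_plus (ZS p) (BX p) \<subseteq> ZX p"
proof -
  show "BX p \<subseteq> frag_plus (ZS p) (BX p)"
    by (rule frag_plus_right[OF frag_subgroup_relcycles])
  show "frag_plus (ZS p) (BX p) \<subseteq> ZX p"
    unfolding frag_plus_def ZS_eq using singular_relboundary_imp_relcycle singular_relcycle_add by blast
qed

private lemma total_rank:
  shows "im_rank p k \<Longrightarrow> rel_im_rank p l \<Longrightarrow> homology_rank p X {} (k + l)"
    and "homology_rank p X {} n \<Longrightarrow> \<exists>k l. im_rank p k \<and> rel_im_rank p l \<and> n = k + l"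
proof -
  show "homology_rank p X {} (k + l)" if "im_rank p k" "rel_im_rank p l"
    using frag_rank_tower_sum[of "ZX p" "frag_plus (ZS p) (BX p)" "BX p" l k] that plus_ZS_BX
    unfolding im_rank_alt rel_im_rank_alt homology_rank_def by (simp add: subgroups add.commute)
  show "\<exists>k l. im_rank p k \<and> rel_im_rank p l \<and> n = k + l" if "homology_rank p X {} n"
    using frag_rank_tower[of "ZX p" "frag_plus (ZS p) (BX p)" "BX p" n] that plus_ZS_BX
    unfolding im_rank_alt rel_im_rank_alt homology_rank_def by (metis subgroups add.commute)
qed

text \<open>The connecting homomorphism is induced by the boundary map. Its kernel consists of the
  relative cycles that are cycles up to chains in \<open>S\<close>, and it maps onto the cycles in
  \<open>S\<close> that bound in \<open>X\<close>.\<close>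

private lemma connecting_rank:
  "frag_rank (ZR (Suc p)) (frag_plus (ZX (Suc p)) (CS (Suc p))) n \<longleftrightarrow> ker_rank p n"
  unfolding ker_rank_def
proof (rule frag_rank_iso[where f = "chain_boundary (Suc p)"])
  have ZRD: "singular_chain (Suc p) X z" "singular_chain p (subtopology X S) (chain_boundary (Suc p) z)"
    if "z \<in> ZR (Suc p)" for z
    using that by (auto simp: singular_relcycle)
  show "chain_boundary (Suc p) z \<in> ZS p \<inter> BX p" if z: "z \<in> ZR (Suc p)" for z
    using ZRD[OF z] chain_boundary_boundary_alt[OF ZRD(1)[OF z]] by (auto simp: singular_cycle singular_boundary)
  show "chain_boundary (Suc p) z \<in> BS p \<longleftrightarrow> z \<in> frag_plus (ZX (Suc p)) (CS (Suc p))" if z: "z \<in> ZR (Suc p)" for z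
  proof
    assume "chain_boundary (Suc p) z \<in> BS p"
    then obtain d where d: "singular_chain (Suc p) (subtopology X S) d" "chain_boundary (Suc p) d = chain_boundary (Suc p) z"
      by (auto simp: singular_boundary)
    then have "z - d \<in> ZX (Suc p)"
      using ZRD(1)[OF z] sub_chain by (simp add: singular_cycle singular_chain_diff chain_boundary_diff)
    from frag_plus_I[OF this, of d "CS (Suc p)"] d show "z \<in> frag_plus (ZX (Suc p)) (CS (Suc p))"
      by simp
  next
    assume "z \<in> frag_plus (ZX (Suc p)) (CS (Suc p))"
    then obtain x c where "z = x + c" "x \<in> ZX (Suc p)" "c \<in> CS (Suc p)"
      by (auto simp: frag_plus_def)
    then show "chain_boundary (Suc p) z \<in> BS p"
      by (auto simp: singular_cycle chain_boundary_add singular_boundary)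
  qed
  fix z'
  assume z': "z' \<in> ZS p \<inter> BX p"
  then obtain d where d: "singular_chain (Suc p) X d" "chain_boundary (Suc p) d = z'"
    by (auto simp: singular_boundary)
  then have "d \<in> ZR (Suc p)"
    using z' by (simp add: singular_relcycle singular_cycle)
  then show "\<exists>z\<in>ZR (Suc p). z' - chain_boundary (Suc p) z \<in> BS p"
    using d by (intro bexI[of _ d]) auto
qed (simp_all add: subgroups chain_boundary_diff)

private lemma BR_ZX: "BR p \<subseteq> frag_plus (ZX p) (CS p)"
  unfolding BR_eq frag_plus_def using singular_relboundary_imp_relcycle by blast

private lemma rel_rank_Suc:
  shows "rel_im_rank (Suc p) k \<Longrightarrow> ker_rank p l \<Longrightarrow> homology_rank (Suc p) X S (k + l)"
    and "homology_rank (Suc p) X S n \<Longrightarrow> \<exists>k l. rel_im_rank (Suc p) k \<and> ker_rank p l \<and> n = k + l"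
proof -
  show "homology_rank (Suc p) X S (k + l)" if "rel_im_rank (Suc p) k" "ker_rank p l"
    using frag_rank_tower_sum[of "ZR (Suc p)" "frag_plus (ZX (Suc p)) (CS (Suc p))" "BR (Suc p)" l k] that ZR_eq_rel BR_ZX
    unfolding rel_im_rank_def homology_rank_def by (simp add: subgroups connecting_rank add.commute)
  show "\<exists>k l. rel_im_rank (Suc p) k \<and> ker_rank p l \<and> n = k + l" if "homology_rank (Suc p) X S n"
    using frag_rank_tower[of "ZR (Suc p)" "frag_plus (ZX (Suc p)) (CS (Suc p))" "BR (Suc p)" n] that ZR_eq_rel BR_ZX
    unfolding rel_im_rank_def homology_rank_def connecting_rank by (metis subgroups add.commute)
qed

text \<open>In degree 0 the boundary is zero, so every relative cycle is already a cycle and the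
  absolute homology maps onto the relative one.\<close>

private lemma rel_rank_0: "homology_rank 0 X S n \<longleftrightarrow> rel_im_rank 0 n"
proof -
  have "ZR 0 \<subseteq> frag_plus (ZX 0) (CS 0)"
  proof
    fix z
    assume "z \<in> ZR 0"
    then have "z \<in> ZX 0"
      by (simp add: singular_relcycle singular_cycle chain_boundary_def)
    then show "z \<in> frag_plus (ZX 0) (CS 0)"
      using frag_plus_left[OF frag_subgroup_chains] by blast
  qed
  then show ?thesis
    using ZR_eq_rel[of 0] unfolding homology_rank_def rel_im_rank_def by (metis subset_antisym)
qed

text \<open>Each group in the long exact sequence is assembled from two of these three families: the
  kernels \<open>\<alpha>\<close>, the images \<open>\<beta>\<close> and the relative images
  \<open>\<gamma>\<close>.\<close>

definition pair_ranks :: "(nat \<Rightarrow> nat) \<Rightarrow> (nat \<Rightarrow> nat) \<Rightarrow> (nat \<Rightarrow> nat) \<Rightarrow> bool" where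
  "pair_ranks \<alpha> \<beta> \<gamma> \<longleftrightarrow> (\<forall>p. ker_rank p (\<alpha> p) \<and> im_rank p (\<beta> p) \<and> rel_im_rank p (\<gamma> p))"

lemma pair_ranksD:
  assumes "pair_ranks \<alpha> \<beta> \<gamma>"
  shows "homology_rank p (subtopology X S) {} (\<alpha> p + \<beta> p)" "homology_rank p X {} (\<beta> p + \<gamma> p)"
    "homology_rank p X S (\<gamma> p + (if p = 0 then 0 else \<alpha> (p - 1)))"
proof -
  show "homology_rank p (subtopology X S) {} (\<alpha> p + \<beta> p)" "homology_rank p X {} (\<beta> p + \<gamma> p)"
    using assms sub_rank(1) total_rank(1) unfolding pair_ranks_def by blast+
  show "homology_rank p X S (\<gamma> p + (if p = 0 then 0 else \<alpha> (p - 1)))"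
    using assms rel_rank_0 rel_rank_Suc(1) unfolding pair_ranks_def by (cases p) auto
qed

text \<open>Finite ranks for the subspace and for one of the other two terms suffice, because
  subgroups and quotients inherit finite rank.\<close>

lemma pair_ranks_exist:
  assumes "\<And>p. homology_rank p (subtopology X S) {} (s p)"
    and "(\<forall>p. \<exists>t. homology_rank p X {} t) \<or> (\<forall>p. \<exists>t. homology_rank p X S t)"
  obtains \<alpha> \<beta> \<gamma> where "pair_ranks \<alpha> \<beta> \<gamma>"
proof -
  have "\<forall>p. \<exists>k l. ker_rank p k \<and> im_rank p l"
    using assms(1) sub_rank(2) by metis
  moreover have "\<forall>p. \<exists>k. rel_im_rank p k"
    using assms(2) total_rank(2) rel_rank_0 rel_rank_Suc(2) by (metis not0_implies_Suc)
  ultimately have "\<forall>p. \<exists>k l m. ker_rank p k \<and> im_rank p l \<and> rel_im_rank p m"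
    by metis
  then show ?thesis
    using that unfolding pair_ranks_def by metis
qed

end

section \<open>Euler characteristics of pairs, excision and additivity\<close>

lemma homology_rank_unique:
  "homology_rank p X S m \<Longrightarrow> homology_rank p X S n \<Longrightarrow> m = n"
  unfolding homology_rank_def using frag_rank_unique frag_subgroup_relboundaries by blast

definition has_rel_euler :: "'a topology \<Rightarrow> 'a set \<Rightarrow> int \<Rightarrow> bool" where
  "has_rel_euler X S e \<longleftrightarrow> (\<exists>h N. (\<forall>p. homology_rank p X S (h p)) \<and> (\<forall>p\<ge>N. h p = 0) \<and>
      e = (\<Sum>p<N. (- 1) ^ p * int (h p)))"

lemma has_euler_eq_rel: "has_euler X e \<longleftrightarrow> has_rel_euler X {} e"
  by (simp add: has_euler_def has_rel_euler_def)

lemma alternating_sum_cutoff: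
  fixes h :: "nat \<Rightarrow> nat"
  assumes "\<forall>p\<ge>N. h p = 0" "N \<le> M"
  shows "(\<Sum>p<M. (- 1) ^ p * int (h p)) = (\<Sum>p<N. (- 1) ^ p * int (h p))"
proof (rule sum.mono_neutral_right)
  show "\<forall>i\<in>{..<M} - {..<N}. (- 1) ^ i * int (h i) = 0"
    using assms(1) by simp
qed (use assms(2) in auto)

lemma has_rel_eulerI:
  assumes "\<And>p. homology_rank p X S (h p)" "\<And>p. p \<ge> N \<Longrightarrow> h p = 0" "e = (\<Sum>p<N. (- 1) ^ p * int (h p))"
  shows "has_rel_euler X S e"
  using assms unfolding has_rel_euler_def by blast

text \<open>The connecting homomorphism lowers the degree by one, which makes the contribution of
  \<open>\<alpha>\<close> negative. The shifted sum leaves out the degree \<open>N\<close>, whose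
  term is zero.\<close>

lemma alternating_shift:
  fixes \<alpha> \<gamma> :: "nat \<Rightarrow> nat"
  assumes "\<alpha> N = 0"
  shows "(\<Sum>p<Suc N. (- 1) ^ p * int (\<gamma> p + (if p = 0 then 0 else \<alpha> (p - 1)))) =
    (\<Sum>p<Suc N. (- 1) ^ p * int (\<gamma> p)) - (\<Sum>p<Suc N. (- 1) ^ p * int (\<alpha> p))"
proof -
  have "(\<Sum>p<Suc N. (- 1) ^ p * int (if p = 0 then 0 else \<alpha> (p - 1))) = (\<Sum>p<N. (- 1) ^ Suc p * int (\<alpha> p))"
    unfolding sum.lessThan_Suc_shift by simp
  also have "\<dots> = - (\<Sum>p<N. (- 1) ^ p * int (\<alpha> p))"
    by (simp add: sum_negf)
  finally show ?thesis
    using assms by (simp add: sum.distrib algebra_simps del: sum.lessThan_Suc) simp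
qed

lemma pair_ranks_euler:
  assumes r: "pair_ranks X S \<alpha> \<beta> \<gamma>" and N: "\<And>p. p \<ge> N \<Longrightarrow> \<alpha> p = 0 \<and> \<beta> p = 0 \<and> \<gamma> p = 0"
  shows "\<exists>x y. has_euler (subtopology X S) x \<and> has_rel_euler X S y \<and> has_euler X (x + y)"
proof -
  \<comment> \<open>In terms of these sums the Euler characteristics are \<open>A + B\<close> for
    the subspace, \<open>B + C\<close> for the space and \<open>C - A\<close> for the pair.\<close>
  define A B C where "A = (\<Sum>p<Suc N. (- 1) ^ p * int (\<alpha> p))" "B = (\<Sum>p<Suc N. (- 1) ^ p * int (\<beta> p))"
    "C = (\<Sum>p<Suc N. (- 1) ^ p * int (\<gamma> p))"
  note D = pair_ranksD[OF r]
  have "has_euler (subtopology X S) (A + B)" unfolding has_euler_eq_rel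
    by (rule has_rel_eulerI[OF D(1), of "Suc N"]) (use N in \<open>simp_all add: A_B_C_def sum.distrib algebra_simps del: sum.lessThan_Suc\<close>)
  moreover have "has_euler X (B + C)" unfolding has_euler_eq_rel
    by (rule has_rel_eulerI[OF D(2), of "Suc N"]) (use N in \<open>simp_all add: A_B_C_def sum.distrib algebra_simps del: sum.lessThan_Suc\<close>)
  moreover have "has_rel_euler X S (C - A)"
    by (rule has_rel_eulerI[OF D(3), of "Suc N"])
       (use N alternating_shift[of \<alpha> N \<gamma>] in \<open>simp_all add: A_B_C_def del: sum.lessThan_Suc of_nat_add\<close>)
  moreover have "B + C = (A + B) + (C - A)"
    by simp
  ultimately show ?thesis
    by metis
qed

lemma has_rel_euler_unique:
  assumes "has_rel_euler X S x" "has_rel_euler X S y"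
  shows "x = y"
proof -
  obtain h N where h: "\<forall>p. homology_rank p X S (h p)" "\<forall>p\<ge>N. h p = 0" "x = (\<Sum>p<N. (- 1) ^ p * int (h p))"
    using assms(1) unfolding has_rel_euler_def by blast
  obtain g M where g: "\<forall>p. homology_rank p X S (g p)" "\<forall>p\<ge>M. g p = 0" "y = (\<Sum>p<M. (- 1) ^ p * int (g p))"
    using assms(2) unfolding has_rel_euler_def by blast
  have "h = g"
    using h(1) g(1) homology_rank_unique by blast
  then show ?thesis
    using h g alternating_sum_cutoff[of N h "max N M"] alternating_sum_cutoff[of M g "max N M"] by simp
qed

lemma has_rel_euler_of_sub_total:
  assumes "has_euler (subtopology X S) x" "has_euler X y"
  shows "has_rel_euler X S (y - x)"
proof -
  obtain h N where h: "\<forall>p. homology_rank p (subtopology X S) {} (h p)" "\<forall>p\<ge>N. h p = 0"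
    using assms(1) unfolding has_euler_def by blast
  obtain g M where g: "\<forall>p. homology_rank p X {} (g p)" "\<forall>p\<ge>M. g p = 0"
    using assms(2) unfolding has_euler_def by blast
  obtain \<alpha> \<beta> \<gamma> where r: "pair_ranks X S \<alpha> \<beta> \<gamma>"
    using pair_ranks_exist[of X S h] h(1) g(1) by metis
  have "h p = \<alpha> p + \<beta> p" "g p = \<beta> p + \<gamma> p" for p
    using pair_ranksD[OF r] h(1) g(1) homology_rank_unique by blast+
  then obtain x' y' where "has_euler (subtopology X S) x'" "has_rel_euler X S y'" "has_euler X (x' + y')"
    using pair_ranks_euler[OF r, of "max N M"] h(2) g(2) by fastforce
  moreover from this have "x' = x" "x' + y' = y"
    using assms has_rel_euler_unique unfolding has_euler_eq_rel by blast+
  ultimately show ?thesis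
    by auto
qed

lemma has_euler_of_sub_rel:
  assumes "has_euler (subtopology X S) x" "has_rel_euler X S y"
  shows "has_euler X (x + y)"
proof -
  obtain h N where h: "\<forall>p. homology_rank p (subtopology X S) {} (h p)" "\<forall>p\<ge>N. h p = 0"
    using assms(1) unfolding has_euler_def by blast
  obtain g M where g: "\<forall>p. homology_rank p X S (g p)" "\<forall>p\<ge>M. g p = 0"
    using assms(2) unfolding has_rel_euler_def by blast
  obtain \<alpha> \<beta> \<gamma> where r: "pair_ranks X S \<alpha> \<beta> \<gamma>"
    using pair_ranks_exist[of X S h] h(1) g(1) by metis
  have "h p = \<alpha> p + \<beta> p" "g p = \<gamma> p + (if p = 0 then 0 else \<alpha> (p - 1))" for p
    using pair_ranksD[OF r] h(1) g(1) homology_rank_unique by blast+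
  then obtain x' y' where "has_euler (subtopology X S) x'" "has_rel_euler X S y'" "has_euler X (x' + y')"
    using pair_ranks_euler[OF r, of "max N M"] h(2) g(2) by fastforce
  moreover from this have "x' = x" "y' = y"
    using assms has_rel_euler_unique unfolding has_euler_eq_rel by blast+
  ultimately show ?thesis
    by auto
qed

text \<open>A chain of the smaller pair is the same formal sum in the larger one, so the excision
  isomorphism is induced by the identity on chains and can be fed into
  \<open>frag_rank_iso\<close>.\<close>

lemma excision_rank:
  assumes X: "(X closure_of U) \<subseteq> (X interior_of T)" and TS: "T \<subseteq> S"
  shows "homology_rank p (subtopology X (S - U)) (T - U) n \<longleftrightarrow> homology_rank p (subtopology X S) T n"
  unfolding homology_rank_def
proof (rule frag_rank_iso[where f = "\<lambda>x. x"])
  let ?Y = "subtopology X (S - U)" and ?X = "subtopology X S"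
  have cont: "continuous_map ?Y ?X id"
    by (simp add: continuous_map_in_subtopology continuous_map_from_subtopology_mono Diff_subset)
  have id: "chain_map p id z = z" if "singular_relcycle p ?Y (T - U) z" for z
    using that chain_map_ident unfolding singular_relcycle_def by blast
  have idb: "chain_map p id z = z" if "singular_relboundary p ?Y (T - U) z" for z
    using that id singular_relboundary_imp_relcycle by blast
  show Z: "z \<in> singular_relcycle_set p ?X T" if "z \<in> singular_relcycle_set p ?Y (T - U)" for z
    using singular_relcycle_chain_map[of p ?Y "T - U" z ?X id T] cont id that by auto
  have iso: "hom_induced p ?Y (T - U) ?X T id \<in>
      iso (relative_homology_group p ?Y (T - U)) (relative_homology_group p ?X T)"
    by (rule homology_excision_axiom[OF X TS])
  show "z \<in> singular_relboundary_set p ?X T \<longleftrightarrow> z \<in> singular_relboundary_set p ?Y (T - U)"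
    if z: "z \<in> singular_relcycle_set p ?Y (T - U)" for z
  proof
    assume "z \<in> singular_relboundary_set p ?Y (T - U)"
    then show "z \<in> singular_relboundary_set p ?X T"
      using singular_relboundary_chain_map[of p ?Y "T - U" z ?X id T] cont idb by auto
  next
    assume b: "z \<in> singular_relboundary_set p ?X T"
    let ?h = "hom_induced p ?Y (T - U) ?X T id"
    let ?c = "\<lambda>x. homologous_rel_set p ?Y (T - U) x"
    have h: "?h (?c x) = homologous_rel_set p ?X T (chain_map p id x)" if "singular_relcycle p ?Y (T - U) x" for x
      using hom_induced_chain_map[of ?Y ?X id "T - U" T p x] cont that by auto
    have "?h (?c z) = homologous_rel_set p ?X T z"
      using h[of z] z id by simp
    also have "\<dots> = homologous_rel_set p ?X T 0"
      unfolding homologous_rel_set_eq using b by (simp add: homologous_rel_def)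
    also have "\<dots> = ?h (?c 0)"
      using h[of 0] by simp
    finally have "?h (?c z) = ?h (?c 0)" .
    moreover have "?c z \<in> carrier (relative_homology_group p ?Y (T - U))" "?c 0 \<in> carrier (relative_homology_group p ?Y (T - U))"
      using z by (auto simp: carrier_relative_homology_group)
    moreover have "inj_on ?h (carrier (relative_homology_group p ?Y (T - U)))"
      using iso by (simp add: iso_def bij_betw_def)
    ultimately have "?c z = ?c 0"
      by (simp only: inj_on_eq_iff)
    then show "z \<in> singular_relboundary_set p ?Y (T - U)"
      unfolding homologous_rel_set_eq by (simp add: homologous_rel_def)
  qed
  fix z'
  assume "z' \<in> singular_relcycle_set p ?X T"
  then obtain c' where "singular_relcycle p ?Y (T - U) c'" "homologous_rel p ?X T z' c'"
    using excised_relcycle_exists[OF X TS] by blast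
  then show "\<exists>z\<in>singular_relcycle_set p ?Y (T - U). z' - z \<in> singular_relboundary_set p ?X T"
    by (auto simp: homologous_rel_def)
qed (simp_all add: frag_subgroup_relcycles frag_subgroup_relboundaries)

text \<open>Excising \<open>U - V\<close> reduces the pair of \<open>U \<union> V\<close> and
  \<open>U\<close> to the pair of \<open>V\<close> and \<open>U \<inter> V\<close>, whose Euler
  characteristic is \<open>b - c\<close>. Here \<open>U - V\<close> is closed in the union, being
  the complement of \<open>V\<close>.\<close>

proposition has_euler_Un:
  assumes op: "openin X U" "openin X V"
    and e: "has_euler (subtopology X U) a" "has_euler (subtopology X V) b" "has_euler (subtopology X (U \<inter> V)) c"
  shows "has_euler (subtopology X (U \<union> V)) (a + b - c)"
proof -
  define Y where "Y = subtopology X (U \<union> V)"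
  have top: "topspace Y = U \<union> V"
    using op openin_subset by (fastforce simp: Y_def)
  have opY: "openin Y U" "openin Y V"
    using op by (auto simp: Y_def openin_subtopology intro: exI[of _ U] exI[of _ V])
  have sub: "subtopology Y U = subtopology X U" "subtopology Y V = subtopology X V"
    "subtopology (subtopology Y V) (U \<inter> V) = subtopology X (U \<inter> V)"
    by (auto simp: Y_def subtopology_subtopology intro!: arg_cong[of _ _ "subtopology X"])
  have "has_rel_euler (subtopology Y V) (U \<inter> V) (b - c)"
    by (rule has_rel_euler_of_sub_total) (use e sub in auto)
  moreover have "homology_rank p (subtopology Y ((U \<union> V) - (U - V))) (U - (U - V)) n \<longleftrightarrow> homology_rank p (subtopology Y (U \<union> V)) U n"
    for p n
  proof (rule excision_rank)
    have "U - V = topspace Y - V"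
      using top by auto
    then have "closedin Y (U - V)"
      using opY by auto
    then show "(Y closure_of (U - V)) \<subseteq> (Y interior_of U)"
      using opY by (simp add: closure_of_closedin interior_of_openin)
  qed auto
  moreover have "(U \<union> V) - (U - V) = V" "U - (U - V) = U \<inter> V"
    by auto
  moreover have "subtopology Y (U \<union> V) = Y"
    using top by (metis subtopology_topspace)
  ultimately have "has_rel_euler Y U (b - c)"
    by (simp add: has_rel_euler_def)
  then have "has_euler Y (a + (b - c))"
    using e sub by (intro has_euler_of_sub_rel) auto
  then show ?thesis
    by (simp add: Y_def add_diff_eq)
qed

section \<open>Spaces with known Euler characteristic\<close>

lemma frag_rank_0I: "Z \<subseteq> B \<Longrightarrow> frag_rank Z B 0"
  unfolding frag_rank_def by (intro exI[of _ "{}"]) (auto simp: frag_indep_def intro!: exI[of _ 1])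

lemma has_euler_empty:
  assumes "topspace X = {}"
  shows "has_euler X 0"
proof -
  have "homology_rank p X {} 0" for p
    unfolding homology_rank_def using singular_chain_empty[OF assms]
    by (intro frag_rank_0I) (auto simp: singular_relcycle)
  then show ?thesis
    unfolding has_euler_def by (intro exI[of _ "\<lambda>_. 0"] exI[of _ 0]) auto
qed

lemma homology_rank_homeomorphic:
  assumes "homeomorphic_maps X Y f g" "homology_rank p X {} n"
  shows "homology_rank p Y {} n"
proof -
  have cont: "continuous_map X Y f" "continuous_map Y X g"
    and gf: "\<And>x. x \<in> topspace X \<Longrightarrow> (g \<circ> f) x = x" and fg: "\<And>y. y \<in> topspace Y \<Longrightarrow> (f \<circ> g) y = y"
    using assms by (auto simp: homeomorphic_maps_def)
  have gf_chain: "chain_map p g (chain_map p f c) = c" if "singular_chain p X c" for c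
  proof -
    have "chain_map p (g \<circ> f) c = c"
      by (rule chain_map_id_gen[OF that gf])
    then show ?thesis
      unfolding chain_map_compose by simp
  qed
  have fg_chain: "chain_map p f (chain_map p g c) = c" if "singular_chain p Y c" for c
  proof -
    have "chain_map p (f \<circ> g) c = c"
      by (rule chain_map_id_gen[OF that fg])
    then show ?thesis
      unfolding chain_map_compose by simp
  qed
  have Zf: "singular_relcycle p Y {} (chain_map p f c)" if "singular_relcycle p X {} c" for c
    using singular_relcycle_chain_map[OF that cont(1)] by simp
  have Zg: "singular_relcycle p X {} (chain_map p g c)" if "singular_relcycle p Y {} c" for c
    using singular_relcycle_chain_map[OF that cont(2)] by simp
  have Bf: "singular_relboundary p Y {} (chain_map p f c)" if "singular_relboundary p X {} c" for c
    using singular_relboundary_chain_map[OF that cont(1)] by simp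
  have Bg: "singular_relboundary p X {} (chain_map p g c)" if "singular_relboundary p Y {} c" for c
    using singular_relboundary_chain_map[OF that cont(2)] by simp
  have "frag_rank (singular_relcycle_set p X {}) (singular_relboundary_set p X {}) n \<longleftrightarrow>
      frag_rank (singular_relcycle_set p Y {}) (singular_relboundary_set p Y {}) n"
  proof (rule frag_rank_iso[where f = "chain_map p f"])
    show "chain_map p f z \<in> singular_relboundary_set p Y {} \<longleftrightarrow> z \<in> singular_relboundary_set p X {}"
      if "z \<in> singular_relcycle_set p X {}" for z
    proof
      assume "chain_map p f z \<in> singular_relboundary_set p Y {}"
      then have "singular_relboundary p X {} (chain_map p g (chain_map p f z))"
        using Bg by simp
      moreover have "singular_chain p X z"
        using that by (simp add: singular_cycle)
      ultimately show "z \<in> singular_relboundary_set p X {}"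
        by (simp add: gf_chain)
    qed (use Bf in auto)
    show "\<exists>z\<in>singular_relcycle_set p X {}. z' - chain_map p f z \<in> singular_relboundary_set p Y {}"
      if "z' \<in> singular_relcycle_set p Y {}" for z'
    proof (rule bexI)
      have "singular_chain p Y z'"
        using that by (simp add: singular_cycle)
      then show "z' - chain_map p f (chain_map p g z') \<in> singular_relboundary_set p Y {}"
        by (simp add: fg_chain)
    qed (use that Zg in auto)
  qed (use Zf in \<open>auto simp: frag_subgroup_relcycles frag_subgroup_relboundaries chain_map_diff\<close>)
  then show ?thesis
    using assms(2) by (simp add: homology_rank_def)
qed

lemma has_euler_homeomorphic:
  assumes "X homeomorphic_space Y" "has_euler X e"
  shows "has_euler Y e"
  using assms homology_rank_homeomorphic unfolding has_euler_def homeomorphic_space_def by metis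

text \<open>The identity is homotopic to a constant map, so every cycle is homologous to its image
  in the one-point space \<open>P\<close>. The class of a point has infinite order, since a multiple
  of it that bounds is sent to a boundary of degree 0 in \<open>P\<close>, and this is zero.\<close>

proposition has_euler_contractible:
  assumes X: "contractible_space X" "topspace X \<noteq> {}"
  shows "has_euler X 1"
proof -
  obtain a where hom: "homotopic_with (\<lambda>x. True) X X id (\<lambda>x. a)"
    using X by (auto simp: contractible_space_def)
  have a: "a \<in> topspace X"
    using homotopic_with_imp_continuous_maps[OF hom] X(2) by (auto simp: continuous_map_def)
  define P where "P = subtopology X {a}"
  have P: "topspace P = {a}"
    using a by (auto simp: P_def)
  have cont: "continuous_map X P (\<lambda>x. a)"
    using a by (auto simp: P_def continuous_map_in_subtopology)
  have hom': "homotopic_with (\<lambda>h. h \<in> {} \<rightarrow> {}) X X id (\<lambda>x. a)"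
    using hom by simp
  have homologous: "singular_relboundary p X {} (c - chain_map p (\<lambda>x. a) c)" if "singular_relcycle p X {} c" for p c
    using homotopic_imp_homologous_rel_chain_maps[OF hom' that] chain_map_ident[of p X c] that
    by (simp add: homologous_rel_def singular_cycle)
  have bd: "singular_relboundary p X {} c" if "singular_relboundary p P {} c" for p c
    using singular_boundary_mono[of "{a}" UNIV p X c] that by (simp add: P_def)
  \<comment> \<open>The constant 0-simplex. Singular simplices are undefined outside the standard
    simplex, whence \<open>restrict\<close>.\<close>
  define \<sigma> where "\<sigma> = restrict (\<lambda>x. a) (standard_simplex 0)"
  have "homology_rank 0 X {} 1"
    unfolding homology_rank_def frag_rank_def
  proof (intro exI[of _ "{frag_of \<sigma>}"] conjI ballI)
    have "singular_simplex 0 P \<sigma>"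
      using singular_simplex_singleton[OF P] by (simp add: \<sigma>_def)
    then have sX: "singular_simplex 0 X \<sigma>"
      by (simp add: P_def singular_simplex_subtopology)
    then show "{frag_of \<sigma>} \<subseteq> singular_relcycle_set 0 X {}"
      by (simp add: singular_cycle singular_chain_of chain_boundary_def)
    have \<sigma>: "simplex_map 0 (\<lambda>x. a) \<sigma> = \<sigma>"
      by (auto simp: simplex_map_def \<sigma>_def restrict_def)
    show "frag_indep (singular_relboundary_set 0 X {}) {frag_of \<sigma>}"
      unfolding frag_indep_def
    proof (intro conjI allI impI)
      fix u :: "_ \<Rightarrow> int"
      assume "(\<Sum>s\<in>{frag_of \<sigma>}. frag_cmul (u s) s) \<in> singular_relboundary_set 0 X {}"
      then have "singular_relboundary 0 X {} (frag_cmul (u (frag_of \<sigma>)) (frag_of \<sigma>))"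
        by simp
      from singular_relboundary_chain_map[OF this cont, of "{}"]
      have "frag_cmul (u (frag_of \<sigma>)) (frag_of \<sigma>) = 0"
        using singular_boundary_singleton[OF P, of 0] by (simp add: \<sigma>)
      then show "\<forall>s\<in>{frag_of \<sigma>}. u s = 0"
        by simp
    qed simp
    fix z
    assume z: "z \<in> singular_relcycle_set 0 X {}"
    then have "singular_chain 0 P (chain_map 0 (\<lambda>x. a) z)"
      using cont by (auto simp: singular_cycle intro: singular_chain_chain_map)
    then obtain b where "chain_map 0 (\<lambda>x. a) z = frag_cmul b (frag_of \<sigma>)"
      using singular_chain_singleton[OF P] by (auto simp: \<sigma>_def)
    then show "\<exists>N u. N \<noteq> 0 \<and> frag_cmul N z - (\<Sum>s\<in>{frag_of \<sigma>}. frag_cmul (u s) s) \<in> singular_relboundary_set 0 X {}"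
      using homologous[of 0 z] z by (intro exI[of _ 1] exI[of _ "\<lambda>_. b"]) simp
  qed simp
  moreover have "homology_rank p X {} 0" if p: "p \<ge> 1" for p
    unfolding homology_rank_def
  proof (intro frag_rank_0I subsetI)
    fix c
    assume c: "c \<in> singular_relcycle_set p X {}"
    then have "singular_relcycle p P {} (chain_map p (\<lambda>x. a) c)"
      using singular_relcycle_chain_map[of p X "{}" c P "\<lambda>x. a" "{}"] cont by simp
    then have "singular_relboundary p X {} (chain_map p (\<lambda>x. a) c)"
      using bd singular_boundary_eq_cycle_singleton[OF P p] by blast
    then show "c \<in> singular_relboundary_set p X {}"
      using homologous[of p c] c singular_relboundary_add[of p X "{}" "c - chain_map p (\<lambda>x. a) c" "chain_map p (\<lambda>x. a) c"]
      by simp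
  qed
  ultimately have "homology_rank p X {} (if p = 0 then 1 else 0)" for p
    by auto
  then show ?thesis
    unfolding has_euler_def by (intro exI[of _ "\<lambda>p. if p = 0 then 1 else 0"] exI[of _ 1]) auto
qed

section \<open>Products of star-shaped sets and punctured planes\<close>

definition star_about :: "complex set \<Rightarrow> complex \<Rightarrow> bool" where
  "star_about A c \<longleftrightarrow> c \<in> A \<and> (\<forall>z\<in>A. \<forall>t\<in>{0..1}. of_real (1 - t) * z + of_real t * c \<in> A)"

definition coord_box :: "('i \<Rightarrow> complex set) \<Rightarrow> ('i \<Rightarrow> complex) set" where
  "coord_box A = {x. \<forall>i. x i \<in> A i}"

text \<open>All coordinates are contracted simultaneously along segments towards \<open>c\<close>.
  Continuity is checked coordinatewise, so an infinite index type causes no difficulty.\<close>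

lemma has_euler_star_box:
  assumes star: "\<And>i. star_about (A i) (c i)"
  shows "has_euler (top_of_set (coord_box A)) 1"
proof (rule has_euler_contractible)
  let ?h = "\<lambda>(t, x) i. of_real (1 - t) * x i + of_real t * c i"
  have "continuous_on ({0..1} \<times> coord_box A) (\<lambda>tx. ?h tx i)" for i
  proof -
    have "continuous_on ({0..1} \<times> coord_box A) (\<lambda>tx. snd tx i)"
      by (rule continuous_on_product_then_coordinatewise) (intro continuous_intros)
    then show ?thesis
      by (simp add: case_prod_unfold) (intro continuous_intros)
  qed
  then have "continuous_on ({0..1} \<times> coord_box A) ?h"
    by (intro continuous_on_coordinatewise_then_product)
  moreover have "?h ` ({0..1} \<times> coord_box A) \<subseteq> coord_box A"
    using star by (auto simp: coord_box_def star_about_def)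
  ultimately have "continuous_map (prod_topology (top_of_set {0..1}) (top_of_set (coord_box A))) (top_of_set (coord_box A)) ?h"
    by (simp add: continuous_map_in_subtopology image_subset_iff_funcset)
  then have "homotopic_with (\<lambda>x. True) (top_of_set (coord_box A)) (top_of_set (coord_box A)) id (\<lambda>x. c)"
    unfolding homotopic_with_def by (intro exI[of _ ?h]) auto
  then show "contractible_space (top_of_set (coord_box A))"
    unfolding contractible_space_def by (intro exI[of _ c])
  have "c \<in> coord_box A"
    using star by (auto simp: coord_box_def star_about_def)
  then show "topspace (top_of_set (coord_box A)) \<noteq> {}"
    by auto
qed

lemma star_about_slit:
  "star_about (- {z. Im z = 0 \<and> Re z \<le> 0}) 1" "star_about (- {z. Im z = 0 \<and> Re z \<ge> 0}) (- 1)"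
  "star_about {z. Im z > 0} \<i>" "star_about {z. Im z < 0} (- \<i>)"
proof -
  have pos: "(1 - t) * x + t > 0" if "x > 0" "0 \<le> t" "t \<le> 1" for t x :: real
    using that by (cases "t = 1") (auto intro: add_pos_nonneg)
  have "Re z > 0" if "z \<in> - {z. Im z = 0 \<and> Re z \<le> 0}" "Im z = 0" for z
    using that by auto
  then show "star_about (- {z. Im z = 0 \<and> Re z \<le> 0}) 1"
    using pos unfolding star_about_def by (force simp: not_le)
  have neg: "(1 - t) * x - t < 0" if "x < 0" "0 \<le> t" "t \<le> 1" for t x :: real
    using pos[of "- x" t] that by simp
  then show "star_about (- {z. Im z = 0 \<and> Re z \<ge> 0}) (- 1)"
    unfolding star_about_def by (force simp: not_le)
  show "star_about {z. Im z > 0} \<i>" "star_about {z. Im z < 0} (- \<i>)"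
    using pos neg by (auto simp: star_about_def)
qed

text \<open>Covering each factor \<open>\<complex> - {0}\<close> by two slit planes, whose intersection is a pair of half planes,
  makes its contribution \<open>1 + 1 - (1 + 1) = 0\<close>.\<close>
lemma has_euler_coord_box:
  assumes "finite F" and "\<And>i. i \<notin> F \<Longrightarrow> star_about (A i) (c i)" and "\<And>i. i \<in> F \<Longrightarrow> A i = - {0}"
  shows "has_euler (top_of_set (coord_box A)) (if F = {} then 1 else 0)"
  using assms
proof (induction F arbitrary: A c rule: finite_induct)
  case empty
  then show ?case
    using has_euler_star_box[of A c] by simp
next
  case (insert j F)
  define e :: int where "e = (if F = {} then 1 else 0)"
  \<comment> \<open>Replacing the coordinate set at \<open>j\<close> by a star-shaped one leaves a
    box with one punctured plane less.\<close>
  have IH: "has_euler (top_of_set (coord_box (A(j := B)))) e" if "star_about B b" for B b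
    unfolding e_def
    by (rule insert.IH[of _ "c(j := b)"]) (use insert.prems insert.hyps that in auto)
  let ?X = "top_of_set (coord_box A)"
  let ?Y = "\<lambda>B. coord_box (A(j := B))"
  have memY: "x \<in> ?Y B \<longleftrightarrow> x j \<in> B \<and> (\<forall>i. i \<noteq> j \<longrightarrow> x i \<in> A i)" for x B
    by (auto simp: coord_box_def split: if_split_asm)
  have "A(j := - {0}) = A"
    using insert.prems(2)[of j] by (simp add: fun_upd_idem)
  then have memA: "x \<in> coord_box A \<longleftrightarrow> x j \<noteq> 0 \<and> (\<forall>i. i \<noteq> j \<longrightarrow> x i \<in> A i)" for x
    using memY[of x "- {0}"] by simp
  have op: "openin ?X (?Y B)" if "open B" "0 \<notin> B" for B
  proof -
    have "continuous_on UNIV (\<lambda>x::_ \<Rightarrow> complex. x j)"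
      by (rule continuous_on_product_coordinates)
    then have "open ((\<lambda>x::_ \<Rightarrow> complex. x j) -` B)"
      using that by (intro open_vimage)
    moreover have "?Y B = coord_box A \<inter> (\<lambda>x. x j) -` B"
      using that by (auto simp: memY memA)
    ultimately show ?thesis
      by (auto intro: openin_open_Int)
  qed
  have subt: "subtopology ?X (?Y B) = top_of_set (?Y B)" if "0 \<notin> B" for B
  proof -
    have "?Y B \<subseteq> coord_box A"
      using that by (auto simp: memY memA)
    then show ?thesis
      by (simp add: subtopology_subtopology Int_absorb1)
  qed
  define U V :: "complex set" where "U = - {z. Im z = 0 \<and> Re z \<le> 0}" "V = - {z. Im z = 0 \<and> Re z \<ge> 0}"
  define H K :: "complex set" where "H = {z. Im z > 0}" "K = {z. Im z < 0}"
  have 0: "0 \<notin> U" "0 \<notin> V" "0 \<notin> H" "0 \<notin> K"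
    by (auto simp: U_V_def H_K_def)
  have op1: "open U" "open V" "open H" "open K"
    unfolding U_V_def H_K_def
    by (auto intro!: open_Collect_less closed_Collect_eq closed_Collect_le closed_Collect_conj continuous_intros
        simp: closed_def[symmetric])
  have eU: "has_euler (subtopology ?X (?Y U)) e" and eV: "has_euler (subtopology ?X (?Y V)) e"
    and eH: "has_euler (subtopology ?X (?Y H)) e" and eK: "has_euler (subtopology ?X (?Y K)) e"
    using IH star_about_slit 0 subt by (auto simp: U_V_def H_K_def)
  have "H \<inter> K = {}"
    by (auto simp: H_K_def)
  then have HK: "?Y H \<inter> ?Y K = {}"
    by (auto simp: memY)
  have "has_euler (subtopology ?X (?Y H \<union> ?Y K)) (e + e - 0)"
    by (rule has_euler_Un[OF op op eH eK]) (use 0 op1 HK in \<open>auto intro: has_euler_empty\<close>)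
  \<comment> \<open>Both sides require the coordinate \<open>j\<close> to be non-real.\<close>
  moreover have "?Y H \<union> ?Y K = ?Y U \<inter> ?Y V"
    unfolding set_eq_iff Un_iff Int_iff memY by (auto simp: U_V_def H_K_def)
  ultimately have "has_euler (subtopology ?X (?Y U \<inter> ?Y V)) (e + e)"
    by simp
  then have "has_euler (subtopology ?X (?Y U \<union> ?Y V)) (e + e - (e + e))"
    by (intro has_euler_Un op eU eV) (use 0 op1 in auto)
  moreover have "?Y U \<union> ?Y V = coord_box A"
    unfolding set_eq_iff Un_iff memY memA by (auto simp: U_V_def complex_eq_iff)
  ultimately show ?case
    by (simp add: subtopology_subtopology)
qed

text \<open>Inclusion-exclusion, one member at a time. \<open>U\<close> turns unions of index sets
  into intersections, and the union of two distinct sets with at least \<open>n\<close> elements has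
  more than \<open>n\<close> elements, so the overlap of one member with the others contributes
  nothing.\<close>

lemma has_euler_Union_family:
  fixes U :: "'s set \<Rightarrow> 'a set"
  assumes op: "\<And>S. S \<in> \<C> \<Longrightarrow> openin X (U S)"
    and U_Un: "\<And>S T. U (S \<union> T) = U S \<inter> U T"
    and C_Un: "\<And>S T. S \<in> \<C> \<Longrightarrow> T \<in> \<C> \<Longrightarrow> S \<union> T \<in> \<C>"
    and C_card: "\<And>S. S \<in> \<C> \<Longrightarrow> finite S \<and> n \<le> card S"
    and euler: "\<And>S. S \<in> \<C> \<Longrightarrow> has_euler (subtopology X (U S)) (if card S = n then 1 else 0)"
    and "finite \<G>" "\<G> \<subseteq> \<C>"
  shows "has_euler (subtopology X (\<Union>(U ` \<G>))) (int (card {S \<in> \<G>. card S = n}))"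
  using assms(6,7)
proof (induction "card \<G>" arbitrary: \<G> rule: less_induct)
  case less
  show ?case
  proof (cases "\<G> = {}")
    case True
    then show ?thesis
      by (simp add: has_euler_empty)
  next
    case False
    then obtain S where S: "S \<in> \<G>"
      by blast
    define \<H> where "\<H> = \<G> - {S}"
    define \<K> where "\<K> = (\<union>) S ` \<H>"
    have fin: "finite \<H>" "finite \<K>"
      using less by (auto simp: \<H>_def \<K>_def)
    have lessH: "card \<H> < card \<G>"
      using S less by (simp add: \<H>_def card_Diff1_less del: card_Diff_insert)
    have "card \<K> \<le> card \<H>"
      unfolding \<K>_def by (rule card_image_le[OF fin(1)])
    then have lessK: "card \<K> < card \<G>"
      using lessH by simp
    have C: "S \<in> \<C>" "\<H> \<subseteq> \<C>" "\<K> \<subseteq> \<C>"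
      using S less.prems C_Un by (auto simp: \<H>_def \<K>_def)
    have noK: "{T \<in> \<K>. card T = n} = {}"
    proof (rule ccontr)
      assume "{T \<in> \<K>. card T = n} \<noteq> {}"
      then obtain T where T: "T \<in> \<H>" "card (S \<union> T) = n"
        by (auto simp: \<K>_def)
      have "finite (S \<union> T)" "n \<le> card S" "n \<le> card T"
        using C_card C T by auto
      then have "S = S \<union> T" "T = S \<union> T"
        using T(2) by (intro card_seteq; auto)+
      then show False
        using T(1) by (auto simp: \<H>_def)
    qed
    have "U S \<inter> \<Union>(U ` \<H>) = \<Union>(U ` \<K>)"
      by (auto simp: \<K>_def U_Un)
    then have "has_euler (subtopology X (U S \<inter> \<Union>(U ` \<H>))) 0"
      using less.hyps[OF lessK fin(2) C(3)] noK by simp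
    then have "has_euler (subtopology X (U S \<union> \<Union>(U ` \<H>))) ((if card S = n then 1 else 0) + int (card {S \<in> \<H>. card S = n}) - 0)"
      using C op by (intro has_euler_Un euler less.hyps lessH fin) (auto intro!: openin_Union)
    moreover have "U S \<union> \<Union>(U ` \<H>) = \<Union>(U ` \<G>)"
      using S by (auto simp: \<H>_def)
    moreover have "{T \<in> \<G>. card T = n} = (if card S = n then {S} else {}) \<union> {T \<in> \<H>. card T = n}"
      using S by (auto simp: \<H>_def)
    then have "int (card {T \<in> \<G>. card T = n}) = (if card S = n then 1 else 0) + int (card {T \<in> \<H>. card T = n})"
      using fin by (auto simp: \<H>_def card_insert_if)
    ultimately show ?thesis
      by simp
  qed
qed

section \<open>Systems of disjoint subsets and rooted forests\<close>

text \<open>Rado's argument: if no element of an oversized set can be removed, the tight index sets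
  containing that index have a smallest member \<open>D\<close>, and \<open>D\<close> violates the hypothesis.\<close>
lemma disjoint_subsets_of_card:
  fixes N :: "'i \<Rightarrow> 'b set"
  assumes "finite I" "\<And>i. i \<in> I \<Longrightarrow> finite (N i)"
    and "\<And>A. A \<subseteq> I \<Longrightarrow> k * card A \<le> card (\<Union>(N ` A))"
  shows "\<exists>C. (\<forall>i\<in>I. C i \<subseteq> N i \<and> card (C i) = k) \<and> disjoint_family_on C I"
  using assms(2,3)
proof (induction "\<Sum>i\<in>I. card (N i)" arbitrary: N rule: less_induct)
  case less
  have ge: "k \<le> card (N i)" if "i \<in> I" for i
    using less.prems(2)[of "{i}"] that by simp
  show ?case
  proof (cases "\<forall>i\<in>I. card (N i) = k")
    case True
    have "N i \<inter> N j = {}" if "i \<in> I" "j \<in> I" "i \<noteq> j" for i j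
    proof -
      have "2 * k \<le> card (N i \<union> N j)"
        using less.prems(2)[of "{i, j}"] that by simp
      moreover have "card (N i \<union> N j) + card (N i \<inter> N j) = card (N i) + card (N j)"
        using card_Un_Int[of "N i" "N j"] less.prems(1) that by simp
      ultimately have "card (N i \<inter> N j) = 0"
        using True that by simp
      then show ?thesis
        using less.prems(1) that by simp
    qed
    then show ?thesis
      using True by (intro exI[of _ N]) (auto simp: disjoint_family_on_def)
  next
    case False
    then obtain i where i: "i \<in> I" "k < card (N i)"
      using ge by (metis le_neq_implies_less)
    define R where "R x = N(i := N i - {x})" for x
    have "\<exists>x\<in>N i. \<forall>A\<subseteq>I. k * card A \<le> card (\<Union>(R x ` A))"
    proof (rule ccontr)
      assume "\<not> ?thesis"
      then have "\<forall>x\<in>N i. \<exists>A\<subseteq>I. card (\<Union>(R x ` A)) < k * card A"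
        by (meson not_le)
      then obtain A where A: "\<And>x. x \<in> N i \<Longrightarrow> A x \<subseteq> I" "\<And>x. x \<in> N i \<Longrightarrow> card (\<Union>(R x ` A x)) < k * card (A x)"
        by metis
      define g where "g B = card (\<Union>(N ` B))" for B
      have finN: "finite (\<Union>(N ` B))" if "B \<subseteq> I" for B
        using less.prems(1) that finite_subset[OF that assms(1)] by auto
      \<comment> \<open>If deleting \<open>x\<close> from \<open>N i\<close> breaks the inequality
        for \<open>A x\<close>, then \<open>A x\<close> contains \<open>i\<close>, satisfied the
        inequality with equality, and reached \<open>x\<close> only through
        \<open>i\<close>.\<close>
      have tight: "i \<in> A x \<and> g (A x) = k * card (A x) \<and> x \<notin> \<Union>(N ` (A x - {i}))" if x: "x \<in> N i" for x
      proof -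
        have iA: "i \<in> A x"
        proof (rule ccontr)
          assume "i \<notin> A x"
          then have "\<Union>(R x ` A x) = \<Union>(N ` A x)"
            by (auto simp: R_def)
          then show False
            using A[OF x] less.prems(2)[of "A x"] by simp
        qed
        have sub: "\<Union>(N ` A x) - {x} \<subseteq> \<Union>(R x ` A x)"
          by (auto simp: R_def)
        have finR: "finite (\<Union>(R x ` A x))"
          by (rule finite_subset[OF _ finN[OF A(1)[OF x]]]) (auto simp: R_def split: if_splits)
        have gle: "k * card (A x) \<le> g (A x)"
          using less.prems(2) A(1)[OF x] by (simp add: g_def)
        have notin: "x \<notin> \<Union>(N ` (A x - {i}))"
        proof
          assume "x \<in> \<Union>(N ` (A x - {i}))"
          then have "\<Union>(N ` A x) \<subseteq> \<Union>(R x ` A x)"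
            using sub by (auto simp: R_def)
          then have "g (A x) \<le> card (\<Union>(R x ` A x))"
            unfolding g_def by (rule card_mono[OF finR])
          then show False
            using A(2)[OF x] gle by simp
        qed
        have "g (A x) - 1 \<le> card (\<Union>(N ` A x) - {x})"
          unfolding g_def by (metis card_Diff1_le card_Diff_singleton_if diff_le_self le_refl)
        also have "\<dots> \<le> card (\<Union>(R x ` A x))"
          by (rule card_mono[OF finR sub])
        finally have "g (A x) \<le> k * card (A x)"
          using A(2)[OF x] by simp
        then show ?thesis
          using iA notin gle by simp
      qed
      \<comment> \<open>\<open>g\<close> is submodular and \<open>k * card\<close> is modular, so
        equality passes from two index sets to their intersection.\<close>
      have inter: "g (B \<inter> D) = k * card (B \<inter> D)"
        if B: "B \<subseteq> I" "g B = k * card B" and D: "D \<subseteq> I" "g D = k * card D" for B D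
      proof -
        have fin: "finite B" "finite D"
          using B D assms(1) finite_subset by blast+
        have "card (\<Union>(N ` B) \<union> \<Union>(N ` D)) + card (\<Union>(N ` B) \<inter> \<Union>(N ` D)) = g B + g D"
          unfolding g_def by (rule card_Un_Int[symmetric]) (use finN B D in auto)
        moreover have "card (\<Union>(N ` B) \<union> \<Union>(N ` D)) = g (B \<union> D)"
          unfolding g_def by (intro arg_cong[of _ _ card]) auto
        moreover have "g (B \<inter> D) \<le> card (\<Union>(N ` B) \<inter> \<Union>(N ` D))"
          unfolding g_def using finN[OF B(1)] by (intro card_mono) auto
        ultimately have "g (B \<union> D) + g (B \<inter> D) \<le> k * card B + k * card D"
          using B(2) D(2) by linarith
        also have "\<dots> = k * card (B \<union> D) + k * card (B \<inter> D)"
          using card_Un_Int[OF fin] by (metis distrib_left)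
        finally have le: "g (B \<union> D) + g (B \<inter> D) \<le> k * card (B \<union> D) + k * card (B \<inter> D)" .
        have "k * card (B \<union> D) \<le> g (B \<union> D)" "k * card (B \<inter> D) \<le> g (B \<inter> D)"
          using less.prems(2)[of "B \<union> D"] less.prems(2)[of "B \<inter> D"] B D by (auto simp: g_def)
        then show ?thesis
          using le by linarith
      qed
      define P where "P B \<longleftrightarrow> B \<subseteq> I \<and> i \<in> B \<and> g B = k * card B" for B
      have "card (N i) \<noteq> 0"
        using i by simp
      then obtain x0 where "x0 \<in> N i"
        by fastforce
      then have "P (A x0)"
        using A tight by (simp add: P_def)
      then obtain D where D: "P D" "\<And>B. P B \<Longrightarrow> card D \<le> card B"
        using ex_has_least_nat[of P "A x0" card] by blast
      then have DI: "D \<subseteq> I" "i \<in> D" "finite D"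
        using assms(1) finite_subset by (auto simp: P_def)
      have sub: "D \<subseteq> A x" if x: "x \<in> N i" for x
      proof -
        have "P (A x \<inter> D)"
          using inter[of "A x" D] A(1)[OF x] tight[OF x] D(1) by (auto simp: P_def)
        then have "card D \<le> card (A x \<inter> D)"
          by (rule D(2))
        then have "A x \<inter> D = D"
          using DI by (intro card_seteq) auto
        then show ?thesis
          by blast
      qed
      \<comment> \<open>Each \<open>x\<close> in \<open>N i\<close> is missed by the other members
        of \<open>A x\<close>, and \<open>D\<close> is contained in every such \<open>A x\<close>.
        Hence within \<open>D\<close> the elements of \<open>N i\<close> belong to \<open>i\<close>
        alone; there are more than \<open>k\<close> of them, too many for equality at
        \<open>D\<close>.\<close>
      have disj: "N i \<inter> \<Union>(N ` (D - {i})) = {}"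
        using sub tight by blast
      have "g D = card (N i \<union> \<Union>(N ` (D - {i})))"
        using DI unfolding g_def by (intro arg_cong[of _ _ card]) auto
      also have "\<dots> = card (N i) + g (D - {i})"
        unfolding g_def using DI less.prems(1) i finN[of "D - {i}"] disj by (intro card_Un_disjoint) auto
      finally have "g D = card (N i) + g (D - {i})" .
      moreover have "k * card (D - {i}) \<le> g (D - {i})"
        using less.prems(2)[of "D - {i}"] DI by (auto simp: g_def)
      moreover have "card D = Suc (card (D - {i}))"
        by (rule card.remove[OF DI(3,2)])
      ultimately have "k * card D < g D"
        using i(2) by simp
      then show False
        using D(1) by (simp add: P_def)
    qed
    then obtain x where x: "x \<in> N i" "\<forall>A\<subseteq>I. k * card A \<le> card (\<Union>(R x ` A))"
      by blast
    have sub: "R x j \<subseteq> N j" for j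
      by (simp add: R_def)
    have "(\<Sum>j\<in>I. card (R x j)) < (\<Sum>j\<in>I. card (N j))"
    proof (rule sum_strict_mono_ex1[OF assms(1)])
      show "\<forall>j\<in>I. card (R x j) \<le> card (N j)"
        using less.prems(1) sub by (auto intro: card_mono)
      have "card (R x i) < card (N i)"
        using card_Diff1_less[OF less.prems(1)[OF i(1)] x(1)] by (simp only: R_def fun_upd_same)
      then show "\<exists>j\<in>I. card (R x j) < card (N j)"
        using i(1) by blast
    qed
    moreover have "finite (R x j)" if "j \<in> I" for j
      using less.prems(1)[OF that] sub finite_subset by blast
    ultimately obtain C where "\<forall>j\<in>I. C j \<subseteq> R x j \<and> card (C j) = k" "disjoint_family_on C I"
      using less.hyps[of "R x"] x(2) by blast
    then show ?thesis
      using sub by (intro exI[of _ C]) blast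
  qed
qed

text \<open>The multinomial coefficient with equal parts, cleared of its denominator and obtained by
  choosing the fibre of one point \<open>x\<close> at a time.\<close>

lemma card_equal_fibres:
  assumes "finite A" "finite B" "card B = k * card A"
  shows "card {f \<in> B \<rightarrow>\<^sub>E A. \<forall>s\<in>A. card {t \<in> B. f t = s} = k} * fact k ^ card A = fact (card B)"
  using assms
proof (induction A arbitrary: B rule: finite_induct)
  case empty
  then have "B = {}"
    by simp
  then show ?case
    by simp
next
  case (insert x A)
  let ?F = "\<lambda>B A. {f \<in> B \<rightarrow>\<^sub>E A. \<forall>s\<in>A. card {t \<in> B. f t = s} = k}"
  define \<K> where "\<K> = {K. K \<subseteq> B \<and> card K = k}"
  have fin\<K>: "finite \<K>"
    using insert.prems by (auto simp: \<K>_def)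
  have finF: "finite (?F B' A')" if "finite B'" "finite A'" for B' A' :: "_ set"
    by (rule finite_subset[OF _ finite_PiE[of B' "\<lambda>_. A'"]]) (use that in auto)
  have kB: "k \<le> card B" and cardB: "card B - k = k * card A"
    using insert by auto
  have sub: "card (B - K) = k * card A" if "K \<in> \<K>" for K
    using that insert.prems finite_subset[of K B] cardB by (auto simp: \<K>_def card_Diff_subset)
  have "bij_betw (\<lambda>f. ({t \<in> B. f t = x}, restrict f (B - {t \<in> B. f t = x}))) (?F B (insert x A)) (SIGMA K:\<K>. ?F (B - K) A)"
  proof (rule bij_betw_byWitness[where f' = "\<lambda>(K, h). \<lambda>t\<in>B. if t \<in> K then x else h t"])
    show "\<forall>f\<in>?F B (insert x A). (case ({t \<in> B. f t = x}, restrict f (B - {t \<in> B. f t = x})) of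
        (K, h) \<Rightarrow> \<lambda>t\<in>B. if t \<in> K then x else h t) = f"
      by (auto simp: fun_eq_iff PiE_def extensional_def)
    show "\<forall>Kh\<in>(SIGMA K:\<K>. ?F (B - K) A).
        (({t \<in> B. (case Kh of (K, h) \<Rightarrow> \<lambda>t\<in>B. if t \<in> K then x else h t) t = x},
          restrict (case Kh of (K, h) \<Rightarrow> \<lambda>t\<in>B. if t \<in> K then x else h t)
            (B - {t \<in> B. (case Kh of (K, h) \<Rightarrow> \<lambda>t\<in>B. if t \<in> K then x else h t) t = x}))) = Kh"
    proof clarify
      fix K h
      assume K: "K \<in> \<K>" and h: "h \<in> (B - K) \<rightarrow>\<^sub>E A"
      have "{t \<in> B. (\<lambda>t\<in>B. if t \<in> K then x else h t) t = x} = K"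
        using K h insert.hyps(2) by (auto simp: \<K>_def PiE_def Pi_def)
      moreover have "restrict (\<lambda>t\<in>B. if t \<in> K then x else h t) (B - K) = h"
        using h by (auto simp: fun_eq_iff PiE_def extensional_def)
      ultimately show "{t \<in> B. (\<lambda>t\<in>B. if t \<in> K then x else h t) t = x} = K \<and>
          restrict (\<lambda>t\<in>B. if t \<in> K then x else h t) (B - {t \<in> B. (\<lambda>t\<in>B. if t \<in> K then x else h t) t = x}) = h"
        by simp
    qed
    show "(\<lambda>f. ({t \<in> B. f t = x}, restrict f (B - {t \<in> B. f t = x}))) ` ?F B (insert x A) \<subseteq> (SIGMA K:\<K>. ?F (B - K) A)"
    proof (rule image_subsetI)
      fix f
      assume f: "f \<in> ?F B (insert x A)"
      let ?K = "{t \<in> B. f t = x}"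
      have "?K \<in> \<K>"
        using f by (auto simp: \<K>_def)
      moreover have "restrict f (B - ?K) \<in> (B - ?K) \<rightarrow>\<^sub>E A"
        using f by (auto simp: PiE_def Pi_def)
      moreover have "{t \<in> B - ?K. restrict f (B - ?K) t = s} = {t \<in> B. f t = s}" if "s \<in> A" for s
        using that insert.hyps(2) by auto
      ultimately show "(?K, restrict f (B - ?K)) \<in> (SIGMA K:\<K>. ?F (B - K) A)"
        using f by simp
    qed
    show "(\<lambda>(K, h). \<lambda>t\<in>B. if t \<in> K then x else h t) ` (SIGMA K:\<K>. ?F (B - K) A) \<subseteq> ?F B (insert x A)"
    proof clarify
      fix K h
      assume K: "K \<in> \<K>" and h: "h \<in> (B - K) \<rightarrow>\<^sub>E A" and fib: "\<forall>s\<in>A. card {t \<in> B - K. h t = s} = k"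
      let ?f = "\<lambda>t\<in>B. if t \<in> K then x else h t"
      have "{t \<in> B. ?f t = x} = K"
        using K h insert.hyps(2) by (auto simp: \<K>_def PiE_def Pi_def)
      moreover have "{t \<in> B. ?f t = s} = {t \<in> B - K. h t = s}" if "s \<in> A" for s
        using that insert.hyps(2) by auto
      ultimately have "\<forall>s\<in>insert x A. card {t \<in> B. ?f t = s} = k"
        using K fib by (simp add: \<K>_def)
      moreover have "?f \<in> B \<rightarrow>\<^sub>E insert x A"
        using h by (auto simp: PiE_def Pi_def)
      ultimately show "?f \<in> B \<rightarrow>\<^sub>E insert x A \<and> (\<forall>s\<in>insert x A. card {t \<in> B. ?f t = s} = k)"
        by blast
    qed
  qed
  then have "card (?F B (insert x A)) = card (SIGMA K:\<K>. ?F (B - K) A)"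
    by (rule bij_betw_same_card)
  also have "\<dots> = (\<Sum>K\<in>\<K>. card (?F (B - K) A))"
    by (rule card_SigmaI[OF fin\<K>], rule ballI, rule finF) (use insert in auto)
  finally have "card (?F B (insert x A)) * fact k ^ card A = (\<Sum>K\<in>\<K>. card (?F (B - K) A) * fact k ^ card A)"
    by (simp add: sum_distrib_right)
  also have "\<dots> = (\<Sum>K\<in>\<K>. fact (card B - k))"
  proof (rule sum.cong)
    fix K
    assume "K \<in> \<K>"
    then show "card (?F (B - K) A) * fact k ^ card A = fact (card B - k)"
      using insert.IH[of "B - K"] insert.prems sub[of K] cardB by simp
  qed simp
  also have "\<dots> = (card B choose k) * fact (card B - k)"
    using n_subsets[OF insert.prems(1), of k] by (simp add: \<K>_def)
  finally have "card (?F B (insert x A)) * fact k ^ card A * fact k = fact k * fact (card B - k) * (card B choose k)"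
    by simp
  also have "\<dots> = fact (card B)"
    by (rule binomial_fact_lemma[OF kB])
  finally show ?case
    using insert.hyps by (simp add: mult.assoc mult.commute)
qed

text \<open>A map \<open>p\<close> sends each node \<open>s \<in> A\<close> to its parent slot, which lies either in \<open>R\<close> (the slots of
  the roots) or in the slots \<open>C s'\<close> of another node; it is grounded if all nodes descend from \<open>R\<close>.\<close>
inductive_set grounded :: "'i set \<Rightarrow> 'x set \<Rightarrow> ('i \<Rightarrow> 'x set) \<Rightarrow> ('i \<Rightarrow> 'x) \<Rightarrow> 'i set"
  for A R C p where
  base: "s \<in> A \<Longrightarrow> p s \<in> R \<Longrightarrow> s \<in> grounded A R C p"
| step: "s \<in> A \<Longrightarrow> s' \<in> grounded A R C p \<Longrightarrow> p s \<in> C s' \<Longrightarrow> s \<in> grounded A R C p"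

definition grounded_maps :: "'i set \<Rightarrow> 'x set \<Rightarrow> ('i \<Rightarrow> 'x set) \<Rightarrow> ('i \<Rightarrow> 'x) set" where
  "grounded_maps A R C = {p \<in> A \<rightarrow>\<^sub>E R \<union> \<Union>(C ` A). A \<subseteq> grounded A R C p}"

lemma grounded_sub: "grounded A R C p \<subseteq> A"
proof
  show "s \<in> A" if "s \<in> grounded A R C p" for s
    using that by cases auto
qed

section \<open>Counting rooted forests level by level\<close>

lemma sum_over_subsets_card:
  fixes g :: "nat \<Rightarrow> nat"
  assumes "finite A"
  shows "(\<Sum>B\<in>Pow A. g (card B)) = (\<Sum>j\<le>card A. (card A choose j) * g j)"
proof -
  have "(\<Sum>B\<in>Pow A. g (card B)) = (\<Sum>j\<le>card A. \<Sum>B\<in>{B \<in> Pow A. card B = j}. g (card B))"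
    using assms by (intro sum.group[symmetric]) (auto simp: card_mono)
  also have "\<dots> = (\<Sum>j\<le>card A. (card A choose j) * g j)"
  proof (rule sum.cong)
    fix j
    have "(\<Sum>B\<in>{B \<in> Pow A. card B = j}. g (card B)) = (\<Sum>B\<in>{B. B \<subseteq> A \<and> card B = j}. g j)"
      by (intro sum.cong) auto
    then show "(\<Sum>B\<in>{B \<in> Pow A. card B = j}. g (card B)) = (card A choose j) * g j"
      using n_subsets[OF assms, of j] by simp
  qed simp
  finally show ?thesis .
qed

text \<open>The binomial theorem differentiated in \<open>r\<close> and multiplied by
  \<open>r\<close>; in the proof the factor \<open>j\<close> is absorbed into the binomial
  coefficient.\<close>

lemma weighted_binomial_sum:
  fixes r x n :: nat
  assumes "n > 0"
  shows "(\<Sum>j\<le>n. (n choose j) * (j * r ^ j * x ^ (n - j))) = n * r * (r + x) ^ (n - 1)"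
proof -
  obtain n' where n: "n = Suc n'"
    using assms by (cases n) auto
  have "(\<Sum>j\<le>n. (n choose j) * (j * r ^ j * x ^ (n - j))) =
      (\<Sum>j\<le>n'. (Suc n' choose Suc j) * (Suc j * r ^ Suc j * x ^ (n' - j)))"
    unfolding n by (subst sum.atMost_Suc_shift) simp
  also have "\<dots> = (\<Sum>j\<le>n'. n * r * ((n' choose j) * r ^ j * x ^ (n' - j)))"
  proof (rule sum.cong)
    fix j
    have "(Suc n' choose Suc j) * Suc j = n * (n' choose j)"
      using Suc_times_binomial_eq[of n' j] n by simp
    then show "(Suc n' choose Suc j) * (Suc j * r ^ Suc j * x ^ (n' - j)) = n * r * ((n' choose j) * r ^ j * x ^ (n' - j))"
      by (metis (no_types, lifting) mult.assoc mult.left_commute power_Suc)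
  qed simp
  also have "\<dots> = n * r * (r + x) ^ n'"
    by (simp add: binomial sum_distrib_left)
  finally show ?thesis
    by (simp add: n)
qed

text \<open>Deleting the first level \<open>B\<close>, the nodes attached directly to
  \<open>R\<close>, leaves a map of the same kind in which the slots of \<open>B\<close> have become
  the root slots. This is the recursion behind \<open>card_grounded_maps\<close>.\<close>

lemma grounded_restrict:
  fixes p :: "'i \<Rightarrow> 'x"
  assumes disj: "\<And>s. s \<in> A \<Longrightarrow> C s \<inter> R = {}" and cdisj: "disjoint_family_on C A"
    and pm: "\<And>s. s \<in> A \<Longrightarrow> p s \<in> R \<union> \<Union>(C ` A)"
    and B: "B = {s \<in> A. p s \<in> R}" and q: "\<And>s. s \<in> A - B \<Longrightarrow> q s = p s"
  shows "A \<subseteq> grounded A R C p \<longleftrightarrow> A - B \<subseteq> grounded (A - B) (\<Union>(C ` B)) C q"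
proof
  assume L: "A \<subseteq> grounded A R C p"
  have "s \<in> A - B \<longrightarrow> s \<in> grounded (A - B) (\<Union>(C ` B)) C q" if "s \<in> grounded A R C p" for s
    using that
  proof induction
    case (base s)
    then show ?case
      by (simp add: B)
  next
    case (step s s')
    show ?case
    proof
      assume s: "s \<in> A - B"
      have s': "s' \<in> A"
        by (rule subsetD[OF grounded_sub step.hyps(2)])
      show "s \<in> grounded (A - B) (\<Union>(C ` B)) C q"
      proof (cases "s' \<in> B")
        case True
        then show ?thesis
          using s q[OF s] step.hyps by (intro grounded.base) auto
      next
        case False
        then have "s' \<in> grounded (A - B) (\<Union>(C ` B)) C q"
          using step.IH s' by blast
        then show ?thesis
          using s q[OF s] step.hyps by (intro grounded.step[of s _ s']) auto
      qed
    qed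
  qed
  then show "A - B \<subseteq> grounded (A - B) (\<Union>(C ` B)) C q"
    using L by blast
next
  assume R: "A - B \<subseteq> grounded (A - B) (\<Union>(C ` B)) C q"
  have b: "s \<in> grounded A R C p" if "s \<in> B" for s
    using that by (intro grounded.base) (auto simp: B)
  have "s \<in> grounded A R C p" if "s \<in> grounded (A - B) (\<Union>(C ` B)) C q" for s
    using that
  proof induction
    case (base s)
    then obtain s' where "s' \<in> B" "p s \<in> C s'"
      using q by auto
    then show ?case
      using b base by (intro grounded.step[of s A s']) auto
  next
    case (step s s')
    then show ?case
      using q by (intro grounded.step[of s A s']) auto
  qed
  then show "A \<subseteq> grounded A R C p"
    using R b by blast
qed

text \<open>A Cayley-type formula. If \<open>B\<close> is the first level, its nodes have
  \<open>card R ^ card B\<close> choices of root slots, and the rest is a forest over the slots of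
  \<open>B\<close>, to which the induction hypothesis applies.\<close>

theorem card_grounded_maps:
  fixes A :: "'i set" and R :: "'x set"
  assumes "finite A" "finite R" "\<And>s. s \<in> A \<Longrightarrow> finite (C s) \<and> card (C s) = c \<and> C s \<inter> R = {}"
    "disjoint_family_on C A"
  shows "card (grounded_maps A R C) = (if A = {} then 1 else card R * (card R + c * card A) ^ (card A - 1))"
  using assms
proof (induction "card A" arbitrary: A R rule: less_induct)
  case less
  note fin = less.prems(1,2) and C = less.prems(3) and cdisj = less.prems(4)
  show ?case
  proof (cases "A = {}")
    case True
    then show ?thesis
      by (simp add: grounded_maps_def)
  next
    case False
    define n where "n = card A"
    have n: "n > 0"
      using False fin by (simp add: n_def card_gt_0_iff)
    define r where "r = card R"
    let ?U = "\<lambda>B. \<Union>(C ` B)"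
    let ?G = "\<lambda>B. grounded_maps (A - B) (?U B) C"
    define \<B> where "\<B> = Pow A - {{}}"
    have finU: "finite (?U B)" and cardU: "card (?U B) = c * card B" if "B \<subseteq> A" for B
    proof -
      have fB: "finite B"
        using that fin finite_subset by blast
      then show "finite (?U B)"
        using C that by auto
      have "card (?U B) = (\<Sum>s\<in>B. card (C s))"
      proof (rule card_UN_disjoint)
        show "\<forall>s\<in>B. \<forall>s'\<in>B. s \<noteq> s' \<longrightarrow> C s \<inter> C s' = {}"
          using cdisj that unfolding disjoint_family_on_def by blast
      qed (use fB C that in auto)
      also have "\<dots> = (\<Sum>s\<in>B. c)"
        using C that by (intro sum.cong) auto
      finally show "card (?U B) = c * card B"
        by simp
    qed
    have finG: "finite (?G B)" if "B \<subseteq> A" for B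
    proof -
      have "finite ((A - B) \<rightarrow>\<^sub>E ?U B \<union> ?U (A - B))"
        using fin finU[OF that] finU[of "A - B"] by (intro finite_PiE) auto
      then show ?thesis
        by (rule rev_finite_subset) (auto simp: grounded_maps_def)
    qed
    \<comment> \<open>A grounded map splits into the set \<open>B\<close> of nodes on the first
      level, their root slots and the map on the remaining nodes; \<open>\<Psi>\<close> glues these
      together again.\<close>
    define \<Phi> where "\<Phi> p = (let B = {s \<in> A. p s \<in> R} in (B, restrict p B, restrict p (A - B)))" for p :: "'i \<Rightarrow> 'x"
    define \<Psi> :: "'i set \<times> ('i \<Rightarrow> 'x) \<times> ('i \<Rightarrow> 'x) \<Rightarrow> 'i \<Rightarrow> 'x"
      where "\<Psi> = (\<lambda>(B, u, q). \<lambda>s\<in>A. if s \<in> B then u s else q s)"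
    have "bij_betw \<Phi> (grounded_maps A R C) (SIGMA B:\<B>. (B \<rightarrow>\<^sub>E R) \<times> ?G B)"
    proof (rule bij_betw_byWitness[where f' = \<Psi>])
      show "\<forall>p\<in>grounded_maps A R C. \<Psi> (\<Phi> p) = p"
        by (auto simp: \<Phi>_def \<Psi>_def Let_def grounded_maps_def fun_eq_iff PiE_def extensional_def)
      \<comment> \<open>The slots of nodes are disjoint from \<open>R\<close>, so the glued map has
        \<open>B\<close> as its first level again.\<close>
      have glue: "{s \<in> A. (\<lambda>s\<in>A. if s \<in> B then u s else q s) s \<in> R} = B"
        if "B \<in> \<B>" "u \<in> B \<rightarrow>\<^sub>E R" "q \<in> ?G B" for B u q
      proof -
        have "q s \<notin> R" if "s \<in> A" "s \<notin> B" for s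
        proof -
          have "q s \<in> ?U B \<union> ?U (A - B)"
            using \<open>q \<in> ?G B\<close> that by (auto simp: grounded_maps_def PiE_def Pi_def)
          then show ?thesis
            using C \<open>B \<in> \<B>\<close> by (auto simp: \<B>_def)
        qed
        then show ?thesis
          using that by (auto simp: \<B>_def PiE_def Pi_def)
      qed
      show "\<forall>z\<in>(SIGMA B:\<B>. (B \<rightarrow>\<^sub>E R) \<times> ?G B). \<Phi> (\<Psi> z) = z"
      proof
        fix z
        assume "z \<in> (SIGMA B:\<B>. (B \<rightarrow>\<^sub>E R) \<times> ?G B)"
        then obtain B u q where z: "z = (B, u, q)" and B: "B \<in> \<B>" "u \<in> B \<rightarrow>\<^sub>E R" "q \<in> ?G B"
          by (elim SigmaE) auto
        let ?p = "\<lambda>s\<in>A. if s \<in> B then u s else q s"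
        have BA: "B \<subseteq> A"
          using B by (simp add: \<B>_def)
        have "restrict ?p B = u"
          using B(2) BA by (auto simp: fun_eq_iff PiE_def extensional_def)
        moreover have "restrict ?p (A - B) = q"
          using B(3) BA by (auto simp: grounded_maps_def fun_eq_iff PiE_def extensional_def)
        ultimately have "\<Phi> ?p = z"
          unfolding \<Phi>_def glue[OF B] Let_def z by (simp only:)
        then show "\<Phi> (\<Psi> z) = z"
          by (simp only: \<Psi>_def z prod.case)
      qed
      show "\<Phi> ` grounded_maps A R C \<subseteq> (SIGMA B:\<B>. (B \<rightarrow>\<^sub>E R) \<times> ?G B)"
      proof (rule image_subsetI)
        fix p
        assume p: "p \<in> grounded_maps A R C"
        define B where "B = {s \<in> A. p s \<in> R}"
        have pm: "p s \<in> R \<union> ?U A" if "s \<in> A" for s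
          using p that by (auto simp: grounded_maps_def PiE_def Pi_def)
        \<comment> \<open>Without nodes attached to \<open>R\<close> nothing would be grounded,
          although \<open>A\<close> is nonempty.\<close>
        have "B \<noteq> {}"
        proof
          assume e: "B = {}"
          have False if "s \<in> grounded A R C p" for s
            using that by induction (use e in \<open>auto simp: B_def\<close>)
          then show False
            using p False by (auto simp: grounded_maps_def)
        qed
        then have "B \<in> \<B>"
          by (auto simp: \<B>_def B_def)
        moreover have "restrict p B \<in> B \<rightarrow>\<^sub>E R"
          by (auto simp: B_def)
        moreover have "restrict p (A - B) \<in> ?G B"
        proof -
          have "A - B \<subseteq> grounded (A - B) (?U B) C (restrict p (A - B))"
            using grounded_restrict[of A C R p B "restrict p (A - B)"] C cdisj pm p
            by (auto simp: B_def grounded_maps_def)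
          moreover have "restrict p (A - B) \<in> (A - B) \<rightarrow>\<^sub>E ?U B \<union> ?U (A - B)"
          proof (rule restrict_PiE_iff[THEN iffD2], rule ballI)
            fix s
            assume "s \<in> A - B"
            then show "p s \<in> ?U B \<union> ?U (A - B)"
              using pm[of s] by (auto simp: B_def)
          qed
          ultimately show ?thesis
            by (simp add: grounded_maps_def)
        qed
        ultimately show "\<Phi> p \<in> (SIGMA B:\<B>. (B \<rightarrow>\<^sub>E R) \<times> ?G B)"
          unfolding \<Phi>_def Let_def by (fold B_def) (intro SigmaI)
      qed
      show "\<Psi> ` (SIGMA B:\<B>. (B \<rightarrow>\<^sub>E R) \<times> ?G B) \<subseteq> grounded_maps A R C"
      proof (rule image_subsetI)
        fix z
        assume "z \<in> (SIGMA B:\<B>. (B \<rightarrow>\<^sub>E R) \<times> ?G B)"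
        then obtain B u q where z: "z = (B, u, q)" and B: "B \<in> \<B>" "u \<in> B \<rightarrow>\<^sub>E R" "q \<in> ?G B"
          by (elim SigmaE) auto
        let ?p = "\<lambda>s\<in>A. if s \<in> B then u s else q s"
        have BA: "B \<subseteq> A"
          using B by (simp add: \<B>_def)
        have pm: "?p s \<in> R \<union> ?U A" if "s \<in> A" for s
        proof (cases "s \<in> B")
          case True
          then show ?thesis
            using B(2) that by auto
        next
          case False
          then have "q s \<in> ?U B \<union> ?U (A - B)"
            using B(3) that by (auto simp: grounded_maps_def PiE_def Pi_def)
          then show ?thesis
            using BA that False by auto
        qed
        then have "?p \<in> A \<rightarrow>\<^sub>E R \<union> ?U A"
          by (intro restrict_PiE_iff[THEN iffD2] ballI) auto
        moreover have "A \<subseteq> grounded A R C ?p"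
        proof -
          have "A - B \<subseteq> grounded (A - B) (?U B) C q"
            using B(3) by (simp add: grounded_maps_def)
          then show ?thesis
            using grounded_restrict[of A C R ?p B q] C cdisj pm glue[OF B] by auto
        qed
        ultimately have "?p \<in> grounded_maps A R C"
          by (simp add: grounded_maps_def)
        then show "\<Psi> z \<in> grounded_maps A R C"
          by (simp only: \<Psi>_def z prod.case)
      qed
    qed
    then have "card (grounded_maps A R C) = card (SIGMA B:\<B>. (B \<rightarrow>\<^sub>E R) \<times> ?G B)"
      by (rule bij_betw_same_card)
    also have "\<dots> = (\<Sum>B\<in>\<B>. card ((B \<rightarrow>\<^sub>E R) \<times> ?G B))"
    proof (rule card_SigmaI)
      show "finite \<B>"
        using fin by (simp add: \<B>_def)
      show "\<forall>B\<in>\<B>. finite ((B \<rightarrow>\<^sub>E R) \<times> ?G B)"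
      proof
        fix B
        assume "B \<in> \<B>"
        then have "B \<subseteq> A" "finite B"
          using fin finite_subset by (auto simp: \<B>_def)
        then show "finite ((B \<rightarrow>\<^sub>E R) \<times> ?G B)"
          using finG fin by (auto intro: finite_PiE)
      qed
    qed
    \<comment> \<open>Multiplication by \<open>n\<close> turns the inductive value
      \<open>c * card B * (c * n) ^ (n - card B - 1)\<close> into
      \<open>card B * (c * n) ^ (n - card B)\<close>. This expression also covers
      \<open>B = A\<close>, and the sum becomes binomial.\<close>
    also have "n * \<dots> = (\<Sum>B\<in>\<B>. card B * r ^ card B * (c * n) ^ (n - card B))"
      unfolding sum_distrib_left
    proof (rule sum.cong)
      fix B
      assume B: "B \<in> \<B>"
      then have BA: "B \<subseteq> A" "B \<noteq> {}" "finite B"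
        using fin finite_subset by (auto simp: \<B>_def)
      have cardB: "card B > 0" "card B \<le> n"
        using BA fin by (auto simp: card_gt_0_iff n_def card_mono)
      have AB: "card (A - B) = n - card B"
        using BA by (simp add: card_Diff_subset n_def)
      have 1: "card (B \<rightarrow>\<^sub>E R) = r ^ card B"
        using BA(3) by (simp add: card_PiE r_def)
      have 2: "n * card (?G B) = card B * (c * n) ^ (n - card B)"
      proof (cases "A - B = {}")
        case True
        then have "B = A"
          using BA by auto
        then show ?thesis
          by (simp add: n_def grounded_maps_def)
      next
        case False
        have lt: "card (A - B) < card A"
          using cardB AB by (simp add: n_def)
        have pos: "n - card B > 0"
          using False fin AB by (metis card_gt_0_iff finite_Diff)
        have "card (?G B) = (if A - B = {} then 1 else card (?U B) * (card (?U B) + c * card (A - B)) ^ (card (A - B) - 1))"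
        proof (rule less.hyps[OF lt])
          show "disjoint_family_on C (A - B)"
            using cdisj by (auto simp: disjoint_family_on_def)
          show "finite (C s) \<and> card (C s) = c \<and> C s \<inter> ?U B = {}" if "s \<in> A - B" for s
            using C[of s] cdisj that BA by (fastforce simp: disjoint_family_on_def)
        qed (use fin C BA in auto)
        also have "\<dots> = c * card B * (c * card B + c * (n - card B)) ^ (n - card B - 1)"
          using False cardU[OF BA(1)] AB by simp
        also have "c * card B + c * (n - card B) = c * n"
          using cardB by (simp flip: distrib_left)
        finally have "n * card (?G B) = card B * (c * n * (c * n) ^ (n - card B - 1))"
          by simp
        also have "c * n * (c * n) ^ (n - card B - 1) = (c * n) ^ (n - card B)"
          using pos by (metis Suc_diff_1 power_Suc)
        finally show ?thesis .
      qed
      have "n * card ((B \<rightarrow>\<^sub>E R) \<times> ?G B) = r ^ card B * (n * card (?G B))"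
        by (simp add: card_cartesian_product 1)
      then show "n * card ((B \<rightarrow>\<^sub>E R) \<times> ?G B) = card B * r ^ card B * (c * n) ^ (n - card B)"
        by (simp add: 2)
    qed simp
    also have "\<dots> = (\<Sum>B\<in>Pow A. card B * r ^ card B * (c * n) ^ (n - card B))"
      using fin by (intro sum.mono_neutral_left) (auto simp: \<B>_def)
    also have "\<dots> = (\<Sum>j\<le>n. (n choose j) * (j * r ^ j * (c * n) ^ (n - j)))"
      unfolding n_def by (rule sum_over_subsets_card[OF fin(1)])
    also have "\<dots> = n * r * (r + c * n) ^ (n - 1)"
      by (rule weighted_binomial_sum[OF n])
    finally have "n * card (grounded_maps A R C) = n * (r * (r + c * n) ^ (n - 1))"
      by (simp only: mult.assoc)
    then have "card (grounded_maps A R C) = r * (r + c * n) ^ (n - 1)"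
      using n by auto
    then show ?thesis
      using False by (simp only: n_def r_def if_False)
  qed
qed

section \<open>Representations of dimension one at every vertex\<close>

lemma subspace_cvec_1:
  assumes "fun_space.subspace S" "S \<subseteq> cvec 1"
  shows "S = {0} \<or> S = cvec 1"
proof (cases "S \<subseteq> {0}")
  case True
  then show ?thesis
    using fun_space.subspace_0[OF assms(1)] by auto
next
  case False
  then obtain x where x: "x \<in> S" "x \<noteq> 0"
    by auto
  have cvec: "y i = 0" if "y \<in> cvec 1" "i \<noteq> 0" for y i
    using that by (simp add: cvec_def)
  have "x 0 \<noteq> 0"
  proof
    assume "x 0 = 0"
    then have "x i = 0" for i
      using x(1) assms(2) cvec[of x i] by (cases "i = 0") auto
    then show False
      using x(2) by (simp add: fun_eq_iff)
  qed
  have "y \<in> S" if "y \<in> cvec 1" for y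
  proof -
    have "y i = ((y 0 / x 0) *\<^sub>f x) i" for i
      using cvec[OF that, of i] cvec[of x i] x(1) assms(2) \<open>x 0 \<noteq> 0\<close>
      by (cases "i = 0") (auto simp: fun_scale_def)
    then have "y = (y 0 / x 0) *\<^sub>f x"
      by (rule ext)
    then show ?thesis
      using fun_space.subspace_scale[OF assms(1) x(1)] by metis
  qed
  then show ?thesis
    using assms(2) by auto
qed

lemma dim_zero_space: "fun_space.dim {0} = 0"
proof -
  have "fun_space.span {} = fun_space.span {0}"
    by (simp only: fun_space.span_insert_0)
  from fun_space.dim_eq_card[OF this fun_space.independent_empty] show ?thesis
    by (simp only: card.empty)
qed

lemma dim_cvec_1: "fun_space.dim (cvec 1 :: (nat \<Rightarrow> complex) set) = 1"
proof -
  define u :: "nat \<Rightarrow> complex" where "u = (\<lambda>i. if i = 0 then 1 else 0)"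
  have "u \<noteq> 0"
    by (auto simp: u_def fun_eq_iff)
  then have ind: "fun_space.independent {u}"
    by simp
  have sub: "fun_space.subspace (cvec 1 :: (nat \<Rightarrow> complex) set)"
    by (auto simp: fun_space.subspace_def cvec_def fun_scale_def)
  have u: "{u} \<subseteq> cvec 1"
    by (auto simp: u_def cvec_def)
  have "cvec 1 \<subseteq> fun_space.span {u}"
  proof
    fix y :: "nat \<Rightarrow> complex"
    assume "y \<in> cvec 1"
    then have "y = y 0 *\<^sub>f u"
      by (auto simp: u_def cvec_def fun_scale_def fun_eq_iff)
    then show "y \<in> fun_space.span {u}"
      by (metis fun_space.span_base fun_space.span_scale singletonI)
  qed
  then show ?thesis
    using fun_space.dim_unique[OF u _ ind, of 1] by simp
qed

lemma cvec_1_neq_zero: "(cvec 1 :: (nat \<Rightarrow> complex) set) \<noteq> {0}"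
  using dim_cvec_1 dim_zero_space by (metis zero_neq_one)

lemma cvec_0: "cvec 0 = {0}"
  by (auto simp: cvec_def fun_eq_iff)

lemma GL_1_entry:
  assumes "A \<in> GL 1"
  shows "A 0 0 \<noteq> 0"
proof -
  obtain B where "mat_mul 1 A B = mat_one 1"
    using assms by (auto simp: GL_def)
  then have "mat_mul 1 A B 0 0 = mat_one 1 0 0"
    by simp
  then show ?thesis
    by (auto simp: mat_mul_def mat_one_def)
qed

definition scalar_mat :: "complex \<Rightarrow> nat \<Rightarrow> nat \<Rightarrow> complex" where
  "scalar_mat c = (\<lambda>i j. if i = 0 \<and> j = 0 then c else 0)"

lemma scalar_mat_mul: "mat_mul 1 (scalar_mat c) (scalar_mat c') = scalar_mat (c * c')"
  by (auto simp: mat_mul_def scalar_mat_def fun_eq_iff)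

lemma mat_one_1: "mat_one 1 = scalar_mat 1"
  by (auto simp: mat_one_def scalar_mat_def fun_eq_iff)

lemma scalar_mat_cmat: "scalar_mat c \<in> cmat 1 1"
  by (auto simp: cmat_def scalar_mat_def)

lemma scalar_mat_GL:
  assumes "c \<noteq> 0"
  shows "scalar_mat c \<in> GL 1"
  unfolding GL_def
proof (intro CollectI conjI bexI)
  show "mat_mul 1 (scalar_mat c) (scalar_mat (inverse c)) = mat_one 1"
    "mat_mul 1 (scalar_mat (inverse c)) (scalar_mat c) = mat_one 1"
    using assms by (simp_all add: scalar_mat_mul mat_one_1 del: One_nat_def)
qed (rule scalar_mat_cmat)+

text \<open>Supplies the base change at the vertices of dimension 0.\<close>

lemma zero_GL_0: "0 \<in> GL 0"
  unfolding GL_def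
proof (intro CollectI conjI bexI)
  show "mat_mul 0 0 0 = mat_one 0" "mat_mul 0 0 0 = mat_one 0"
    by (auto simp: mat_mul_def mat_one_def)
qed (simp_all add: cmat_def)

text \<open>Trees are generated by attaching leaves, along arrows of either orientation.
  Connectedness is thereby built in, and the normalisation of a representation along a tree becomes
  an induction.\<close>

inductive span_tree :: "('e \<Rightarrow> 'v) \<Rightarrow> ('e \<Rightarrow> 'v) \<Rightarrow> 'v set \<Rightarrow> 'e set \<Rightarrow> bool"
  for src tgt :: "'e \<Rightarrow> 'v" where
  root: "span_tree src tgt {v} {}"
| grow: "span_tree src tgt V T \<Longrightarrow> v \<in> V \<Longrightarrow> w \<notin> V \<Longrightarrow> (src e = v \<and> tgt e = w) \<or> (src e = w \<and> tgt e = v) \<Longrightarrow>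
    span_tree src tgt (insert w V) (insert e T)"

lemma span_tree_card:
  assumes "span_tree src tgt V T"
  shows "finite V \<and> finite T \<and> card V = Suc (card T) \<and> (\<forall>e\<in>T. src e \<in> V \<and> tgt e \<in> V)"
  using assms
proof induction
  case (grow V T v w e)
  then have "e \<notin> T"
    by auto
  with grow show ?case
    by auto
qed auto

lemma span_tree_constant:
  assumes "span_tree src tgt V T" "\<And>e. e \<in> T \<Longrightarrow> g (src e) = g (tgt e)"
  shows "\<exists>c. \<forall>v\<in>V. g v = c"
  using assms
proof induction
  case (grow V T v w e)
  then obtain c where "\<forall>v\<in>V. g v = c"
    by blast
  then show ?case
    using grow.hyps grow.prems[of e] by (intro exI[of _ c]) auto
qed auto

text \<open>\<open>\<gamma>\<close> is a base change normalising the tree arrows to \<open>1\<close>.\<close>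
lemma span_tree_gauge:
  fixes val :: "'e \<Rightarrow> 'x::topological_space \<Rightarrow> complex"
  assumes "span_tree src tgt V T" and cont: "\<And>e. continuous_on UNIV (val e)"
  shows "\<exists>\<gamma>. \<forall>D. (\<forall>e\<in>T. \<forall>X\<in>D. val e X \<noteq> 0) \<longrightarrow>
    (\<forall>v\<in>V. continuous_on D (\<gamma> v) \<and> (\<forall>X\<in>D. \<gamma> v X \<noteq> 0)) \<and>
    (\<forall>e\<in>T. \<forall>X\<in>D. \<gamma> (tgt e) X * val e X = \<gamma> (src e) X)"
  using assms(1)
proof induction
  case (root v)
  show ?case
    by (intro exI[of _ "\<lambda>_ _. 1"]) auto
next
  case (grow V T v w e)
  then obtain \<gamma> where \<gamma>: "\<And>D. (\<forall>e\<in>T. \<forall>X\<in>D. val e X \<noteq> 0) \<Longrightarrow>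
    (\<forall>v\<in>V. continuous_on D (\<gamma> v) \<and> (\<forall>X\<in>D. \<gamma> v X \<noteq> 0)) \<and>
    (\<forall>e\<in>T. \<forall>X\<in>D. \<gamma> (tgt e) X * val e X = \<gamma> (src e) X)"
    by blast
  \<comment> \<open>The equation for the new arrow \<open>e\<close> determines the value at the leaf
    \<open>w\<close>: a product or a quotient, according to the orientation of
    \<open>e\<close>.\<close>
  define \<gamma>' where "\<gamma>' = \<gamma>(w := (\<lambda>X. if src e = w then \<gamma> v X * val e X else \<gamma> v X / val e X))"
  have vw: "v \<noteq> w"
    using grow.hyps by auto
  show ?case
  proof (intro exI[of _ \<gamma>'] allI impI)
    fix D
    assume D: "\<forall>e\<in>insert e T. \<forall>X\<in>D. val e X \<noteq> 0"
    then have old: "\<forall>v\<in>V. continuous_on D (\<gamma> v) \<and> (\<forall>X\<in>D. \<gamma> v X \<noteq> 0)"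
      "\<forall>e\<in>T. \<forall>X\<in>D. \<gamma> (tgt e) X * val e X = \<gamma> (src e) X"
      using \<gamma>[of D] by auto
    have conte: "continuous_on D (val e)"
      using cont continuous_on_subset by blast
    have w: "continuous_on D (\<gamma>' w) \<and> (\<forall>X\<in>D. \<gamma>' w X \<noteq> 0)"
      using old grow.hyps(2) D conte unfolding \<gamma>'_def
      by (cases "src e = w") (auto intro!: continuous_intros)
    have V: "\<gamma>' u = \<gamma> u" if "u \<in> V" for u
      using that grow.hyps by (auto simp: \<gamma>'_def)
    have e: "\<gamma>' (tgt e) X * val e X = \<gamma>' (src e) X" if "X \<in> D" for X
      using grow.hyps(4) V[OF grow.hyps(2)] vw D that by (auto simp: \<gamma>'_def)
    have T: "\<gamma>' (tgt f) X * val f X = \<gamma>' (src f) X" if "f \<in> T" "X \<in> D" for f X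
      using span_tree_card[OF grow.hyps(1)] that old V by auto
    show "(\<forall>v\<in>insert w V. continuous_on D (\<gamma>' v) \<and> (\<forall>X\<in>D. \<gamma>' v X \<noteq> 0)) \<and>
      (\<forall>e\<in>insert e T. \<forall>X\<in>D. \<gamma>' (tgt e) X * val e X = \<gamma>' (src e) X)"
      using w old V e T by auto
  qed
qed

lemma level_quiver_simps [simp]:
  "tail (level_quiver m) ((p, s), (q, t), r) = Source p s"
  "head (level_quiver m) ((p, s), (q, t), r) = Sink q t"
  "((p, s), (q, t), r) \<in> arcs (level_quiver m) \<longleftrightarrow> p \<ge> 1 \<and> s \<ge> 1 \<and> q \<ge> 1 \<and> t \<ge> 1 \<and> r < m * p * q"
  "Source l n \<in> verts (level_quiver m) \<longleftrightarrow> l \<ge> 1 \<and> n \<ge> 1"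
  "Sink l n \<in> verts (level_quiver m) \<longleftrightarrow> l \<ge> 1 \<and> n \<ge> 1"
  by (simp_all add: level_quiver_def)

section \<open>The torus acting on representations of dimension one\<close>

locale trivial_moduli =
  fixes a k m :: nat
  assumes a: "a \<ge> 1"
begin

definition b :: nat where "b = k * a + 1"

abbreviation Q where "Q \<equiv> level_quiver m"
abbreviation d where "d \<equiv> trivial_partition a b"

definition edge :: "nat \<Rightarrow> nat \<Rightarrow> nat \<Rightarrow> level_arc" where
  "edge s t r = ((1, s), (1, t), r)"

definition edges :: "level_arc set" where
  "edges = {edge s t r | s t r. s \<in> {1..a} \<and> t \<in> {1..b} \<and> r < m}"

definition nodes :: "level_vertex set" where
  "nodes = Source 1 ` {1..a} \<union> Sink 1 ` {1..b}"

lemma finite_edges: "finite edges"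
proof -
  have "edges \<subseteq> (\<lambda>(s, t, r). edge s t r) ` ({1..a} \<times> {1..b} \<times> {..<m})"
    by (force simp: edges_def)
  then show ?thesis
    by (rule finite_subset) auto
qed

lemma edge_in_edges [simp]: "edge s t r \<in> edges \<longleftrightarrow> s \<in> {1..a} \<and> t \<in> {1..b} \<and> r < m"
  by (auto simp: edges_def edge_def)

lemma edge_simps [simp]: "tail Q (edge s t r) = Source 1 s" "head Q (edge s t r) = Sink 1 t"
  by (simp_all add: edge_def)

lemma edge_inject [simp]: "edge s t r = edge s' t' r' \<longleftrightarrow> s = s' \<and> t = t' \<and> r = r'"
  by (auto simp: edge_def)

lemma d_le_1: "d v \<le> 1"
  by (cases v) auto

lemma d_eq_1: "d v = 1 \<longleftrightarrow> v \<in> nodes" and d_eq_0: "d v = 0 \<longleftrightarrow> v \<notin> nodes"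
  by (cases v; force simp: nodes_def)+

lemma card_nodes: "card nodes = a + b"
  unfolding nodes_def by (subst card_Un_disjoint) (auto simp: card_image inj_on_def)

lemma edges_arcs: "e \<in> edges \<longleftrightarrow> e \<in> arcs Q \<and> tail Q e \<in> nodes \<and> head Q e \<in> nodes"
proof -
  obtain p s q t r where "e = ((p, s), (q, t), r)"
    by (metis prod.exhaust)
  then show ?thesis
    by (auto simp: edges_def edge_def nodes_def)
qed

lemma nodes_verts: "nodes \<subseteq> verts Q"
  by (auto simp: nodes_def)

text \<open>Matrices at arrows that meet a vertex of dimension 0 have no entries and the others are
  1 by 1, so a representation amounts to one number for each element of
  \<open>edges\<close>.\<close>

lemma rep_space_iff:
  "X \<in> rep_space Q d \<longleftrightarrow> (\<forall>e i j. X e i j \<noteq> 0 \<longrightarrow> e \<in> edges \<and> i = 0 \<and> j = 0)"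
proof
  assume X: "X \<in> rep_space Q d"
  show "\<forall>e i j. X e i j \<noteq> 0 \<longrightarrow> e \<in> edges \<and> i = 0 \<and> j = 0"
  proof (intro allI impI)
    fix e i j
    assume nz: "X e i j \<noteq> 0"
    have e: "e \<in> arcs Q"
    proof (rule ccontr)
      assume "e \<notin> arcs Q"
      then have "X e = 0"
        using X unfolding rep_space_def by blast
      then show False
        using nz by simp
    qed
    then have "X e \<in> cmat (d (head Q e)) (d (tail Q e))"
      using X unfolding rep_space_def by blast
    then have "i < d (head Q e)" "j < d (tail Q e)"
      using nz by (auto simp: cmat_def not_le[symmetric])
    then show "e \<in> edges \<and> i = 0 \<and> j = 0"
      using d_le_1[of "head Q e"] d_le_1[of "tail Q e"] e d_eq_0[of "head Q e"] d_eq_0[of "tail Q e"]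
      by (auto simp: edges_arcs)
  qed
next
  assume R: "\<forall>e i j. X e i j \<noteq> 0 \<longrightarrow> e \<in> edges \<and> i = 0 \<and> j = 0"
  have "X e i j = 0" if "i \<ge> d (head Q e) \<or> j \<ge> d (tail Q e)" for e i j
  proof (rule ccontr)
    assume "X e i j \<noteq> 0"
    then have "e \<in> edges" "i = 0" "j = 0"
      using R by blast+
    then show False
      using that d_eq_1[of "head Q e"] d_eq_1[of "tail Q e"] by (auto simp: edges_arcs)
  qed
  moreover have "X e = 0" if "e \<notin> arcs Q" for e
  proof (intro ext)
    fix i j
    have "X e i j = 0"
      using R[rule_format, of e i j] that edges_arcs[of e] by blast
    then show "X e i j = 0 i j"
      by simp
  qed
  ultimately show "X \<in> rep_space Q d"
    unfolding rep_space_def cmat_def by blast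
qed

lemma rep_space_eqI:
  assumes "X \<in> rep_space Q d" "Y \<in> rep_space Q d" "\<And>e. e \<in> edges \<Longrightarrow> X e 0 0 = Y e 0 0"
  shows "X = Y"
proof (intro ext)
  fix e i j
  show "X e i j = Y e i j"
    using assms unfolding rep_space_iff by metis
qed

definition mk_rep :: "(level_arc \<Rightarrow> complex) \<Rightarrow> level_arc rep" where
  "mk_rep x = (\<lambda>e. if e \<in> edges then scalar_mat (x e) else 0)"

lemma mk_rep_in: "mk_rep x \<in> rep_space Q d"
  unfolding rep_space_iff
proof (intro allI impI)
  fix e i j
  assume nz: "mk_rep x e i j \<noteq> 0"
  show "e \<in> edges \<and> i = 0 \<and> j = 0"
  proof (rule ccontr)
    assume "\<not> (e \<in> edges \<and> i = 0 \<and> j = 0)"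
    then have "mk_rep x e i j = 0"
      by (cases "e \<in> edges") (auto simp: mk_rep_def scalar_mat_def)
    then show False
      using nz by simp
  qed
qed

lemma mk_rep_entry [simp]:
  assumes "e \<in> edges"
  shows "mk_rep x e 0 0 = x e"
proof -
  have "mk_rep x e = scalar_mat (x e)"
    using assms by (simp only: mk_rep_def if_True)
  then show ?thesis
    by (simp only: scalar_mat_def simp_thms if_True)
qed

text \<open>Base change by a product of groups \<open>GL 1\<close> is the action of a torus. Scalars
  at vertices outside \<open>nodes\<close> do not occur in the equations, so they can be set to 1 to
  have \<open>g\<close> nonzero everywhere.\<close>

lemma rep_iso_iff:
  assumes X: "X \<in> rep_space Q d" and Y: "Y \<in> rep_space Q d"
  shows "rep_iso Q d X Y \<longleftrightarrow> (\<exists>g. (\<forall>v. g v \<noteq> 0) \<and>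
    (\<forall>e\<in>edges. Y e 0 0 * g (tail Q e) = g (head Q e) * X e 0 0))"
proof
  assume "rep_iso Q d X Y"
  then obtain G where G: "\<And>v. v \<in> verts Q \<Longrightarrow> G v \<in> GL (d v)"
    and eq: "\<And>e. e \<in> arcs Q \<Longrightarrow> mat_mul (d (tail Q e)) (Y e) (G (tail Q e)) = mat_mul (d (head Q e)) (G (head Q e)) (X e)"
    unfolding rep_iso_def by blast
  define g where "g v = (if v \<in> nodes then G v 0 0 else 1)" for v
  have "g v \<noteq> 0" for v
    using G[of v] GL_1_entry[of "G v"] d_eq_1[of v] nodes_verts by (auto simp: g_def)
  moreover have "Y e 0 0 * g (tail Q e) = g (head Q e) * X e 0 0" if e: "e \<in> edges" for e
  proof -
    have "d (tail Q e) = 1" "d (head Q e) = 1" and n: "tail Q e \<in> nodes" "head Q e \<in> nodes" and "e \<in> arcs Q"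
      using e d_eq_1 by (auto simp: edges_arcs)
    with eq[of e] have "mat_mul 1 (Y e) (G (tail Q e)) 0 0 = mat_mul 1 (G (head Q e)) (X e) 0 0"
      by simp
    then show ?thesis
      using n by (simp add: mat_mul_def g_def)
  qed
  ultimately show "\<exists>g. (\<forall>v. g v \<noteq> 0) \<and> (\<forall>e\<in>edges. Y e 0 0 * g (tail Q e) = g (head Q e) * X e 0 0)"
    by blast
next
  assume "\<exists>g. (\<forall>v. g v \<noteq> 0) \<and> (\<forall>e\<in>edges. Y e 0 0 * g (tail Q e) = g (head Q e) * X e 0 0)"
  then obtain g where g: "\<And>v. g v \<noteq> 0" "\<And>e. e \<in> edges \<Longrightarrow> Y e 0 0 * g (tail Q e) = g (head Q e) * X e 0 0"
    by blast
  define G where "G v = (if v \<in> nodes then scalar_mat (g v) else 0)" for v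
  show "rep_iso Q d X Y"
    unfolding rep_iso_def
  proof (intro exI[of _ G] conjI ballI)
    fix v
    show "G v \<in> GL (d v)"
      using scalar_mat_GL[OF g(1), of v] zero_GL_0 d_eq_1[of v] d_eq_0[of v]
      by (cases "v \<in> nodes") (simp_all add: G_def)
  next
    fix e
    assume e: "e \<in> arcs Q"
    show "mat_mul (d (tail Q e)) (Y e) (G (tail Q e)) = mat_mul (d (head Q e)) (G (head Q e)) (X e)"
    proof (cases "e \<in> edges")
      case True
      then have n: "tail Q e \<in> nodes" "head Q e \<in> nodes"
        by (auto simp: edges_arcs)
      then have d1: "d (tail Q e) = 1" "d (head Q e) = 1"
        by (simp_all only: d_eq_1)
      have X0: "X e i j = 0" "Y e i j = 0" if "i \<noteq> 0 \<or> j \<noteq> 0" for i j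
        using X[unfolded rep_space_iff, rule_format, of e i j] Y[unfolded rep_space_iff, rule_format, of e i j] that
        by blast+
      have G: "G (tail Q e) = scalar_mat (g (tail Q e))" "G (head Q e) = scalar_mat (g (head Q e))"
        using n by (simp_all add: G_def)
      show ?thesis
        unfolding d1 G
      proof (intro ext)
        fix i j
        show "mat_mul 1 (Y e) (scalar_mat (g (tail Q e))) i j = mat_mul 1 (scalar_mat (g (head Q e))) (X e) i j"
          using g(2)[OF True] X0[of i 0] X0[of 0 j]
          by (cases "i = 0"; cases "j = 0") (simp_all add: mat_mul_def scalar_mat_def)
      qed
    next
      case False
      then have "X e i j = 0" "Y e i j = 0" for i j
        using X[unfolded rep_space_iff, rule_format, of e i j] Y[unfolded rep_space_iff, rule_format, of e i j]
        by blast+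
      then show ?thesis
        by (simp add: mat_mul_def)
    qed
  qed
qed

lemma rep_iso_refl:
  assumes "X \<in> rep_space Q d"
  shows "rep_iso Q d X X"
proof -
  have "\<exists>g. (\<forall>v. g v \<noteq> 0) \<and> (\<forall>e\<in>edges. X e 0 0 * g (tail Q e) = g (head Q e) * X e 0 0)"
    by (rule exI[of _ "\<lambda>_. 1"]) simp
  then show ?thesis
    by (simp only: rep_iso_iff[OF assms assms])
qed

lemma rep_iso_sym:
  assumes "X \<in> rep_space Q d" "Y \<in> rep_space Q d" "rep_iso Q d X Y"
  shows "rep_iso Q d Y X"
proof -
  obtain g where g: "\<And>v. g v \<noteq> 0" "\<And>e. e \<in> edges \<Longrightarrow> Y e 0 0 * g (tail Q e) = g (head Q e) * X e 0 0"
    using assms(3) unfolding rep_iso_iff[OF assms(1,2)] by blast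
  have "X e 0 0 * inverse (g (tail Q e)) = inverse (g (head Q e)) * Y e 0 0" if "e \<in> edges" for e
    using g(2)[OF that] g(1)[of "tail Q e"] g(1)[of "head Q e"] by (simp add: field_simps)
  then show ?thesis
    unfolding rep_iso_iff[OF assms(2,1)] using g(1) by (intro exI[of _ "\<lambda>v. inverse (g v)"]) simp
qed

lemma rep_iso_trans:
  assumes "X \<in> rep_space Q d" "Y \<in> rep_space Q d" "Z \<in> rep_space Q d" "rep_iso Q d X Y" "rep_iso Q d Y Z"
  shows "rep_iso Q d X Z"
proof -
  obtain g where g: "\<And>v. g v \<noteq> 0" "\<And>e. e \<in> edges \<Longrightarrow> Y e 0 0 * g (tail Q e) = g (head Q e) * X e 0 0"
    using assms(4) unfolding rep_iso_iff[OF assms(1,2)] by blast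
  obtain h where h: "\<And>v. h v \<noteq> 0" "\<And>e. e \<in> edges \<Longrightarrow> Z e 0 0 * h (tail Q e) = h (head Q e) * Y e 0 0"
    using assms(5) unfolding rep_iso_iff[OF assms(2,3)] by blast
  have "Z e 0 0 * (g (tail Q e) * h (tail Q e)) = (g (head Q e) * h (head Q e)) * X e 0 0" if "e \<in> edges" for e
  proof -
    have "Z e 0 0 * (g (tail Q e) * h (tail Q e)) = Z e 0 0 * h (tail Q e) * g (tail Q e)"
      by simp
    also have "\<dots> = h (head Q e) * (Y e 0 0 * g (tail Q e))"
      by (simp add: h(2)[OF that])
    finally show ?thesis
      by (simp add: g(2)[OF that])
  qed
  then show ?thesis
    unfolding rep_iso_iff[OF assms(1,3)] using g(1) h(1) by (intro exI[of _ "\<lambda>v. g v * h v"]) simp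
qed

lemma iso_class_eq_iff:
  assumes "X \<in> rep_space Q d" "Y \<in> rep_space Q d"
  shows "iso_class Q d X = iso_class Q d Y \<longleftrightarrow> rep_iso Q d X Y"
proof
  assume "iso_class Q d X = iso_class Q d Y"
  then show "rep_iso Q d X Y"
    using assms rep_iso_refl by (auto simp: iso_class_def)
next
  assume "rep_iso Q d X Y"
  then show "iso_class Q d X = iso_class Q d Y"
    using assms rep_iso_sym rep_iso_trans unfolding iso_class_def by blast
qed

definition nonzero_on :: "level_arc set \<Rightarrow> level_arc rep set" where
  "nonzero_on S = {X \<in> rep_space Q d. \<forall>e\<in>S. X e 0 0 \<noteq> 0}"

lemma nonzero_on_iso:
  assumes "X \<in> nonzero_on S" "Y \<in> rep_space Q d" "rep_iso Q d X Y" "S \<subseteq> edges"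
  shows "Y \<in> nonzero_on S"
proof -
  have X: "X \<in> rep_space Q d"
    using assms by (simp add: nonzero_on_def)
  obtain g where g: "\<And>v. g v \<noteq> 0" "\<And>e. e \<in> edges \<Longrightarrow> Y e 0 0 * g (tail Q e) = g (head Q e) * X e 0 0"
    using assms(3) unfolding rep_iso_iff[OF X assms(2)] by blast
  have "Y e 0 0 \<noteq> 0" if "e \<in> S" for e
  proof
    assume "Y e 0 0 = 0"
    then have "g (head Q e) * X e 0 0 = 0"
      using g(2)[of e] that assms(4) by auto
    then show False
      using g(1)[of "head Q e"] assms(1) that by (auto simp: nonzero_on_def)
  qed
  then show ?thesis
    using assms(2) by (simp add: nonzero_on_def)
qed

text \<open>Normal forms for the representations in \<open>nonzero_on S\<close>, the tree arrows
  being scaled to 1. The punctured planes of this box are the coordinates in \<open>S - T\<close>;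
  the other factors are points or planes.\<close>

definition slice :: "level_arc set \<Rightarrow> level_arc set \<Rightarrow> level_arc \<Rightarrow> complex set" where
  "slice T S e = (if e \<in> T then {1} else if e \<in> S then - {0} else if e \<in> edges then UNIV else {0})"

lemma continuous_entry: "continuous_on UNIV (\<lambda>X :: level_arc rep. X e 0 0)"
  by (rule continuous_on_product_then_coordinatewise[OF
        continuous_on_product_then_coordinatewise[OF continuous_on_product_coordinates]])

lemma continuous_mk_rep: "continuous_on UNIV mk_rep"
proof (intro continuous_on_coordinatewise_then_product)
  fix e i j
  have "continuous_on UNIV (\<lambda>x :: level_arc \<Rightarrow> complex. x e)"
    by (rule continuous_on_product_coordinates)
  then show "continuous_on UNIV (\<lambda>x. mk_rep x e i j)"
    by (cases "e \<in> edges"; cases "i = 0"; cases "j = 0") (simp_all add: mk_rep_def scalar_mat_def)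
qed

text \<open>An isomorphism that respects the normalisation has equal scalars at both ends of every
  tree arrow, hence the same scalar at all nodes, and a common scalar acts trivially.\<close>

lemma slice_rigid:
  assumes T: "span_tree (tail Q) (head Q) nodes T" "T \<subseteq> edges"
    and X: "X \<in> rep_space Q d" "\<And>e. e \<in> T \<Longrightarrow> X e 0 0 = 1"
    and Y: "Y \<in> rep_space Q d" "\<And>e. e \<in> T \<Longrightarrow> Y e 0 0 = 1"
    and iso: "rep_iso Q d X Y"
  shows "X = Y"
proof -
  obtain g where g: "\<And>v. g v \<noteq> 0" "\<And>e. e \<in> edges \<Longrightarrow> Y e 0 0 * g (tail Q e) = g (head Q e) * X e 0 0"
    using iso unfolding rep_iso_iff[OF X(1) Y(1)] by blast
  have "g (tail Q e) = g (head Q e)" if "e \<in> T" for e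
    using g(2)[of e] X(2)[OF that] Y(2)[OF that] T(2) that by auto
  then obtain c where c: "\<forall>v\<in>nodes. g v = c"
    using span_tree_constant[OF T(1), of g] by blast
  have "X e 0 0 = Y e 0 0" if "e \<in> edges" for e
  proof -
    have "g (tail Q e) = c" "g (head Q e) = c"
      using that c by (auto simp: edges_arcs)
    then show ?thesis
      using g(2)[OF that] g(1)[of "tail Q e"] by (simp add: mult.commute)
  qed
  then show ?thesis
    by (rule rep_space_eqI[OF X(1) Y(1)])
qed

text \<open>The normalisation along \<open>T\<close> depends continuously on the representation,
  which later makes the inverse of the chart map continuous.\<close>

lemma gauge_fixing:
  assumes T: "span_tree (tail Q) (head Q) nodes T" "T \<subseteq> S" "S \<subseteq> edges"
  obtains \<nu> where "continuous_on (nonzero_on S) \<nu>" "\<And>X. X \<in> nonzero_on S \<Longrightarrow> \<nu> X \<in> coord_box (slice T S)"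
    "\<And>X. X \<in> nonzero_on S \<Longrightarrow> rep_iso Q d X (mk_rep (\<nu> X))"
proof -
  obtain \<gamma> where \<gamma>: "\<And>D. (\<forall>e\<in>T. \<forall>X\<in>D. (X :: level_arc rep) e 0 0 \<noteq> 0) \<Longrightarrow>
    (\<forall>v\<in>nodes. continuous_on D (\<gamma> v) \<and> (\<forall>X\<in>D. \<gamma> v X \<noteq> 0)) \<and>
    (\<forall>e\<in>T. \<forall>X\<in>D. \<gamma> (head Q e) X * X e 0 0 = \<gamma> (tail Q e) X)"
    using span_tree_gauge[OF T(1), of "\<lambda>e X. X e 0 0", OF continuous_entry] by blast
  let ?D = "nonzero_on S"
  have "\<forall>e\<in>T. \<forall>X\<in>?D. X e 0 0 \<noteq> 0"
    using T(2) by (auto simp: nonzero_on_def)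
  note \<gamma> = \<gamma>[OF this]
  have cont: "continuous_on ?D (\<gamma> v)" and nz: "\<And>X. X \<in> ?D \<Longrightarrow> \<gamma> v X \<noteq> 0" if "v \<in> nodes" for v
    using \<gamma> that by blast+
  have tree: "\<gamma> (head Q e) X * X e 0 0 = \<gamma> (tail Q e) X" if "e \<in> T" "X \<in> ?D" for e X
    using \<gamma> that by blast
  define \<nu> where "\<nu> X e = (if e \<in> edges then \<gamma> (head Q e) X * X e 0 0 / \<gamma> (tail Q e) X else 0)" for X e
  have ends: "tail Q e \<in> nodes" "head Q e \<in> nodes" if "e \<in> edges" for e
    using that by (auto simp: edges_arcs)
  show ?thesis
  proof
    show "continuous_on ?D \<nu>"
    proof (rule continuous_on_coordinatewise_then_product)
      fix e
      have "continuous_on ?D (\<lambda>X. X e 0 0)"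
        by (rule continuous_on_subset[OF continuous_entry]) simp
      then have "continuous_on ?D (\<lambda>X. \<gamma> (head Q e) X * X e 0 0 / \<gamma> (tail Q e) X)" if "e \<in> edges"
        using cont nz ends[OF that] by (intro continuous_intros) auto
      then show "continuous_on ?D (\<lambda>X. \<nu> X e)"
        by (cases "e \<in> edges") (simp_all add: \<nu>_def)
    qed
    show "\<nu> X \<in> coord_box (slice T S)" if X: "X \<in> ?D" for X
    proof -
      have "\<nu> X e = 1" if "e \<in> T" for e
        using tree[OF that X] nz[OF ends(1) X, of e] that T by (auto simp: \<nu>_def)
      moreover have "\<nu> X e \<noteq> 0" if "e \<in> S" for e
        using nz[OF ends(1) X, of e] nz[OF ends(2) X, of e] that T X by (auto simp: \<nu>_def nonzero_on_def)
      ultimately show ?thesis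
        by (auto simp: coord_box_def slice_def \<nu>_def)
    qed
    show "rep_iso Q d X (mk_rep (\<nu> X))" if X: "X \<in> ?D" for X
    proof -
      have XR: "X \<in> rep_space Q d"
        using X by (simp add: nonzero_on_def)
      define g where "g v = (if v \<in> nodes then \<gamma> v X else 1)" for v
      have "g v \<noteq> 0" for v
        using nz X by (simp add: g_def)
      moreover have "mk_rep (\<nu> X) e 0 0 * g (tail Q e) = g (head Q e) * X e 0 0" if "e \<in> edges" for e
        using that ends[OF that] nz[OF ends(1)[OF that] X] by (simp add: g_def \<nu>_def)
      ultimately show ?thesis
        unfolding rep_iso_iff[OF XR mk_rep_in] by blast
    qed
  qed
qed

section \<open>Charts of the moduli space\<close>

definition stable_locus :: "level_arc rep set" where
  "stable_locus = {X. stable_rep Q level_slope d X}"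

abbreviation M where "M \<equiv> stable_moduli Q level_slope d"

definition chart :: "level_arc set \<Rightarrow> level_arc rep set set" where
  "chart S = iso_class Q d ` nonzero_on S"

lemma stable_locus_sub: "stable_locus \<subseteq> rep_space Q d"
  by (auto simp: stable_locus_def stable_rep_def)

lemma M_eq: "M = quotient_topology (top_of_set stable_locus) (iso_class Q d)"
  by (simp add: stable_moduli_def stable_locus_def)

lemma topspace_M: "topspace M = iso_class Q d ` stable_locus"
  by (simp add: M_eq)

text \<open>Whether an arrow acts by zero depends only on the isomorphism class, so one
  representative serves for both charts.\<close>

lemma chart_Un:
  assumes "S \<subseteq> edges" "T \<subseteq> edges"
  shows "chart (S \<union> T) = chart S \<inter> chart T"
proof
  show "chart (S \<union> T) \<subseteq> chart S \<inter> chart T"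
    by (auto simp: chart_def nonzero_on_def)
  show "chart S \<inter> chart T \<subseteq> chart (S \<union> T)"
  proof
    fix c
    assume "c \<in> chart S \<inter> chart T"
    then obtain X Y where X: "X \<in> nonzero_on S" "c = iso_class Q d X" and Y: "Y \<in> nonzero_on T" "c = iso_class Q d Y"
      by (auto simp: chart_def)
    then have R: "X \<in> rep_space Q d" "Y \<in> rep_space Q d"
      by (auto simp: nonzero_on_def)
    then have "rep_iso Q d Y X"
      using X Y by (simp flip: iso_class_eq_iff)
    then have "X \<in> nonzero_on T"
      using nonzero_on_iso Y R assms by blast
    then have "X \<in> nonzero_on (S \<union> T)"
      using X by (auto simp: nonzero_on_def)
    then show "c \<in> chart (S \<union> T)"
      using X by (auto simp: chart_def)
  qed
qed

lemma chart_preimage: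
  assumes "S \<subseteq> edges" "nonzero_on S \<subseteq> stable_locus"
  shows "{X \<in> stable_locus. iso_class Q d X \<in> chart S} = nonzero_on S"
proof
  show "nonzero_on S \<subseteq> {X \<in> stable_locus. iso_class Q d X \<in> chart S}"
    using assms by (auto simp: chart_def)
  show "{X \<in> stable_locus. iso_class Q d X \<in> chart S} \<subseteq> nonzero_on S"
  proof clarify
    fix X
    assume X: "X \<in> stable_locus" "iso_class Q d X \<in> chart S"
    then obtain Y where Y: "Y \<in> nonzero_on S" "iso_class Q d X = iso_class Q d Y"
      by (auto simp: chart_def)
    then have R: "X \<in> rep_space Q d" "Y \<in> rep_space Q d"
      using X stable_locus_sub by (auto simp: nonzero_on_def)
    then have "rep_iso Q d Y X"
      using Y by (simp flip: iso_class_eq_iff)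
    then show "X \<in> nonzero_on S"
      using nonzero_on_iso Y R assms by blast
  qed
qed

lemma openin_chart:
  assumes "S \<subseteq> edges" "nonzero_on S \<subseteq> stable_locus"
  shows "openin M (chart S)"
  unfolding M_eq openin_quotient_topology
proof
  show "chart S \<subseteq> iso_class Q d ` topspace (top_of_set stable_locus)"
    using assms by (auto simp: chart_def)
  have fin: "finite S"
    using assms finite_edges finite_subset by blast
  have "open (\<Inter>e\<in>S. (\<lambda>X :: level_arc rep. X e 0 0) -` (- {0}))"
    using fin by (intro open_INT ballI open_vimage continuous_entry) auto
  moreover have "nonzero_on S = stable_locus \<inter> (\<Inter>e\<in>S. (\<lambda>X. X e 0 0) -` (- {0}))"
    using assms stable_locus_sub by (auto simp: nonzero_on_def)
  ultimately have "openin (top_of_set stable_locus) (nonzero_on S)"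
    by (metis openin_open_Int)
  then show "openin (top_of_set stable_locus) {x \<in> topspace (top_of_set stable_locus). iso_class Q d x \<in> chart S}"
    using chart_preimage[OF assms] by simp
qed

text \<open>Each class in the chart has exactly one representative in the slice: existence is
  \<open>gauge_fixing\<close>, uniqueness is \<open>slice_rigid\<close>. The inverse is continuous
  because \<open>\<nu>\<close> is constant on classes and the projection remains a quotient map on
  the open saturated set \<open>nonzero_on S\<close>.\<close>

lemma chart_homeomorphic:
  assumes T: "span_tree (tail Q) (head Q) nodes T" "T \<subseteq> S" "S \<subseteq> edges" and st: "nonzero_on S \<subseteq> stable_locus"
  shows "top_of_set (coord_box (slice T S)) homeomorphic_space subtopology M (chart S)"
proof -
  let ?q = "iso_class Q d" and ?B = "coord_box (slice T S)"
  obtain \<nu> where \<nu>_cont: "continuous_on (nonzero_on S) \<nu>" and \<nu>_box: "\<And>X. X \<in> nonzero_on S \<Longrightarrow> \<nu> X \<in> ?B"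
    and \<nu>_iso: "\<And>X. X \<in> nonzero_on S \<Longrightarrow> rep_iso Q d X (mk_rep (\<nu> X))"
    using gauge_fixing[OF T] by blast
  have NR: "X \<in> rep_space Q d" if "X \<in> nonzero_on S" for X
    using that by (simp add: nonzero_on_def)
  have box1: "x e = 1" if "x \<in> ?B" "e \<in> T" for x e
  proof -
    have "x e \<in> slice T S e"
      using that(1) unfolding coord_box_def by blast
    then show ?thesis
      using that(2) by (simp add: slice_def)
  qed
  have box_out: "x e = 0" if "x \<in> ?B" "e \<notin> edges" for x e
  proof -
    have "x e \<in> slice T S e"
      using that(1) unfolding coord_box_def by blast
    moreover have "e \<notin> T" "e \<notin> S"
      using that(2) T(2,3) by auto
    ultimately show ?thesis
      using that(2) by (simp add: slice_def)
  qed
  have box_S: "x e \<noteq> 0" if "x \<in> ?B" "e \<in> S" for x e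
  proof -
    have "x e \<in> slice T S e"
      using that(1) unfolding coord_box_def by blast
    then show ?thesis
      using that(2) by (cases "e \<in> T") (simp_all add: slice_def)
  qed
  have mk: "mk_rep x \<in> nonzero_on S" if "x \<in> ?B" for x
    using box_S[OF that] mk_rep_in T by (auto simp: nonzero_on_def subset_iff)
  have mk_inj: "x = y" if "x \<in> ?B" "y \<in> ?B" "rep_iso Q d (mk_rep x) (mk_rep y)" for x y
  proof -
    have "mk_rep x = mk_rep y"
      using T box1[OF that(1)] box1[OF that(2)] that(3)
      by (intro slice_rigid[OF T(1)] mk_rep_in) (auto simp: subset_iff)
    then have "x e = y e" for e
      using mk_rep_entry[of e x] mk_rep_entry[of e y] box_out[OF that(1), of e] box_out[OF that(2), of e]
      by (cases "e \<in> edges") auto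
    then show ?thesis
      by (rule ext)
  qed
  have \<nu>_eq: "\<nu> X = \<nu> Y" if "X \<in> nonzero_on S" "Y \<in> nonzero_on S" "?q X = ?q Y" for X Y
  proof (rule mk_inj)
    have XY: "rep_iso Q d X Y"
      using that NR by (simp flip: iso_class_eq_iff)
    have "rep_iso Q d (mk_rep (\<nu> X)) X"
      using \<nu>_iso[OF that(1)] NR[OF that(1)] mk_rep_in rep_iso_sym by blast
    then show "rep_iso Q d (mk_rep (\<nu> X)) (mk_rep (\<nu> Y))"
      using XY \<nu>_iso[OF that(2)] NR that mk_rep_in rep_iso_trans by meson
  qed (use that \<nu>_box in auto)
  have quot: "quotient_map (top_of_set (nonzero_on S)) (subtopology M (chart S)) ?q"
  proof -
    have "quotient_map (subtopology (top_of_set stable_locus) (nonzero_on S)) (subtopology M (chart S)) ?q"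
    proof (rule quotient_map_restriction)
      show "quotient_map (top_of_set stable_locus) M ?q"
        unfolding M_eq by (rule quotient_map_quotient_topology)
    qed (use chart_preimage[OF T(3) st] openin_chart[OF T(3) st] in auto)
    then show ?thesis
      using st by (simp add: subtopology_subtopology Int_absorb1)
  qed
  define g where "g c = \<nu> (SOME X. X \<in> nonzero_on S \<and> ?q X = c)" for c
  have gq: "g (?q X) = \<nu> X" if "X \<in> nonzero_on S" for X
  proof -
    have "\<exists>Y. Y \<in> nonzero_on S \<and> ?q Y = ?q X"
      using that by blast
    from someI_ex[OF this] show ?thesis
      unfolding g_def using \<nu>_eq that by blast
  qed
  have topc: "topspace (subtopology M (chart S)) = chart S"
    using openin_subset[OF openin_chart[OF T(3) st]] by auto
  have "continuous_map (top_of_set (nonzero_on S)) (top_of_set ?B) \<nu>"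
    using \<nu>_cont \<nu>_box by (auto simp: continuous_map_in_subtopology)
  then have "continuous_map (top_of_set (nonzero_on S)) (top_of_set ?B) (g \<circ> ?q)"
    by (rule continuous_map_eq) (simp add: gq)
  then have g_cont: "continuous_map (subtopology M (chart S)) (top_of_set ?B) g"
    by (rule continuous_compose_quotient_map[OF quot])
  have "continuous_on ?B mk_rep"
    by (rule continuous_on_subset[OF continuous_mk_rep]) simp
  then have "continuous_map (top_of_set ?B) (top_of_set (nonzero_on S)) mk_rep"
    using mk by (auto simp: continuous_map_in_subtopology)
  then have f_cont: "continuous_map (top_of_set ?B) (subtopology M (chart S)) (?q \<circ> mk_rep)"
    by (rule continuous_map_compose[OF _ quotient_imp_continuous_map[OF quot]])
  have "g ((?q \<circ> mk_rep) x) = x" if "x \<in> ?B" for x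
  proof -
    have "rep_iso Q d (mk_rep (\<nu> (mk_rep x))) (mk_rep x)"
      using \<nu>_iso[OF mk[OF that]] rep_iso_sym mk_rep_in by blast
    then have "\<nu> (mk_rep x) = x"
      using mk_inj \<nu>_box[OF mk[OF that]] that by blast
    then show ?thesis
      using gq[OF mk[OF that]] by simp
  qed
  moreover have "(?q \<circ> mk_rep) (g c) = c" if "c \<in> chart S" for c
  proof -
    obtain X where X: "X \<in> nonzero_on S" "c = ?q X"
      using \<open>c \<in> chart S\<close> by (auto simp: chart_def)
    have "?q X = ?q (mk_rep (\<nu> X))"
      using \<nu>_iso[OF X(1)] iso_class_eq_iff[OF NR[OF X(1)] mk_rep_in] by blast
    then show ?thesis
      using gq[OF X(1)] X(2) by simp
  qed
  ultimately have "homeomorphic_maps (top_of_set ?B) (subtopology M (chart S)) (?q \<circ> mk_rep) g"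
    unfolding homeomorphic_maps_def using f_cont g_cont topc by simp
  then show ?thesis
    unfolding homeomorphic_space_def by blast
qed

text \<open>The torus factor has rank \<open>card (S - T)\<close> and a spanning tree has
  \<open>a + b - 1\<close> arrows, so the torus is trivial exactly when \<open>S\<close> has this
  size.\<close>

lemma has_euler_chart:
  assumes T: "span_tree (tail Q) (head Q) nodes T" "T \<subseteq> S" "S \<subseteq> edges" and st: "nonzero_on S \<subseteq> stable_locus"
  shows "has_euler (subtopology M (chart S)) (if card S = a + b - 1 then 1 else 0)"
proof -
  have fin: "finite S"
    using T finite_edges finite_subset by blast
  have "has_euler (top_of_set (coord_box (slice T S))) (if S - T = {} then 1 else 0)"
  proof (rule has_euler_coord_box[where c = "\<lambda>e. if e \<in> T then 1 else 0"])
    show "star_about (slice T S e) (if e \<in> T then 1 else 0)" if "e \<notin> S - T" for e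
      using that by (auto simp: star_about_def slice_def)
    show "slice T S e = - {0}" if "e \<in> S - T" for e
      using that by (simp add: slice_def)
  qed (use fin in simp)
  moreover have "S - T = {} \<longleftrightarrow> card S = a + b - 1"
  proof -
    have "card T = a + b - 1"
      using span_tree_card[OF T(1)] card_nodes by simp
    then show ?thesis
      using T(2) fin card_subset_eq[OF fin T(2)] by auto
  qed
  ultimately show ?thesis
    using has_euler_homeomorphic[OF chart_homeomorphic[OF assms]] by simp
qed

text \<open>The Euler characteristic counts the torus fixed points: only the charts given by the stable
  trees themselves contribute, as every larger intersection of charts has a torus factor.\<close>
proposition has_euler_moduli:
  assumes trees: "\<And>T. T \<in> \<T> \<Longrightarrow> span_tree (tail Q) (head Q) nodes T \<and> T \<subseteq> edges \<and> nonzero_on T \<subseteq> stable_locus"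
    and cover: "\<And>X. X \<in> stable_locus \<Longrightarrow> \<exists>T\<in>\<T>. X \<in> nonzero_on T"
  shows "has_euler M (int (card \<T>))"
proof -
  \<comment> \<open>All sets of arrows that contain one of the trees: they are closed under unions,
    and each defines a chart inside the stable locus.\<close>
  define \<C> where "\<C> = {S. S \<subseteq> edges \<and> (\<exists>T\<in>\<T>. T \<subseteq> S)}"
  have C: "S \<subseteq> edges" "nonzero_on S \<subseteq> stable_locus" "\<exists>T\<in>\<T>. T \<subseteq> S" if "S \<in> \<C>" for S
  proof -
    show "S \<subseteq> edges" and ex: "\<exists>T\<in>\<T>. T \<subseteq> S"
      using that by (auto simp: \<C>_def)
    then show "nonzero_on S \<subseteq> stable_locus"
      using trees by (fastforce simp: nonzero_on_def)
  qed
  have cardT: "card T = a + b - 1" if "T \<in> \<T>" for T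
    using span_tree_card[of "tail Q" "head Q" nodes T] trees[OF that] card_nodes by simp
  have fin: "finite \<T>"
  proof (rule finite_subset)
    show "\<T> \<subseteq> Pow edges"
      using trees by auto
  qed (use finite_edges in auto)
  \<comment> \<open>Intersecting with \<open>edges\<close> makes the rule for unions hold for
    arbitrary index sets, as \<open>has_euler_Union_family\<close> demands; on \<open>\<C>\<close>
    it changes nothing.\<close>
  let ?U = "\<lambda>S. chart (S \<inter> edges)"
  have "has_euler (subtopology M (\<Union>(?U ` \<T>))) (int (card {S \<in> \<T>. card S = a + b - 1}))"
  proof (rule has_euler_Union_family[where \<C> = \<C>])
    show "openin M (?U S)" if "S \<in> \<C>" for S
      using C[OF that] openin_chart by (simp add: Int_absorb2)
    show "?U (S \<union> T) = ?U S \<inter> ?U T" for S T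
      using chart_Un[of "S \<inter> edges" "T \<inter> edges"] by (simp add: Int_Un_distrib2)
    show "S \<union> T \<in> \<C>" if "S \<in> \<C>" "T \<in> \<C>" for S T
      using that by (auto simp: \<C>_def)
    show "finite S \<and> a + b - 1 \<le> card S" if S: "S \<in> \<C>" for S
    proof -
      have "finite S"
        using C(1)[OF S] finite_edges finite_subset by blast
      moreover obtain T where "T \<in> \<T>" "T \<subseteq> S"
        using C(3)[OF S] by blast
      ultimately show ?thesis
        using cardT card_mono by metis
    qed
    show "has_euler (subtopology M (?U S)) (if card S = a + b - 1 then 1 else 0)" if S: "S \<in> \<C>" for S
    proof -
      obtain T where T: "T \<in> \<T>" "T \<subseteq> S"
        using C(3)[OF S] by blast
      show ?thesis
        using has_euler_chart[of T S] trees[OF T(1)] T(2) C(1,2)[OF S] by (simp add: Int_absorb2)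
    qed
    show "\<T> \<subseteq> \<C>"
      using trees by (auto simp: \<C>_def)
  qed (rule fin)
  moreover have "{S \<in> \<T>. card S = a + b - 1} = \<T>"
    using cardT by auto
  moreover have "\<Union>(?U ` \<T>) = topspace M"
  proof
    show "\<Union>(?U ` \<T>) \<subseteq> topspace M"
      using trees by (fastforce simp: chart_def topspace_M Int_absorb2)
    show "topspace M \<subseteq> \<Union>(?U ` \<T>)"
    proof
      fix c
      assume "c \<in> topspace M"
      then obtain X where X: "X \<in> stable_locus" "c = iso_class Q d X"
        by (auto simp: topspace_M)
      then obtain T where "T \<in> \<T>" "X \<in> nonzero_on T"
        using cover by blast
      then show "c \<in> \<Union>(?U ` \<T>)"
        using X trees by (auto simp: chart_def Int_absorb2 intro!: bexI[of _ T])
    qed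
  qed
  ultimately show ?thesis
    by simp
qed

end

section \<open>Stability and spanning trees\<close>

context trivial_moduli
begin

definition nbrs :: "level_arc set \<Rightarrow> nat set \<Rightarrow> nat set" where
  "nbrs F A = {t. \<exists>s\<in>A. \<exists>r. edge s t r \<in> F}"

definition support :: "level_arc rep \<Rightarrow> level_arc set" where
  "support X = {e \<in> edges. X e 0 0 \<noteq> 0}"

lemma nbrs_sub:
  assumes F: "F \<subseteq> edges"
  shows "nbrs F A \<subseteq> {1..b}"
proof
  fix t
  assume "t \<in> nbrs F A"
  then obtain s r where "edge s t r \<in> F"
    by (auto simp: nbrs_def)
  then have "edge s t r \<in> edges"
    using F by blast
  then show "t \<in> {1..b}"
    by simp
qed

lemma level_slope_01:
  assumes A: "A \<subseteq> {1..a}" and B: "B \<subseteq> {1..b}"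
    and f1: "\<And>v. v \<in> Source 1 ` A \<union> Sink 1 ` B \<Longrightarrow> f v = 1"
    and f0: "\<And>v. v \<notin> Source 1 ` A \<union> Sink 1 ` B \<Longrightarrow> f v = 0"
  shows "level_slope f = real (card A) / (real (card A) + real (card B))"
proof -
  have fin: "finite A" "finite B"
    using A B finite_subset by blast+
  have sup: "{v. f v \<noteq> 0} = Source 1 ` A \<union> Sink 1 ` B"
    using f1 f0 by (metis (mono_tags, lifting) Collect_mem_eq Collect_cong zero_neq_one)
  then have src: "{v. is_source v \<and> f v \<noteq> 0} = Source 1 ` A"
    by auto
  have one: "real (level v * f v) = 1" if "v \<in> Source 1 ` A \<union> Sink 1 ` B" for v
    using f1[OF that] that by auto
  have "(\<Sum>v | is_source v \<and> f v \<noteq> 0. real (level v * f v)) = (\<Sum>v\<in>Source 1 ` A. 1)"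
    unfolding src using one by (intro sum.cong) auto
  also have "\<dots> = real (card A)"
    by (simp add: card_image inj_on_def)
  finally have num: "(\<Sum>v | is_source v \<and> f v \<noteq> 0. real (level v * f v)) = real (card A)" .
  have "(\<Sum>v | f v \<noteq> 0. real (level v * f v)) = (\<Sum>v\<in>Source 1 ` A \<union> Sink 1 ` B. 1)"
    unfolding sup using one by (intro sum.cong) auto
  also have "\<dots> = real (card (Source 1 ` A \<union> Sink 1 ` B))"
    by simp
  also have "card (Source 1 ` A \<union> Sink 1 ` B) = card A + card B"
    using fin by (subst card_Un_disjoint) (auto simp: card_image inj_on_def)
  finally have "(\<Sum>v | f v \<noteq> 0. real (level v * f v)) = real (card A) + real (card B)"
    by simp
  with num show ?thesis
    by (simp add: level_slope_def)
qed

lemma level_slope_d: "level_slope d = real a / (real a + real b)"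
proof -
  have "level_slope d = real (card {1..a}) / (real (card {1..a}) + real (card {1..b}))"
  proof (rule level_slope_01)
    show "d v = 1" if "v \<in> Source 1 ` {1..a} \<union> Sink 1 ` {1..b}" for v
      using that d_eq_1[of v] by (simp only: nodes_def)
    show "d v = 0" if "v \<notin> Source 1 ` {1..a} \<union> Sink 1 ` {1..b}" for v
      using that by (simp only: d_eq_0 nodes_def not_False_eq_True)
  qed auto
  then show ?thesis
    by simp
qed

lemma slope_less_iff:
  assumes "x > 0 \<or> y > (0::nat)"
  shows "real x / (real x + real y) < real a / (real a + real b) \<longleftrightarrow> x * b < a * y"
proof -
  have "real x + real y > 0" "real a + real b > 0"
    using assms a by linarith+
  then have "real x / (real x + real y) < real a / (real a + real b) \<longleftrightarrow>
      real x * (real a + real b) < real a * (real x + real y)"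
    by (simp add: divide_less_eq less_divide_eq mult.commute frac_less_eq)
  also have "\<dots> \<longleftrightarrow> real (x * b) < real (a * y)"
    by (simp add: algebra_simps)
  finally show ?thesis
    by (simp only: of_nat_less_iff)
qed

lemma mult_less_imp:
  assumes "x * b < a * y" "x > 0"
  shows "k * x < y"
proof -
  have "a * (k * x) + x < a * y"
    using assms by (simp add: b_def algebra_simps)
  then have "a * (k * x) < a * y"
    by linarith
  then show ?thesis
    by simp
qed

text \<open>A subrepresentation is a set \<open>A\<close> of sources with a set \<open>B\<close> of
  sinks containing all neighbours of \<open>A\<close>, and for given \<open>A\<close> its slope is
  largest when \<open>B\<close> is as small as possible. For nonempty \<open>A\<close> with
  \<open>card A < a\<close> the inequality \<open>card A * (k * a + 1) < a * card B\<close> amounts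
  to \<open>k * card A < card B\<close>, as \<open>card A / a\<close> lies strictly between 0 and
  1.\<close>

lemma stable_iff:
  "stable_rep Q level_slope d X \<longleftrightarrow> X \<in> rep_space Q d \<and>
    (\<forall>A\<subseteq>{1..a}. A \<noteq> {} \<longrightarrow> k * card A < card (nbrs (support X) A))"
proof (cases "X \<in> rep_space Q d")
  case False
  then show ?thesis
    by (simp add: stable_rep_def)
next
  case X: True
  have supp: "support X \<subseteq> edges"
    by (auto simp: support_def)
  have entry0: "X e i j = 0" if "e \<notin> support X \<or> i \<noteq> 0 \<or> j \<noteq> 0" for e i j
    using X[unfolded rep_space_iff, rule_format, of e i j] that by (auto simp: support_def)
  have dpos: "\<exists>v\<in>verts Q. d v \<noteq> 0"
    using a by (intro bexI[of _ "Source 1 1"]) auto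
  have cvec01: "U v = {0} \<or> U v = cvec 1 \<and> v \<in> nodes" if "subrep Q d X U" for U v
  proof (cases "v \<in> verts Q")
    case True
    then have U: "fun_space.subspace (U v)" "U v \<subseteq> cvec (d v)"
      using that by (auto simp: subrep_def)
    show ?thesis
    proof (cases "v \<in> nodes")
      case True
      then have "d v = 1"
        by (simp only: d_eq_1)
      with U subspace_cvec_1[of "U v"] True show ?thesis
        by simp
    next
      case False
      then have "d v = 0"
        by (simp only: d_eq_0 not_False_eq_True)
      with U fun_space.subspace_0[OF U(1)] show ?thesis
        by (auto simp: cvec_0)
    qed
  qed (use that in \<open>auto simp: subrep_def\<close>)
  show ?thesis
  proof
    assume st: "stable_rep Q level_slope d X"
    have "k * card A < card (nbrs (support X) A)" if A: "A \<subseteq> {1..a}" "A \<noteq> {}" for A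
    proof -
      define N where "N = nbrs (support X) A"
      have N: "N \<subseteq> {1..b}"
        unfolding N_def by (rule nbrs_sub[OF supp])
      define W where "W = Source 1 ` A \<union> Sink 1 ` N"
      have Wn: "W \<subseteq> nodes"
        using A N by (auto simp: W_def nodes_def)
      \<comment> \<open>The subrepresentation generated by the sources in \<open>A\<close>;
        comparing its slope with that of \<open>d\<close> gives the bound.\<close>
      define U :: "level_vertex \<Rightarrow> (nat \<Rightarrow> complex) set" where "U v = (if v \<in> W then cvec 1 else {0})" for v
      have fin: "finite A" "finite N"
        using A N finite_subset by blast+
      have sub: "subrep Q d X U"
        unfolding subrep_def
      proof (intro conjI ballI allI impI)
        fix v
        show "fun_space.subspace (U v)"
          by (auto simp: U_def fun_space.subspace_def cvec_def fun_scale_def)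
        have "d v = 1" if "v \<in> W"
          using that Wn by (auto simp only: d_eq_1)
        then show "U v \<subseteq> cvec (d v)"
          by (auto simp: U_def cvec_def)
        assume "v \<notin> verts Q"
        then show "U v = {0}"
          using Wn nodes_verts by (auto simp: U_def)
      next
        fix e
        show "mat_app (d (tail Q e)) (X e) ` U (tail Q e) \<subseteq> U (head Q e)"
        proof clarify
          fix x
          assume x: "x \<in> U (tail Q e)"
          show "mat_app (d (tail Q e)) (X e) x \<in> U (head Q e)"
          proof (cases "e \<in> support X \<and> tail Q e \<in> W")
            case True
            then obtain s t r where e: "e = edge s t r" "e \<in> support X" "s \<in> A"
              using supp by (auto simp: edges_def W_def)
            then have "t \<in> N"
              by (auto simp: N_def nbrs_def)
            then have "head Q e \<in> W"
              using e by (simp add: W_def)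
            moreover have "mat_app (d (tail Q e)) (X e) x \<in> cvec 1"
              using entry0[of e] by (simp add: cvec_def mat_app_def)
            ultimately show ?thesis
              by (simp add: U_def)
          next
            case False
            have "mat_app (d (tail Q e)) (X e) x = 0"
            proof (cases "e \<in> support X")
              case True
              then have "x = 0"
                using x False by (auto simp: U_def split: if_splits)
              then show ?thesis
                by (auto simp: mat_app_def)
            next
              case False
              then show ?thesis
                using entry0[of e] by (auto simp: mat_app_def)
            qed
            then show ?thesis
              by (auto simp: U_def cvec_def)
          qed
        qed
      qed
      show ?thesis
      proof (cases "W = nodes")
        \<comment> \<open>If \<open>A\<close> generates everything, stability says nothing about
          \<open>U\<close>, but the bound reads \<open>k * a < k * a + 1\<close>.\<close>
        case True
        have "A = {1..a}"
        proof
          show "{1..a} \<subseteq> A"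
          proof
            fix s assume "s \<in> {1..a}"
            then have "Source 1 s \<in> W"
              unfolding True by (simp add: nodes_def)
            then show "s \<in> A"
              by (auto simp: W_def)
          qed
        qed (rule A)
        moreover have "N = {1..b}"
        proof
          show "{1..b} \<subseteq> N"
          proof
            fix t assume "t \<in> {1..b}"
            then have "Sink 1 t \<in> W"
              unfolding True by (simp add: nodes_def)
            then show "t \<in> N"
              by (auto simp: W_def)
          qed
        qed (rule N)
        ultimately show ?thesis
          by (fold N_def) (simp add: b_def)
      next
        case False
        then obtain v where v: "v \<in> nodes" "v \<notin> W"
          using Wn by auto
        then have "d v = 1"
          by (simp only: d_eq_1)
        then have "U v \<noteq> cvec (d v)"
          using v cvec_1_neq_zero by (simp add: U_def)
        moreover obtain s where "s \<in> A"
          using A by blast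
        then have s: "Source 1 s \<in> W"
          by (simp add: W_def)
        then have "U (Source 1 s) \<noteq> {0}"
          using cvec_1_neq_zero by (simp add: U_def)
        ultimately have "level_slope (dim_vec U) < level_slope d"
          using st sub v(1) s Wn nodes_verts unfolding stable_rep_def by blast
        moreover have "level_slope (dim_vec U) = real (card A) / (real (card A) + real (card N))"
        proof (rule level_slope_01[OF A(1) N])
          show "dim_vec U v = 1" if "v \<in> Source 1 ` A \<union> Sink 1 ` N" for v
            using that dim_cvec_1 unfolding dim_vec_def U_def W_def by simp
          show "dim_vec U v = 0" if "v \<notin> Source 1 ` A \<union> Sink 1 ` N" for v
            using that dim_zero_space unfolding dim_vec_def U_def W_def by simp
        qed
        moreover have "card A > 0"
          using A fin by (simp add: card_gt_0_iff)
        ultimately have "card A * b < a * card N"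
          using slope_less_iff level_slope_d by simp
        then show ?thesis
          using mult_less_imp \<open>card A > 0\<close> unfolding N_def by blast
      qed
    qed
    then show "X \<in> rep_space Q d \<and> (\<forall>A\<subseteq>{1..a}. A \<noteq> {} \<longrightarrow> k * card A < card (nbrs (support X) A))"
      using X by blast
  next
    assume "X \<in> rep_space Q d \<and> (\<forall>A\<subseteq>{1..a}. A \<noteq> {} \<longrightarrow> k * card A < card (nbrs (support X) A))"
    then have R: "k * card A < card (nbrs (support X) A)" if "A \<subseteq> {1..a}" "A \<noteq> {}" for A
      using that by blast
    have "level_slope (dim_vec U) < level_slope d"
      if U: "subrep Q d X U" and nz: "\<exists>v\<in>verts Q. U v \<noteq> {0}" and proper: "\<exists>v\<in>verts Q. U v \<noteq> cvec (d v)" for U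
    proof -
      note U01 = cvec01[OF U]
      define A where "A = {s \<in> {1..a}. U (Source 1 s) \<noteq> {0}}"
      define B where "B = {t \<in> {1..b}. U (Sink 1 t) \<noteq> {0}}"
      have AB: "A \<subseteq> {1..a}" "B \<subseteq> {1..b}"
        by (auto simp: A_def B_def)
      have fin: "finite A" "finite B"
        using AB finite_subset by blast+
      have nz_iff: "U v \<noteq> {0} \<longleftrightarrow> v \<in> Source 1 ` A \<union> Sink 1 ` B" for v
      proof
        assume "U v \<noteq> {0}"
        then have "v \<in> nodes"
          using U01[of v] by blast
        then consider s where "v = Source 1 s" "s \<in> {1..a}" | t where "v = Sink 1 t" "t \<in> {1..b}"
          unfolding nodes_def by blast
        then show "v \<in> Source 1 ` A \<union> Sink 1 ` B"
        proof cases
          case 1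
          then have "s \<in> A"
            using \<open>U v \<noteq> {0}\<close> unfolding A_def by blast
          then show ?thesis
            using 1 by blast
        next
          case 2
          then have "t \<in> B"
            using \<open>U v \<noteq> {0}\<close> unfolding B_def by blast
          then show ?thesis
            using 2 by blast
        qed
      qed (auto simp: A_def B_def)
      have slope: "level_slope (dim_vec U) = real (card A) / (real (card A) + real (card B))"
      proof (rule level_slope_01[OF AB])
        show "dim_vec U v = 1" if "v \<in> Source 1 ` A \<union> Sink 1 ` B" for v
        proof -
          have "U v = cvec 1"
            using that nz_iff U01 by blast
          then show ?thesis
            using dim_cvec_1 by (simp only: dim_vec_def)
        qed
        show "dim_vec U v = 0" if "v \<notin> Source 1 ` A \<union> Sink 1 ` B" for v
        proof -
          have "U v = {0}"
            using that nz_iff by blast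
          then show ?thesis
            using dim_zero_space by (simp only: dim_vec_def)
        qed
      qed
      have ne: "A \<noteq> {} \<or> B \<noteq> {}"
        using nz nz_iff by auto
      have "card A * b < a * card B"
      proof (cases "A = {}")
        case True
        then show ?thesis
          using ne fin a by (simp add: card_gt_0_iff)
      next
        case False
        have "nbrs (support X) A \<subseteq> B"
        proof
          fix t
          assume "t \<in> nbrs (support X) A"
          then obtain s r where e: "s \<in> A" "edge s t r \<in> support X"
            by (auto simp: nbrs_def)
          then have ar: "edge s t r \<in> arcs Q" "edge s t r \<in> edges"
            using supp by (auto simp: edges_arcs)
          have ds: "d (Source 1 s) = 1"
            using e(1) AB by (auto simp: A_def)
          define u :: "nat \<Rightarrow> complex" where "u = (\<lambda>i. if i = 0 then 1 else 0)"
          have "u \<in> cvec 1"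
            by (simp add: u_def cvec_def)
          then have "u \<in> U (Source 1 s)"
            using e(1) U01[of "Source 1 s"] by (auto simp: A_def)
          moreover have "mat_app (d (tail Q (edge s t r))) (X (edge s t r)) ` U (tail Q (edge s t r)) \<subseteq> U (head Q (edge s t r))"
            using U ar(1) unfolding subrep_def by blast
          ultimately have mem: "mat_app 1 (X (edge s t r)) u \<in> U (Sink 1 t)"
            by (auto simp: ds simp del: One_nat_def trivial_partition.simps)
          have nz: "mat_app 1 (X (edge s t r)) u 0 \<noteq> 0"
            using e(2) by (simp add: mat_app_def u_def support_def)
          have "U (Sink 1 t) \<noteq> {0}"
          proof
            assume "U (Sink 1 t) = {0}"
            then have "mat_app 1 (X (edge s t r)) u = 0"
              using mem by blast
            then show False
              using nz by (simp only: zero_fun_apply simp_thms)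
          qed
          then show "t \<in> B"
            using ar(2) by (simp add: B_def)
        qed
        then have "card (nbrs (support X) A) \<le> card B"
          using fin card_mono by blast
        then have B: "k * card A < card B"
          using R[OF AB(1) False] by simp
        have "card A \<le> a"
          using AB(1) card_mono[of "{1..a}" A] by simp
        show ?thesis
        proof (cases "card A = a")
          \<comment> \<open>Then \<open>B\<close> has more than \<open>k * a\<close> elements, so it
            consists of all \<open>b\<close> sinks and \<open>U\<close> is not proper.\<close>
          case True
          have "card B \<le> b"
            using AB(2) card_mono[of "{1..b}" B] by simp
          then have "card B = b"
            using B True by (simp add: b_def)
          then have "A = {1..a}" "B = {1..b}"
            using True AB card_subset_eq[of "{1..a}" A] card_subset_eq[of "{1..b}" B] by auto
          then have "v \<in> nodes \<longleftrightarrow> U v \<noteq> {0}" for v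
            unfolding nz_iff by (simp add: nodes_def)
          then have "U v = cvec (d v)" for v
            using U01[of v] d_eq_1[of v] d_eq_0[of v] cvec_0 by (cases "v \<in> nodes") auto
          then show ?thesis
            using proper by blast
        next
          case False
          then have "card A < a"
            using \<open>card A \<le> a\<close> by simp
          have "card A * b = a * (k * card A) + card A"
            by (simp add: b_def algebra_simps)
          also have "\<dots> < a * (k * card A) + a"
            using \<open>card A < a\<close> by simp
          also have "\<dots> = a * Suc (k * card A)"
            by simp
          also have "\<dots> \<le> a * card B"
            using B by (intro mult_le_mono) auto
          finally show ?thesis .
        qed
      qed
      then show ?thesis
        using slope_less_iff[of "card A" "card B"] ne fin unfolding slope level_slope_d by (simp add: card_gt_0_iff)
    qed
    then show "stable_rep Q level_slope d X"
      unfolding stable_rep_def using X dpos by blast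
  qed
qed

end

lemma grounded_mono:
  assumes "s \<in> grounded D R C p" "D \<subseteq> D'" "\<And>s. s \<in> D \<Longrightarrow> p' s = p s"
  shows "s \<in> grounded D' R C p'"
  using assms(1)
proof induction
  case (base s)
  then show ?case
    using assms(2,3) by (intro grounded.base) auto
next
  case (step s s')
  then show ?case
    using assms(2,3) by (intro grounded.step[of s D' s']) auto
qed

section \<open>Rooted trees: their number and their role as minimal stable supports\<close>

context trivial_moduli
begin

text \<open>A place where another source can be attached: a child sink of \<open>s\<close> together
  with the label of the connecting arrow. With the label inside the slot, counting
  \<open>grounded_maps\<close> accounts for the \<open>m\<close> parallel arrows.\<close>

definition slots :: "(nat \<Rightarrow> nat) \<Rightarrow> nat \<Rightarrow> (nat \<times> nat) set" where
  "slots f s = {t \<in> {2..b}. f t = s} \<times> {..<m}"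

definition roots :: "(nat \<times> nat) set" where
  "roots = {1} \<times> {..<m}"

text \<open>A spanning tree all of whose sources have degree \<open>k + 1\<close>, rooted at the sink \<open>1\<close>: the sink
  \<open>t \<ge> 2\<close> is attached to its parent \<open>f t\<close> by the arrow with label \<open>l t\<close>, and \<open>p s\<close> consists of
  the parent of the source \<open>s\<close> and the label of the connecting arrow.\<close>
definition rooted_trees :: "((nat \<Rightarrow> nat) \<times> (nat \<Rightarrow> nat) \<times> (nat \<Rightarrow> nat \<times> nat)) set" where
  "rooted_trees = (SIGMA f:{f \<in> {2..b} \<rightarrow>\<^sub>E {1..a}. \<forall>s\<in>{1..a}. card {t \<in> {2..b}. f t = s} = k}.
      ({2..b} \<rightarrow>\<^sub>E {..<m}) \<times> grounded_maps {1..a} roots (slots f))"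

fun tree :: "(nat \<Rightarrow> nat) \<times> (nat \<Rightarrow> nat) \<times> (nat \<Rightarrow> nat \<times> nat) \<Rightarrow> level_arc set" where
  "tree (f, l, p) = (\<lambda>s. edge s (fst (p s)) (snd (p s))) ` {1..a} \<union> (\<lambda>t. edge (f t) t (l t)) ` {2..b}"

text \<open>There are \<open>fact (k * a) / fact k ^ a\<close> maps \<open>f\<close>, and each of
  the \<open>k * a\<close> sinks other than the root has \<open>m\<close> labels. The forest count
  with \<open>m\<close> root slots and \<open>k * m\<close> slots per source gives
  \<open>m * (m + k * m * a) ^ (a - 1) = m ^ a * b ^ (a - 1)\<close>.\<close>

lemma card_rooted_trees:
  "card rooted_trees * fact k ^ a = fact (k * a) * m ^ ((k + 1) * a) * b ^ (a - 1)"
proof -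
  define F where "F = {f \<in> {2..b} \<rightarrow>\<^sub>E {1..a}. \<forall>s\<in>{1..a}. card {t \<in> {2..b}. f t = s} = k}"
  have finF: "finite F"
    unfolding F_def by (rule finite_subset[OF _ finite_PiE[of "{2..b}" "\<lambda>_. {1..a}"]]) auto
  have finL: "finite ({2..b} \<rightarrow>\<^sub>E {..<m})"
    by (intro finite_PiE) auto
  have cardB: "card {2..b} = k * a"
    by (simp add: b_def)
  have G: "card (grounded_maps {1..a} roots (slots f)) = m ^ a * b ^ (a - 1)" if f: "f \<in> F" for f
  proof -
    have "card (grounded_maps {1..a} roots (slots f)) =
        (if {1..a} = {} then 1 else card roots * (card roots + k * m * card {1..a}) ^ (card {1..a} - 1))"
    proof (rule card_grounded_maps)
      show "finite (slots f s) \<and> card (slots f s) = k * m \<and> slots f s \<inter> roots = {}" if "s \<in> {1..a}" for s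
        using f that by (auto simp: F_def slots_def roots_def card_cartesian_product)
      show "disjoint_family_on (slots f) {1..a}"
        by (auto simp: disjoint_family_on_def slots_def)
    qed (auto simp: roots_def)
    also have "\<dots> = m * (m + k * m * a) ^ (a - 1)"
      using a by (simp add: roots_def card_cartesian_product)
    also have "m + k * m * a = m * b"
      by (simp add: b_def algebra_simps)
    also have "m * (m * b) ^ (a - 1) = m ^ Suc (a - 1) * b ^ (a - 1)"
      by (simp add: power_mult_distrib)
    finally show ?thesis
      using a by simp
  qed
  have L: "card ({2..b} \<rightarrow>\<^sub>E {..<m}) = m ^ (k * a)"
    by (simp add: card_PiE cardB del: card_atLeastAtMost)
  have finG: "finite (grounded_maps {1..a} roots (slots f))" for f
    unfolding grounded_maps_def
    by (rule finite_subset[OF _ finite_PiE[of "{1..a}" "\<lambda>_. roots \<union> \<Union>(slots f ` {1..a})"]])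
       (auto simp: roots_def slots_def)
  have "card rooted_trees = (\<Sum>f\<in>F. card (({2..b} \<rightarrow>\<^sub>E {..<m}) \<times> grounded_maps {1..a} roots (slots f)))"
    unfolding rooted_trees_def F_def[symmetric]
    using finF finL finG by (intro card_SigmaI ballI finite_cartesian_product)
  also have "\<dots> = (\<Sum>f\<in>F. m ^ (k * a) * (m ^ a * b ^ (a - 1)))"
    by (intro sum.cong refl) (simp only: card_cartesian_product G L)
  also have "\<dots> = card F * (m ^ (k * a) * (m ^ a * b ^ (a - 1)))"
    by simp
  finally have "card rooted_trees * fact k ^ a = (card F * fact k ^ a) * (m ^ (k * a) * (m ^ a * b ^ (a - 1)))"
    by simp
  also have "card F * fact k ^ a = fact (k * a)"
    using card_equal_fibres[of "{1..a}" "{2..b}" k] cardB unfolding F_def by simp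
  also have "m ^ (k * a) * (m ^ a * b ^ (a - 1)) = m ^ ((k + 1) * a) * b ^ (a - 1)"
    by (simp add: power_add algebra_simps)
  finally show ?thesis
    by (simp add: mult.assoc)
qed

lemma edge_in_tree:
  "edge s t r \<in> tree (f, l, p) \<longleftrightarrow> (s \<in> {1..a} \<and> p s = (t, r)) \<or> (t \<in> {2..b} \<and> f t = s \<and> l t = r)"
  unfolding tree.simps Un_iff image_iff edge_inject by (cases "p s") auto

lemma rooted_treesD:
  assumes "(f, l, p) \<in> rooted_trees"
  shows "f \<in> {2..b} \<rightarrow>\<^sub>E {1..a}" "l \<in> {2..b} \<rightarrow>\<^sub>E {..<m}"
    "\<And>s. s \<in> {1..a} \<Longrightarrow> card {t \<in> {2..b}. f t = s} = k"
    "\<And>t. t \<in> {2..b} \<Longrightarrow> f t \<in> {1..a}" "\<And>t. t \<in> {2..b} \<Longrightarrow> l t < m"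
    "p \<in> extensional {1..a}" "\<And>s. s \<in> {1..a} \<Longrightarrow> p s \<in> {1..b} \<times> {..<m}"
    "\<And>s. s \<in> {1..a} \<Longrightarrow> s \<in> grounded {1..a} roots (slots f) p"
proof -
  show f: "f \<in> {2..b} \<rightarrow>\<^sub>E {1..a}" and l: "l \<in> {2..b} \<rightarrow>\<^sub>E {..<m}"
    and "\<And>s. s \<in> {1..a} \<Longrightarrow> card {t \<in> {2..b}. f t = s} = k"
    using assms unfolding rooted_trees_def by blast+
  show "\<And>t. t \<in> {2..b} \<Longrightarrow> f t \<in> {1..a}"
    using f by (rule PiE_mem)
  show "l t < m" if "t \<in> {2..b}" for t
    using PiE_mem[OF l that] by simp
  have p: "p \<in> {1..a} \<rightarrow>\<^sub>E roots \<union> \<Union>(slots f ` {1..a})" and g: "{1..a} \<subseteq> grounded {1..a} roots (slots f) p"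
    using assms unfolding rooted_trees_def grounded_maps_def by blast+
  show "p \<in> extensional {1..a}"
    using p by (simp add: PiE_def)
  have sub: "roots \<union> \<Union>(slots f ` {1..a}) \<subseteq> {1..b} \<times> {..<m}"
    by (auto simp: roots_def slots_def b_def)
  show "p s \<in> {1..b} \<times> {..<m}" if "s \<in> {1..a}" for s
    by (rule subsetD[OF sub PiE_mem[OF p that]])
  show "\<And>s. s \<in> {1..a} \<Longrightarrow> s \<in> grounded {1..a} roots (slots f) p"
    by (rule subsetD[OF g])
qed

lemma slots_iff: "(t, r) \<in> slots f s \<longleftrightarrow> t \<in> {2..b} \<and> f t = s \<and> r < m"
  by (auto simp: slots_def)

lemma roots_iff: "(t, r) \<in> roots \<longleftrightarrow> t = 1 \<and> r < m"
  by (auto simp: roots_def)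

text \<open>A source attached below its own child could never be reached from the root. Hence the
  arrow to the parent differs from the arrows to the children, which makes the rooted data
  recoverable from the tree.\<close>

lemma not_own_parent: "s \<in> grounded A roots (slots f) p \<Longrightarrow> p s \<notin> slots f s"
proof (induction rule: grounded.induct)
  case (base s)
  then show ?case
    by (cases "p s") (auto simp: slots_iff roots_iff)
next
  case (step s s')
  show ?case
  proof
    assume "p s \<in> slots f s"
    then have "s = s'"
      using step.hyps(3) by (cases "p s") (auto simp: slots_iff)
    then show False
      using step by simp
  qed
qed

text \<open>Parents of sources are recovered by induction from the root. Suppose that the arrow from
  \<open>s\<close> to its parent sink \<open>t\<close> were a child arrow of \<open>s\<close> for
  the second triple. Then the arrow between \<open>t\<close> and its own parent \<open>s'\<close>
  would have to be the parent arrow of \<open>s'\<close>, against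
  \<open>not_own_parent\<close>.\<close>

lemma tree_inj: "inj_on tree rooted_trees"
proof (rule inj_onI)
  fix \<sigma> \<sigma>'
  assume \<sigma>: "\<sigma> \<in> rooted_trees" "\<sigma>' \<in> rooted_trees" "tree \<sigma> = tree \<sigma>'"
  obtain f l p f' l' p' where eqs: "\<sigma> = (f, l, p)" "\<sigma>' = (f', l', p')"
    by (metis prod_cases3)
  have R: "(f, l, p) \<in> rooted_trees" and R': "(f', l', p') \<in> rooted_trees"
    and eq: "tree (f, l, p) = tree (f', l', p')"
    using \<sigma> by (simp_all only: eqs)
  note D = rooted_treesD[OF R] and D' = rooted_treesD[OF R']
  have mem: "(s \<in> {1..a} \<and> p' s = (t, r)) \<or> (t \<in> {2..b} \<and> f' t = s \<and> l' t = r)"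
    if "(s \<in> {1..a} \<and> p s = (t, r)) \<or> (t \<in> {2..b} \<and> f t = s \<and> l t = r)" for s t r
    using that eq edge_in_tree[of s t r f l p] edge_in_tree[of s t r f' l' p'] by simp
  have p: "p' s = p s" if "s \<in> grounded {1..a} roots (slots f) p" for s
    using that
  proof (induction rule: grounded.induct)
    case (base s)
    then obtain r where "p s = (1, r)"
      by (cases "p s") (auto simp: roots_iff)
    then show ?case
      using mem[of s 1 r] base.hyps by auto
  next
    case (step s s')
    obtain t r where ps: "p s = (t, r)"
      by (cases "p s")
    then have t: "t \<in> {2..b}" "f t = s'"
      using step.hyps(3) by (auto simp: slots_iff)
    show ?case
    proof (rule ccontr)
      assume neq: "p' s \<noteq> p s"
      then have "f' t = s"
        using mem[of s t r] ps step.hyps(1) by auto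
      have "p' s' = (t, l t) \<or> f' t = s'"
        using mem[of s' t "l t"] t by auto
      then show False
      proof
        assume "p' s' = (t, l t)"
        then have "p s' \<in> slots f s'"
          using step.IH t D(5) by (simp add: slots_iff)
        then show False
          using not_own_parent step.hyps(2) by blast
      next
        assume "f' t = s'"
        then show False
          using \<open>f' t = s\<close> step.IH neq by simp
      qed
    qed
  qed
  have pp: "p' s = p s" if "s \<in> {1..a}" for s
    using p D(8)[OF that] by blast
  have fl: "f' t = f t \<and> l' t = l t" if t: "t \<in> {2..b}" for t
  proof (rule ccontr)
    assume "\<not> (f' t = f t \<and> l' t = l t)"
    then have "p' (f t) = (t, l t)"
      using mem[of "f t" t "l t"] t by auto
    then have "p (f t) \<in> slots f (f t)"
      using pp D(4)[OF t] D(5)[OF t] t by (simp add: slots_iff)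
    then show False
      using not_own_parent D(8)[OF D(4)[OF t]] by blast
  qed
  have "f' = f"
    using fl by (intro PiE_ext[OF D'(1) D(1)]) blast
  moreover have "l' = l"
    using fl by (intro PiE_ext[OF D'(2) D(2)]) blast
  moreover have "p' = p"
    using pp by (intro extensionalityI[OF D'(6) D(6)]) blast
  ultimately show "\<sigma> = \<sigma>'"
    by (simp only: eqs)
qed

lemma tree_sub_edges:
  assumes "(f, l, p) \<in> rooted_trees"
  shows "tree (f, l, p) \<subseteq> edges"
proof -
  note D = rooted_treesD[OF assms]
  have "edge s (fst (p s)) (snd (p s)) \<in> edges" if "s \<in> {1..a}" for s
    using D(7)[OF that] that by (auto simp: mem_Times_iff)
  moreover have "edge (f t) t (l t) \<in> edges" if "t \<in> {2..b}" for t
    using D(4,5)[OF that] that by auto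
  ultimately show ?thesis
    by auto
qed

text \<open>A largest subtree containing the root sink is closed under the arrows of
  \<open>tree (f, l, p)\<close> and reaches all nodes, since every source is grounded. It then has
  \<open>a + b - 1\<close> arrows, and \<open>tree (f, l, p)\<close> has no more than that.\<close>

lemma tree_span:
  assumes R: "(f, l, p) \<in> rooted_trees"
  shows "span_tree (tail Q) (head Q) nodes (tree (f, l, p))"
proof -
  note D = rooted_treesD[OF R]
  define P where "P W \<longleftrightarrow> W \<subseteq> nodes \<and> Sink 1 1 \<in> W \<and>
    (\<exists>T\<subseteq>tree (f, l, p). span_tree (tail Q) (head Q) W T)" for W
  have fin: "finite nodes"
    by (simp add: nodes_def)
  have P1: "P {Sink 1 1}"
    unfolding P_def by (auto simp: nodes_def b_def intro!: exI[of _ "{}"] span_tree.root)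
  have P2: "\<forall>W. P W \<longrightarrow> card W < Suc (card nodes)"
    using fin by (auto simp: P_def less_Suc_eq_le intro: card_mono)
  have "\<exists>W. P W \<and> (\<forall>W'. P W' \<longrightarrow> card W' \<le> card W)"
    by (rule ex_has_greatest_nat[OF P1 P2])
  then obtain W where W: "P W" and max: "\<And>W'. P W' \<Longrightarrow> card W' \<le> card W"
    by (elim exE conjE) simp
  obtain T where T: "T \<subseteq> tree (f, l, p)" "span_tree (tail Q) (head Q) W T"
    using W by (auto simp: P_def)
  have finW: "finite W"
    using W fin finite_subset by (auto simp: P_def)
  have closed: "w \<in> W" if w: "w \<in> nodes" and v: "v \<in> W" and e: "e \<in> tree (f, l, p)"
    and ends: "(tail Q e = v \<and> head Q e = w) \<or> (tail Q e = w \<and> head Q e = v)" for v w e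
  proof (rule ccontr)
    assume nw: "w \<notin> W"
    have "span_tree (tail Q) (head Q) (insert w W) (insert e T)"
      by (rule span_tree.grow[OF T(2) v nw ends])
    then have "P (insert w W)"
      using W w T e unfolding P_def by blast
    from max[OF this] show False
      using nw finW by simp
  qed
  have sink: "Sink 1 t \<in> W" if t: "t \<in> {2..b}" and s: "Source 1 (f t) \<in> W" for t
  proof (rule closed[OF _ s])
    show "edge (f t) t (l t) \<in> tree (f, l, p)"
      using t by (simp add: edge_in_tree del: tree.simps)
  qed (use t in \<open>auto simp: nodes_def\<close>)
  have source: "Source 1 s \<in> W" if "s \<in> grounded {1..a} roots (slots f) p" for s
    using that
  proof (induction rule: grounded.induct)
    case (base s)
    then obtain r where ps: "p s = (1, r)"
      by (cases "p s") (auto simp: roots_iff)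
    show ?case
    proof (rule closed[of _ "Sink 1 1"])
      show "edge s 1 r \<in> tree (f, l, p)"
        using base ps by (simp add: edge_in_tree del: tree.simps)
    qed (use base W in \<open>auto simp: nodes_def P_def\<close>)
  next
    case (step s s')
    obtain t r where ps: "p s = (t, r)"
      by (cases "p s")
    then have t: "t \<in> {2..b}" "f t = s'"
      using step.hyps(3) by (auto simp: slots_iff)
    show ?case
    proof (rule closed[of _ "Sink 1 t"])
      show "Sink 1 t \<in> W"
        using sink[OF t(1)] t(2) step.IH by simp
      show "edge s t r \<in> tree (f, l, p)"
        using step.hyps(1) ps by (simp add: edge_in_tree del: tree.simps)
    qed (use step.hyps(1) in \<open>auto simp: nodes_def\<close>)
  qed
  have "nodes \<subseteq> W"
  proof
    fix v
    assume "v \<in> nodes"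
    then consider s where "v = Source 1 s" "s \<in> {1..a}" | t where "v = Sink 1 t" "t \<in> {1..b}"
      unfolding nodes_def by blast
    then show "v \<in> W"
    proof cases
      case 1
      then show ?thesis
        using source D(8) by simp
    next
      case 2
      show ?thesis
      proof (cases "t = 1")
        case True
        then show ?thesis
          using W 2 by (simp add: P_def)
      next
        case False
        then have "t \<in> {2..b}"
          using 2 by auto
        then show ?thesis
          using sink source D(8) D(4) 2 by blast
      qed
    qed
  qed
  then have "W = nodes"
    using W by (auto simp: P_def)
  then have "Suc (card T) = a + b"
    using span_tree_card[OF T(2)] card_nodes by simp
  moreover have "card (tree (f, l, p)) \<le> a + (b - 1)"
  proof -
    have "card (tree (f, l, p)) \<le> card ((\<lambda>s. edge s (fst (p s)) (snd (p s))) ` {1..a}) + card ((\<lambda>t. edge (f t) t (l t)) ` {2..b})"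
      unfolding tree.simps by (rule card_Un_le)
    also have "\<dots> \<le> card {1..a} + card {2..b}"
      by (intro add_mono card_image_le) auto
    finally show ?thesis
      by simp
  qed
  moreover have "b \<ge> 1"
    by (simp add: b_def)
  ultimately have "T = tree (f, l, p)"
    using T(1) by (intro card_seteq) auto
  then show ?thesis
    using T(2) \<open>W = nodes\<close> by simp
qed

lemma card_children:
  assumes "\<And>s. s \<in> {1..a} \<Longrightarrow> card {t \<in> {2..b}. f t = s} = k" "A \<subseteq> {1..a}"
  shows "card {t \<in> {2..b}. f t \<in> A} = k * card A"
proof -
  have fin: "finite A"
    using assms(2) finite_subset by blast
  have "{t \<in> {2..b}. f t \<in> A} = (\<Union>s\<in>A. {t \<in> {2..b}. f t = s})"
    by auto
  also have "card \<dots> = (\<Sum>s\<in>A. card {t \<in> {2..b}. f t = s})"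
    using fin by (intro card_UN_disjoint) auto
  also have "\<dots> = (\<Sum>s\<in>A. k)"
    using assms by (intro sum.cong) auto
  finally show ?thesis
    by simp
qed

text \<open>The sources in \<open>A\<close> have \<open>k * card A\<close> children, and some source
  in \<open>A\<close> has its parent outside these children, as otherwise no source in
  \<open>A\<close> could be grounded. This parent is the additional neighbour.\<close>

lemma tree_stable:
  assumes R: "(f, l, p) \<in> rooted_trees"
  shows "nonzero_on (tree (f, l, p)) \<subseteq> stable_locus"
proof
  note D = rooted_treesD[OF R]
  fix X
  assume X: "X \<in> nonzero_on (tree (f, l, p))"
  then have supp: "tree (f, l, p) \<subseteq> support X"
    using tree_sub_edges[OF R] by (auto simp: nonzero_on_def support_def simp del: tree.simps)
  have "k * card A < card (nbrs (support X) A)" if A: "A \<subseteq> {1..a}" "A \<noteq> {}" for A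
  proof -
    define K where "K = {t \<in> {2..b}. f t \<in> A}"
    have "\<exists>s\<in>A. fst (p s) \<notin> K"
    proof (rule ccontr)
      assume all: "\<not> (\<exists>s\<in>A. fst (p s) \<notin> K)"
      have "s \<notin> A" if "s \<in> grounded {1..a} roots (slots f) p" for s
        using that
      proof (induction rule: grounded.induct)
        case (base s)
        show ?case
        proof
          assume "s \<in> A"
          then have "fst (p s) \<in> {2..b}"
            using all by (auto simp: K_def)
          then show False
            using base.hyps(2) by (cases "p s") (auto simp: roots_iff)
        qed
      next
        case (step s s')
        show ?case
        proof
          assume "s \<in> A"
          then have "f (fst (p s)) \<in> A"
            using all by (auto simp: K_def)
          then show False
            using step.hyps(3) step.IH by (cases "p s") (auto simp: slots_iff)
        qed
      qed
      then show False
        using A D(8) by blast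
    qed
    then obtain s0 where s0: "s0 \<in> A" "fst (p s0) \<notin> K"
      by blast
    have "insert (fst (p s0)) K \<subseteq> nbrs (support X) A"
    proof -
      have "edge s0 (fst (p s0)) (snd (p s0)) \<in> tree (f, l, p)"
        using s0 A by (auto simp: edge_in_tree simp del: tree.simps)
      then have "fst (p s0) \<in> nbrs (support X) A"
        using supp s0 unfolding nbrs_def by blast
      moreover have "t \<in> nbrs (support X) A" if "t \<in> K" for t
      proof -
        have "edge (f t) t (l t) \<in> tree (f, l, p)" "f t \<in> A"
          using that by (auto simp: edge_in_tree K_def simp del: tree.simps)
        then show ?thesis
          using supp unfolding nbrs_def by blast
      qed
      ultimately show ?thesis
        by blast
    qed
    moreover have sE: "support X \<subseteq> edges"
      by (auto simp: support_def)
    have "finite (nbrs (support X) A)"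
      by (rule finite_subset[OF nbrs_sub[OF sE]]) simp
    ultimately have "card (insert (fst (p s0)) K) \<le> card (nbrs (support X) A)"
      by (intro card_mono)
    moreover have "card (insert (fst (p s0)) K) = Suc (k * card A)"
      using s0(2) card_children[OF D(3) A(1)] by (simp add: K_def)
    ultimately show ?thesis
      by simp
  qed
  then show "X \<in> stable_locus"
    using X by (simp add: stable_locus_def stable_iff nonzero_on_def)
qed

text \<open>Removing the sink 1 costs each neighbourhood at most one element, so the stability
  inequality yields the hypothesis of \<open>disjoint_subsets_of_card\<close>, which hands out the
  children. The inequality is used a second time to attach the sources one after the other.\<close>

lemma stable_contains_tree:
  assumes X: "X \<in> stable_locus"
  shows "\<exists>\<sigma>\<in>rooted_trees. X \<in> nonzero_on (tree \<sigma>)"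
proof -
  define F where "F = support X"
  have XR: "X \<in> rep_space Q d" and nbr: "\<And>A. A \<subseteq> {1..a} \<Longrightarrow> A \<noteq> {} \<Longrightarrow> k * card A < card (nbrs F A)"
    using X unfolding stable_locus_def mem_Collect_eq stable_iff F_def by blast+
  have FE: "F \<subseteq> edges"
    by (auto simp: F_def support_def)
  have F_range: "s \<in> {1..a}" "t \<in> {1..b}" "r < m" if "edge s t r \<in> F" for s t r
    using subsetD[OF FE that] by auto
  define N where "N s = nbrs F {s} - {1}" for s
  have NU: "\<Union>(N ` A) = nbrs F A - {1}" for A
    by (auto simp: N_def nbrs_def)
  have N_sub: "N s \<subseteq> {2..b}" for s
    using nbrs_sub[OF FE, of "{s}"] by (force simp: N_def subset_iff)
  have "\<exists>C. (\<forall>i\<in>{1..a}. C i \<subseteq> N i \<and> card (C i) = k) \<and> disjoint_family_on C {1..a}"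
  proof (rule disjoint_subsets_of_card)
    show "finite (N i)" for i
      by (rule finite_subset[OF N_sub]) simp
    show "k * card A \<le> card (\<Union>(N ` A))" if "A \<subseteq> {1..a}" for A
    proof (cases "A = {}")
      case False
      have "card (nbrs F A) - 1 \<le> card (nbrs F A - {1})"
        by (simp add: card_Diff_singleton_if)
      then show ?thesis
        using nbr[OF that False] unfolding NU by linarith
    qed simp
  qed simp
  then obtain C where C: "\<And>i. i \<in> {1..a} \<Longrightarrow> C i \<subseteq> N i" "\<And>i. i \<in> {1..a} \<Longrightarrow> card (C i) = k"
    and disj: "disjoint_family_on C {1..a}"
    by blast
  have C_sub: "C i \<subseteq> {2..b}" if "i \<in> {1..a}" for i
    using C(1)[OF that] N_sub by blast
  \<comment> \<open>The disjoint sets have \<open>k * a\<close> elements in all, as many as there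
    are sinks other than the root, so each such sink is a child of some source.\<close>
  have "(\<Union>i\<in>{1..a}. C i) = {2..b}"
  proof (rule card_seteq)
    have "card (\<Union>i\<in>{1..a}. C i) = (\<Sum>i\<in>{1..a}. card (C i))"
    proof (rule card_UN_disjoint)
      show "\<forall>i\<in>{1..a}. finite (C i)"
        by (intro ballI finite_subset[OF C_sub]) auto
      show "\<forall>i\<in>{1..a}. \<forall>j\<in>{1..a}. i \<noteq> j \<longrightarrow> C i \<inter> C j = {}"
        using disj unfolding disjoint_family_on_def by blast
    qed simp
    also have "\<dots> = (\<Sum>i\<in>{1..a}. k)"
      using C(2) by (intro sum.cong) auto
    also have "\<dots> = card {2..b}"
      by (simp add: b_def)
    finally show "card {2..b} \<le> card (\<Union>i\<in>{1..a}. C i)"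
      by simp
    show "(\<Union>i\<in>{1..a}. C i) \<subseteq> {2..b}"
      using C_sub by (rule UN_least)
  qed simp
  then have "\<forall>t\<in>{2..b}. \<exists>s. s \<in> {1..a} \<and> t \<in> C s"
    by blast
  from bchoice[OF this] obtain f0 where f0: "\<And>t. t \<in> {2..b} \<Longrightarrow> f0 t \<in> {1..a}" "\<And>t. t \<in> {2..b} \<Longrightarrow> t \<in> C (f0 t)"
    by blast
  define f where "f = restrict f0 {2..b}"
  have f: "f t = f0 t" if "t \<in> {2..b}" for t
    using that by (simp add: f_def)
  have fibre: "{t \<in> {2..b}. f t = s} = C s" if "s \<in> {1..a}" for s
  proof
    show "C s \<subseteq> {t \<in> {2..b}. f t = s}"
    proof
      fix t
      assume t: "t \<in> C s"
      then have t2: "t \<in> {2..b}"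
        using C_sub[OF that] by blast
      have "f0 t = s"
      proof (rule ccontr)
        assume "f0 t \<noteq> s"
        then have "C (f0 t) \<inter> C s = {}"
          using disj f0(1)[OF t2] that unfolding disjoint_family_on_def by blast
        then show False
          using t f0(2)[OF t2] by blast
      qed
      then show "t \<in> {t \<in> {2..b}. f t = s}"
        using t2 f by simp
    qed
  qed (use f f0 in auto)
  have card_fibre: "card {t \<in> {2..b}. f t = s} = k" if "s \<in> {1..a}" for s
    using fibre[OF that] C(2)[OF that] by simp
  have "\<forall>t\<in>{2..b}. \<exists>r. edge (f t) t r \<in> F"
  proof
    fix t :: nat
    assume t: "t \<in> {2..b}"
    have "t \<in> N (f0 t)"
      using C(1)[OF f0(1)[OF t]] f0(2)[OF t] by blast
    then show "\<exists>r. edge (f t) t r \<in> F"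
      using f[OF t] by (auto simp: N_def nbrs_def)
  qed
  from bchoice[OF this] obtain l0 where l0: "\<And>t. t \<in> {2..b} \<Longrightarrow> edge (f t) t (l0 t) \<in> F"
    by blast
  \<comment> \<open>\<open>D\<close> is the set of sources attached so far, grounded within itself.
    As its complement \<open>A\<close> has more than \<open>k * card A\<close> neighbours, some
    arrow leads from \<open>A\<close> to a sink that is not a child of \<open>A\<close>, hence to
    the root or to a child of \<open>D\<close>.\<close>
  have "\<exists>D p. D \<subseteq> {1..a} \<and> card D = n \<and> (\<forall>s\<in>D. edge s (fst (p s)) (snd (p s)) \<in> F) \<and>
      D \<subseteq> grounded D roots (slots f) p" if "n \<le> a" for n
    using that
  proof (induction n)
    case 0
    show ?case
      by (intro exI[of _ "{}"]) auto
  next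
    case (Suc n)
    then obtain D p where D: "D \<subseteq> {1..a}" "card D = n" and DF: "\<And>s. s \<in> D \<Longrightarrow> edge s (fst (p s)) (snd (p s)) \<in> F"
      and DG: "D \<subseteq> grounded D roots (slots f) p"
      by auto
    have finD: "finite D"
      by (rule finite_subset[OF D(1)]) simp
    define A where "A = {1..a} - D"
    have cardA: "card A = a - n"
      using D finD by (simp add: A_def card_Diff_subset)
    have A: "A \<subseteq> {1..a}" "A \<noteq> {}"
    proof -
      show "A \<subseteq> {1..a}"
        by (auto simp: A_def)
      have "card A > 0"
        using cardA Suc.prems by simp
      then show "A \<noteq> {}"
        by (metis card.empty less_irrefl)
    qed
    define K where "K = {t \<in> {2..b}. f t \<in> A}"
    have "\<not> nbrs F A \<subseteq> K"
    proof
      assume "nbrs F A \<subseteq> K"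
      then have "card (nbrs F A) \<le> card K"
        by (intro card_mono) (auto simp: K_def)
      then show False
        using nbr[OF A] card_children[OF card_fibre A(1)] by (simp add: K_def)
    qed
    then obtain s t r where e: "s \<in> A" "edge s t r \<in> F" "t \<notin> K"
      by (auto simp: nbrs_def)
    note range = F_range[OF e(2)]
    have sD: "s \<notin> D"
      using e(1) by (simp add: A_def)
    let ?p = "p(s := (t, r))"
    have mono: "u \<in> grounded (insert s D) roots (slots f) ?p" if "u \<in> D" for u
    proof (rule grounded_mono[OF subsetD[OF DG that]])
      show "?p v = p v" if "v \<in> D" for v
        using that sD by auto
    qed blast
    have "s \<in> grounded (insert s D) roots (slots f) ?p"
    proof (cases "t = 1")
      case True
      then show ?thesis
        using range by (intro grounded.base) (auto simp: roots_iff)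
    next
      case False
      then have t: "t \<in> {2..b}"
        using range by auto
      then have "f t \<in> D"
        using e(3) f f0(1) by (auto simp: K_def A_def)
      then show ?thesis
        using mono t range by (intro grounded.step[of s _ "f t"]) (auto simp: slots_iff)
    qed
    moreover have "card (insert s D) = Suc n"
      using D finD sD by simp
    moreover have "edge u (fst (?p u)) (snd (?p u)) \<in> F" if "u \<in> insert s D" for u
      using that DF e(2) by auto
    moreover have "insert s D \<subseteq> {1..a}"
      using D range by blast
    ultimately show ?case
      using mono by (intro exI[of _ "insert s D"] exI[of _ ?p]) blast
  qed
  from this[of a] obtain D p0 where D: "D \<subseteq> {1..a}" "card D = a"
    and p0F: "\<And>s. s \<in> D \<Longrightarrow> edge s (fst (p0 s)) (snd (p0 s)) \<in> F" and p0G: "D \<subseteq> grounded D roots (slots f) p0"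
    by auto
  have Da: "D = {1..a}"
    using D by (intro card_subset_eq) auto
  define p where "p = restrict p0 {1..a}"
  define l where "l = restrict l0 {2..b}"
  have p: "p s = p0 s" if "s \<in> {1..a}" for s
    using that by (simp add: p_def)
  have pF: "edge s (fst (p s)) (snd (p s)) \<in> F" if "s \<in> {1..a}" for s
    using p0F[of s] p[OF that] that Da by simp
  have lF: "edge (f t) t (l t) \<in> F" if "t \<in> {2..b}" for t
    using l0[OF that] that by (simp add: l_def)
  have "(f, l, p) \<in> rooted_trees"
    unfolding rooted_trees_def
  proof (intro SigmaI)
    show "f \<in> {f \<in> {2..b} \<rightarrow>\<^sub>E {1..a}. \<forall>s\<in>{1..a}. card {t \<in> {2..b}. f t = s} = k}"
      using f0(1) card_fibre unfolding f_def by (intro CollectI conjI ballI restrict_PiE_iff[THEN iffD2]) auto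
    show "l \<in> {2..b} \<rightarrow>\<^sub>E {..<m}"
      unfolding l_def using F_range(3)[OF l0] by (intro restrict_PiE_iff[THEN iffD2]) auto
    have "p0 s \<in> roots \<union> \<Union>(slots f ` {1..a})" if s: "s \<in> {1..a}" for s
    proof -
      obtain t r where ps: "p0 s = (t, r)"
        by (cases "p0 s")
      have range: "t \<in> {1..b}" "r < m"
        using F_range[OF p0F[of s]] s Da ps by auto
      show ?thesis
      proof (cases "t = 1")
        case True
        then show ?thesis
          using ps range by (simp add: roots_iff)
      next
        case False
        then have "t \<in> {2..b}"
          using range by auto
        then show ?thesis
          using ps range f f0(1) by (intro UnI2 UN_I[of "f t"]) (simp_all add: slots_iff)
      qed
    qed
    then have "p \<in> {1..a} \<rightarrow>\<^sub>E roots \<union> \<Union>(slots f ` {1..a})"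
      unfolding p_def by (intro restrict_PiE_iff[THEN iffD2] ballI)
    moreover have "s \<in> grounded {1..a} roots (slots f) p" if "s \<in> {1..a}" for s
    proof (rule grounded_mono)
      show "s \<in> grounded {1..a} roots (slots f) p0"
        using p0G that unfolding Da by blast
    qed (use p in auto)
    ultimately show "p \<in> grounded_maps {1..a} roots (slots f)"
      unfolding grounded_maps_def by blast
  qed
  moreover have "X \<in> nonzero_on (tree (f, l, p))"
  proof -
    have "tree (f, l, p) \<subseteq> F"
      using pF lF by auto
    then show ?thesis
      using XR by (auto simp: nonzero_on_def F_def support_def simp del: tree.simps)
  qed
  ultimately show ?thesis
    by blast
qed

proposition has_euler_M: "has_euler M (int (card rooted_trees))"
proof -
  have "has_euler M (int (card (tree ` rooted_trees)))"
  proof (rule has_euler_moduli)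
    show "span_tree (tail Q) (head Q) nodes T \<and> T \<subseteq> edges \<and> nonzero_on T \<subseteq> stable_locus"
      if T: "T \<in> tree ` rooted_trees" for T
    proof -
      obtain f l p where "T = tree (f, l, p)" "(f, l, p) \<in> rooted_trees"
        using T by (metis imageE prod_cases3)
      then show ?thesis
        using tree_span tree_sub_edges tree_stable by (simp del: tree.simps)
    qed
    show "\<exists>T\<in>tree ` rooted_trees. X \<in> nonzero_on T" if "X \<in> stable_locus" for X
      using stable_contains_tree[OF that] by blast
  qed
  then show ?thesis
    by (simp add: card_image[OF tree_inj])
qed

end

theorem theorem5p4:
  fixes a k m :: nat
  assumes "a \<ge> 1" and "k \<ge> 1" and "m \<ge> 1"
  defines "M \<equiv> stable_moduli (level_quiver m) level_slope (trivial_partition a (k * a + 1))"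
  shows "finite_cohomology M \<and>
    real_of_int (euler_characteristic M) =
      real m ^ ((k + 1) * a) * (fact (k * a) / real (k * a + 1)) *
        (real (k * a + 1) / fact k) ^ a"
proof -
  have loc: "trivial_moduli a"
    by unfold_locales (rule assms(1))
  define \<tau> where "\<tau> = card (trivial_moduli.rooted_trees a k m)"
  define B where "B = k * a + 1"
  have B: "trivial_moduli.b a k = B"
    by (simp add: trivial_moduli.b_def[OF loc] B_def)
  have "has_euler M (int \<tau>)"
    using trivial_moduli.has_euler_M[OF loc, where k = k and m = m] unfolding M_def \<tau>_def B B_def .
  note euler = has_euler_imp_cohomology[OF this]
  have "\<tau> * fact k ^ a = fact (k * a) * m ^ ((k + 1) * a) * B ^ (a - 1)"
    using trivial_moduli.card_rooted_trees[OF loc, where k = k and m = m] unfolding \<tau>_def B .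
  then have "real (\<tau> * fact k ^ a) = real (fact (k * a) * m ^ ((k + 1) * a) * B ^ (a - 1))"
    by (simp only:)
  then have "real \<tau> * fact k ^ a = fact (k * a) * real m ^ ((k + 1) * a) * real B ^ (a - 1)"
    by (simp only: of_nat_mult of_nat_power of_nat_fact)
  then have "real \<tau> = fact (k * a) * real m ^ ((k + 1) * a) * real B ^ (a - 1) / fact k ^ a"
    by (simp add: eq_divide_eq)
  \<comment> \<open>As \<open>a\<close> is positive, the exponent can be raised to \<open>a\<close>
    at the cost of the denominator \<open>k * a + 1\<close> in the stated formula.\<close>
  also have "real B ^ (a - 1) = real B ^ a / real B"
  proof -
    have "real B ^ a = real B * real B ^ (a - 1)"
      using assms(1) by (metis Suc_diff_1 less_eq_Suc_le One_nat_def power_Suc)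
    moreover have "real B \<noteq> 0"
      by (simp only: B_def of_nat_eq_0_iff add_eq_0_iff_both_eq_0 one_neq_zero simp_thms)
    ultimately show ?thesis
      by simp
  qed
  finally have "real \<tau> = real m ^ ((k + 1) * a) * (fact (k * a) / real B) * (real B / fact k) ^ a"
    by (simp add: power_divide mult.commute)
  with euler show ?thesis
    by (simp add: B_def)
qed

end
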